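(* Let $K$ be a field of characteristic $2$, and let $F|K=K(z,y)|K$ and $F'|K=K(z',y')|K$ be two function fields that are both of type (a), both of type (b), or both of type (c), where the types are the ones defined in the context; denote by $a,b,c,d$ the constants of $F|K$ and by $a',b',c',d'$ those of $F'|K$ (no $d,d'$ in type (b)). (a) If $F|K$ and $F'|K$ are of type (a), then they are isomorphic over $K$ if and only if there exist constants $\mu_2,\mu_3,\mu_4,\mu_5\in K$ satisfying $(\mu_4,\mu_5)\neq(0,0)$ and $$\varepsilon^6 a' = a+\gamma^2,\qquad \varepsilon^3 b' = b,\qquad c'=\varepsilon c,$$ $$d' = \varepsilon(\mu_4\mu_5+\mu_3^2)^2 b + \varepsilon^2(\mu_4\mu_5+\mu_3^2)+\varepsilon^2(\mu_5^2b^2c^3+\varepsilon d),$$ where $\varepsilon:=\mu_4^2+\mu_5^2a\neq0$ and $\gamma:=\varepsilon^{-1}(\mu_2^2+\mu_3^2a)$. The corresponding $K$-isomorphisms $F'\to F$ are given by $$z'\mapsto\frac1{\varepsilon^3}\Big(\gamma+\frac{\mu_5a+\mu_4z}{\mu_4+\mu_5z}\Big),\qquad y'\mapsto\frac1{\varepsilon^2}\Big(\mu_2+\frac{\mu_3(\mu_5a+\mu_4z)+\varepsilon y}{\mu_4+\mu_5z}\Big).$$ (b) If $F|K$ and $F'|K$ are of type (b), then they are isomorphic over $K$ if and only if there exist constants $\mu_1,\mu_2,\mu_4,\mu_5\in K$ satisfying $(\mu_4,\mu_5)\neq(0,0)$ and $$a'=\varepsilon^2a+\varepsilon\mu_4\mu_5+\mu_2^4+\mu_5^4(c+ab^2),\qquad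 \varepsilon^4b'=b,$$ $$\varepsilon^6c'=c+\gamma^2+(\varepsilon\mu_4\mu_5+\mu_2^4)\varepsilon^{-2}b^2+\varepsilon^{-2}\mu_5^4(c+ab^2)b^2,$$ where $\varepsilon:=\mu_4^2+\mu_5^2b\neq0$ and $\gamma:=\varepsilon^{-1}(\mu_1^2+\mu_2^2b)$. The corresponding $K$-isomorphisms $F'\to F$ are given by $$z'\mapsto\frac1{\varepsilon^2}\Big(\frac{\mu_5b+\mu_4z}{\mu_4+\mu_5z}\Big),\qquad y'\mapsto\frac1{\varepsilon^2}\Big(\mu_1+\frac{\mu_2(\mu_5b+\mu_4z)+\varepsilon y}{\mu_4+\mu_5z}\Big).$$ (c) If $F|K$ and $F'|K$ are of type (c), then they are isomorphic over $K$ if and only if there exist constants $\mu_2,\mu_3,\mu_4,\mu_5\in K$ satisfying $(\mu_4,\mu_5)\neq(0,0)$ and $$a'=\varepsilon^2\,\frac{ab^2}{(b+\gamma^2)^2},\qquad \varepsilon^2b'=b+\gamma^2,\qquad d'=\varepsilon d,$$ $$c'=\varepsilon^2(c+a)+(\mu_3^2+\mu_4\mu_5)^2+\varepsilon d(\mu_3^2+\mu_4\mu_5)+ab^2\Big(\mu_5^4+\frac{\varepsilon^2}{(b+\gamma^2)^2}\Big),$$ where $\varepsilon:=\mu_4^2+\mu_5^2b\neq0$ and $\gamma:=\varepsilon^{-1}(\mu_2^2+\mu_3^2b)$. The corresponding $K$-isomorphisms $F'\to F$ are given by $$z'\mapsto\frac1\varepsilon\Big(\gamma+\frac{\mu_5b+\mu_4z}{\mu_4+\mu_5z}\Big),\qquad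 y'\mapsto\frac1\varepsilon\Big(\mu_2+\frac{\mu_3(\mu_5b+\mu_4z)+\varepsilon y}{\mu_4+\mu_5z}\Big).$$
   Context: $K^2$ denotes the set of squares of $K$. A function field $F|K=K(z,y)|K$ is of one of the following types if $z$ is transcendental over $K$ and the generators satisfy the irreducible equation: Type (a): $b y^4 + d z^4 + y^2 z^2 + z^3 + (b + b^2 c^3) z^2 + a y^2 + a z + a b^2 c^3 + a^2 d = 0$, with $a,b,c,d\in K$, $a\notin K^2$, $b,c\neq0$. Type (b): $y^4 + a z^4 + z^3 + b z + c = 0$, with $a,b,c\in K$, $b\notin K^2$. Type (c): $y^4 + d z^2 y^2 + (c+a) z^4 + d z^3 + bd\, y^2 + z^2 + bd\, z + b^2 c = 0$, with $a,b,c,d\in K$, $a,b\notin K^2$, $d\neq0$. For $F'|K$ the same equations hold with $z',y',a',b',c',d'$ in place of $z,y,a,b,c,d$. The inequality $\varepsilon\ne0$ is automatic from $(\mu_4,\mu_5)\ne(0,0)$ and the non-square condition. *)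

theory Defs
  imports "HOL-Computational_Algebra.Computational_Algebra" "Subresultants.More_Homomorphisms"
begin

text \<open>
  An extension field \<open>F|K\<close> is given by a field homomorphism \<open>\<iota>\<close> from the type \<open>'k\<close> of \<open>K\<close>
  to the type \<open>'f\<close> of \<open>F\<close>.
\<close>

inductive_set field_span :: "'f::field set \<Rightarrow> 'f set" for S :: "'f set" where
  incl: "x \<in> S \<Longrightarrow> x \<in> field_span S"
| one: "1 \<in> field_span S"
| minus: "x \<in> field_span S \<Longrightarrow> - x \<in> field_span S"
| add: "x \<in> field_span S \<Longrightarrow> y \<in> field_span S \<Longrightarrow> x + y \<in> field_span S"
| mult: "x \<in> field_span S \<Longrightarrow> y \<in> field_span S \<Longrightarrow> x * y \<in> field_span S"
| inverse: "x \<in> field_span S \<Longrightarrow> inverse x \<in> field_span S"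

definition transcendental_over :: "('k::field \<Rightarrow> 'f::field) \<Rightarrow> 'f \<Rightarrow> bool" where
  "transcendental_over \<iota> x \<longleftrightarrow> (\<forall>p::'k poly. p \<noteq> 0 \<longrightarrow> poly (map_poly \<iota> p) x \<noteq> 0)"

definition K_isomorphism :: "('k::field \<Rightarrow> 'g::field) \<Rightarrow> ('k \<Rightarrow> 'f::field) \<Rightarrow> ('g \<Rightarrow> 'f) \<Rightarrow> bool" where
  "K_isomorphism \<iota>' \<iota> \<sigma> \<longleftrightarrow> field_isom \<sigma> \<and> (\<forall>k. \<sigma> (\<iota>' k) = \<iota> k)"

definition K_isomorphic :: "('k::field \<Rightarrow> 'g::field) \<Rightarrow> ('k \<Rightarrow> 'f::field) \<Rightarrow> bool" where
  "K_isomorphic \<iota>' \<iota> \<longleftrightarrow> (\<exists>\<sigma>. K_isomorphism \<iota>' \<iota> \<sigma>)"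

definition squares :: "'k::field set" where
  "squares = range (\<lambda>s. s^2)"

text \<open>
  The quartics are defined over an arbitrary commutative ring because each is used both as an
  expression in \<open>F\<close> and as an element of \<open>K[Z][Y]\<close>; in the latter, \<open>Z = [:[:0, 1:]:]\<close>,
  \<open>Y = [:0, 1:]\<close>, and \<open>[:[:k:]:]\<close> is the constant \<open>k\<close>.
\<close>

definition quartic_a :: "'r::comm_ring_1 \<Rightarrow> 'r \<Rightarrow> 'r \<Rightarrow> 'r \<Rightarrow> 'r \<Rightarrow> 'r \<Rightarrow> 'r" where
  "quartic_a a b c d z y =
     b * y^4 + d * z^4 + y^2 * z^2 + z^3 + (b + b^2 * c^3) * z^2 + a * y^2 + a * z
     + a * b^2 * c^3 + a^2 * d"

definition quartic_b :: "'r::comm_ring_1 \<Rightarrow> 'r \<Rightarrow> 'r \<Rightarrow> 'r \<Rightarrow> 'r \<Rightarrow> 'r" where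
  "quartic_b a b c z y = y^4 + a * z^4 + z^3 + b * z + c"

definition quartic_c :: "'r::comm_ring_1 \<Rightarrow> 'r \<Rightarrow> 'r \<Rightarrow> 'r \<Rightarrow> 'r \<Rightarrow> 'r \<Rightarrow> 'r" where
  "quartic_c a b c d z y =
     y^4 + d * z^2 * y^2 + (c + a) * z^4 + d * z^3 + b * d * y^2 + z^2 + b * d * z + b^2 * c"

definition type_a :: "('k::field \<Rightarrow> 'f::field) \<Rightarrow> 'f \<Rightarrow> 'f \<Rightarrow> 'k \<Rightarrow> 'k \<Rightarrow> 'k \<Rightarrow> 'k \<Rightarrow> bool" where
  "type_a \<iota> z y a b c d \<longleftrightarrow>
     field_hom \<iota> \<and> field_span (range \<iota> \<union> {z, y}) = UNIV \<and> transcendental_over \<iota> z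
     \<and> quartic_a (\<iota> a) (\<iota> b) (\<iota> c) (\<iota> d) z y = 0
     \<and> irreducible (quartic_a [:[:a:]:] [:[:b:]:] [:[:c:]:] [:[:d:]:] [:[:0, 1:]:] [:0, 1:])
     \<and> a \<notin> squares \<and> b \<noteq> 0 \<and> c \<noteq> 0"

definition type_b :: "('k::field \<Rightarrow> 'f::field) \<Rightarrow> 'f \<Rightarrow> 'f \<Rightarrow> 'k \<Rightarrow> 'k \<Rightarrow> 'k \<Rightarrow> bool" where
  "type_b \<iota> z y a b c \<longleftrightarrow>
     field_hom \<iota> \<and> field_span (range \<iota> \<union> {z, y}) = UNIV \<and> transcendental_over \<iota> z
     \<and> quartic_b (\<iota> a) (\<iota> b) (\<iota> c) z y = 0
     \<and> irreducible (quartic_b [:[:a:]:] [:[:b:]:] [:[:c:]:] [:[:0, 1:]:] [:0, 1:])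
     \<and> b \<notin> squares"

definition type_c :: "('k::field \<Rightarrow> 'f::field) \<Rightarrow> 'f \<Rightarrow> 'f \<Rightarrow> 'k \<Rightarrow> 'k \<Rightarrow> 'k \<Rightarrow> 'k \<Rightarrow> bool" where
  "type_c \<iota> z y a b c d \<longleftrightarrow>
     field_hom \<iota> \<and> field_span (range \<iota> \<union> {z, y}) = UNIV \<and> transcendental_over \<iota> z
     \<and> quartic_c (\<iota> a) (\<iota> b) (\<iota> c) (\<iota> d) z y = 0
     \<and> irreducible (quartic_c [:[:a:]:] [:[:b:]:] [:[:c:]:] [:[:d:]:] [:[:0, 1:]:] [:0, 1:])
     \<and> a \<notin> squares \<and> b \<notin> squares \<and> d \<noteq> 0"

text \<open>
  The scalars \<open>\<epsilon>\<close> and \<open>\<gamma>\<close>. The first argument \<open>e\<close> is the constant \<open>a\<close> in type (a) and \<open>b\<close> in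
  types (b) and (c); \<open>m, n\<close> are \<open>\<mu>\<^sub>2, \<mu>\<^sub>3\<close> in types (a) and (c), and \<open>\<mu>\<^sub>1, \<mu>\<^sub>2\<close> in type (b).
\<close>

definition eps :: "'k::field \<Rightarrow> 'k \<Rightarrow> 'k \<Rightarrow> 'k" where
  "eps e \<mu>\<^sub>4 \<mu>\<^sub>5 = \<mu>\<^sub>4^2 + \<mu>\<^sub>5^2 * e"

definition gam :: "'k::field \<Rightarrow> 'k \<Rightarrow> 'k \<Rightarrow> 'k \<Rightarrow> 'k \<Rightarrow> 'k" where
  "gam e m n \<mu>\<^sub>4 \<mu>\<^sub>5 = inverse (eps e \<mu>\<^sub>4 \<mu>\<^sub>5) * (m^2 + n^2 * e)"

definition constants_a :: "'k::field \<Rightarrow> 'k \<Rightarrow> 'k \<Rightarrow> 'k \<Rightarrow> 'k \<Rightarrow> 'k \<Rightarrow> 'k \<Rightarrow> 'k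
    \<Rightarrow> 'k \<Rightarrow> 'k \<Rightarrow> 'k \<Rightarrow> 'k \<Rightarrow> bool" where
  "constants_a a b c d a' b' c' d' \<mu>\<^sub>2 \<mu>\<^sub>3 \<mu>\<^sub>4 \<mu>\<^sub>5 \<longleftrightarrow>
     (let \<epsilon> = eps a \<mu>\<^sub>4 \<mu>\<^sub>5; \<gamma> = gam a \<mu>\<^sub>2 \<mu>\<^sub>3 \<mu>\<^sub>4 \<mu>\<^sub>5 in
       (\<mu>\<^sub>4, \<mu>\<^sub>5) \<noteq> (0, 0)
       \<and> \<epsilon>^6 * a' = a + \<gamma>^2
       \<and> \<epsilon>^3 * b' = b
       \<and> c' = \<epsilon> * c
       \<and> d' = \<epsilon> * (\<mu>\<^sub>4 * \<mu>\<^sub>5 + \<mu>\<^sub>3^2)^2 * b + \<epsilon>^2 * (\<mu>\<^sub>4 * \<mu>\<^sub>5 + \<mu>\<^sub>3^2)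
              + \<epsilon>^2 * (\<mu>\<^sub>5^2 * b^2 * c^3 + \<epsilon> * d))"

definition constants_b :: "'k::field \<Rightarrow> 'k \<Rightarrow> 'k \<Rightarrow> 'k \<Rightarrow> 'k \<Rightarrow> 'k
    \<Rightarrow> 'k \<Rightarrow> 'k \<Rightarrow> 'k \<Rightarrow> 'k \<Rightarrow> bool" where
  "constants_b a b c a' b' c' \<mu>\<^sub>1 \<mu>\<^sub>2 \<mu>\<^sub>4 \<mu>\<^sub>5 \<longleftrightarrow>
     (let \<epsilon> = eps b \<mu>\<^sub>4 \<mu>\<^sub>5; \<gamma> = gam b \<mu>\<^sub>1 \<mu>\<^sub>2 \<mu>\<^sub>4 \<mu>\<^sub>5 in
       (\<mu>\<^sub>4, \<mu>\<^sub>5) \<noteq> (0, 0)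
       \<and> a' = \<epsilon>^2 * a + \<epsilon> * \<mu>\<^sub>4 * \<mu>\<^sub>5 + \<mu>\<^sub>2^4 + \<mu>\<^sub>5^4 * (c + a * b^2)
       \<and> \<epsilon>^4 * b' = b
       \<and> \<epsilon>^6 * c' = c + \<gamma>^2 + (\<epsilon> * \<mu>\<^sub>4 * \<mu>\<^sub>5 + \<mu>\<^sub>2^4) * inverse (\<epsilon>^2) * b^2
                    + inverse (\<epsilon>^2) * \<mu>\<^sub>5^4 * (c + a * b^2) * b^2)"

definition constants_c :: "'k::field \<Rightarrow> 'k \<Rightarrow> 'k \<Rightarrow> 'k \<Rightarrow> 'k \<Rightarrow> 'k \<Rightarrow> 'k \<Rightarrow> 'k
    \<Rightarrow> 'k \<Rightarrow> 'k \<Rightarrow> 'k \<Rightarrow> 'k \<Rightarrow> bool" where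
  "constants_c a b c d a' b' c' d' \<mu>\<^sub>2 \<mu>\<^sub>3 \<mu>\<^sub>4 \<mu>\<^sub>5 \<longleftrightarrow>
     (let \<epsilon> = eps b \<mu>\<^sub>4 \<mu>\<^sub>5; \<gamma> = gam b \<mu>\<^sub>2 \<mu>\<^sub>3 \<mu>\<^sub>4 \<mu>\<^sub>5 in
       (\<mu>\<^sub>4, \<mu>\<^sub>5) \<noteq> (0, 0)
       \<and> a' = \<epsilon>^2 * (a * b^2 / (b + \<gamma>^2)^2)
       \<and> \<epsilon>^2 * b' = b + \<gamma>^2
       \<and> d' = \<epsilon> * d
       \<and> c' = \<epsilon>^2 * (c + a) + (\<mu>\<^sub>3^2 + \<mu>\<^sub>4 * \<mu>\<^sub>5)^2 + \<epsilon> * d * (\<mu>\<^sub>3^2 + \<mu>\<^sub>4 * \<mu>\<^sub>5)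
              + a * b^2 * (\<mu>\<^sub>5^4 + \<epsilon>^2 / (b + \<gamma>^2)^2))"

text \<open>The images in \<open>F\<close> of \<open>(z', y')\<close>.\<close>

definition images_a :: "('k::field \<Rightarrow> 'f::field) \<Rightarrow> 'f \<Rightarrow> 'f \<Rightarrow> 'k \<Rightarrow> 'k \<Rightarrow> 'k \<Rightarrow> 'k \<Rightarrow> 'k \<Rightarrow> 'f \<times> 'f" where
  "images_a \<iota> z y a \<mu>\<^sub>2 \<mu>\<^sub>3 \<mu>\<^sub>4 \<mu>\<^sub>5 =
     (let \<epsilon> = eps a \<mu>\<^sub>4 \<mu>\<^sub>5; \<gamma> = gam a \<mu>\<^sub>2 \<mu>\<^sub>3 \<mu>\<^sub>4 \<mu>\<^sub>5 in
       (1 / \<iota> \<epsilon> ^ 3 * (\<iota> \<gamma> + (\<iota> \<mu>\<^sub>5 * \<iota> a + \<iota> \<mu>\<^sub>4 * z) / (\<iota> \<mu>\<^sub>4 + \<iota> \<mu>\<^sub>5 * z)),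
        1 / \<iota> \<epsilon> ^ 2 * (\<iota> \<mu>\<^sub>2 + (\<iota> \<mu>\<^sub>3 * (\<iota> \<mu>\<^sub>5 * \<iota> a + \<iota> \<mu>\<^sub>4 * z) + \<iota> \<epsilon> * y) / (\<iota> \<mu>\<^sub>4 + \<iota> \<mu>\<^sub>5 * z))))"

definition images_b :: "('k::field \<Rightarrow> 'f::field) \<Rightarrow> 'f \<Rightarrow> 'f \<Rightarrow> 'k \<Rightarrow> 'k \<Rightarrow> 'k \<Rightarrow> 'k \<Rightarrow> 'k \<Rightarrow> 'f \<times> 'f" where
  "images_b \<iota> z y b \<mu>\<^sub>1 \<mu>\<^sub>2 \<mu>\<^sub>4 \<mu>\<^sub>5 =
     (let \<epsilon> = eps b \<mu>\<^sub>4 \<mu>\<^sub>5 in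
       (1 / \<iota> \<epsilon> ^ 2 * ((\<iota> \<mu>\<^sub>5 * \<iota> b + \<iota> \<mu>\<^sub>4 * z) / (\<iota> \<mu>\<^sub>4 + \<iota> \<mu>\<^sub>5 * z)),
        1 / \<iota> \<epsilon> ^ 2 * (\<iota> \<mu>\<^sub>1 + (\<iota> \<mu>\<^sub>2 * (\<iota> \<mu>\<^sub>5 * \<iota> b + \<iota> \<mu>\<^sub>4 * z) + \<iota> \<epsilon> * y) / (\<iota> \<mu>\<^sub>4 + \<iota> \<mu>\<^sub>5 * z))))"

definition images_c :: "('k::field \<Rightarrow> 'f::field) \<Rightarrow> 'f \<Rightarrow> 'f \<Rightarrow> 'k \<Rightarrow> 'k \<Rightarrow> 'k \<Rightarrow> 'k \<Rightarrow> 'k \<Rightarrow> 'f \<times> 'f" where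
  "images_c \<iota> z y b \<mu>\<^sub>2 \<mu>\<^sub>3 \<mu>\<^sub>4 \<mu>\<^sub>5 =
     (let \<epsilon> = eps b \<mu>\<^sub>4 \<mu>\<^sub>5; \<gamma> = gam b \<mu>\<^sub>2 \<mu>\<^sub>3 \<mu>\<^sub>4 \<mu>\<^sub>5 in
       (1 / \<iota> \<epsilon> * (\<iota> \<gamma> + (\<iota> \<mu>\<^sub>5 * \<iota> b + \<iota> \<mu>\<^sub>4 * z) / (\<iota> \<mu>\<^sub>4 + \<iota> \<mu>\<^sub>5 * z)),
        1 / \<iota> \<epsilon> * (\<iota> \<mu>\<^sub>2 + (\<iota> \<mu>\<^sub>3 * (\<iota> \<mu>\<^sub>5 * \<iota> b + \<iota> \<mu>\<^sub>4 * z) + \<iota> \<epsilon> * y) / (\<iota> \<mu>\<^sub>4 + \<iota> \<mu>\<^sub>5 * z))))"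

end

theory Submission
  imports Defs "Berlekamp_Zassenhaus.Unique_Factorization_Poly"
begin

text \<open>
  A \<open>K\<close>-isomorphism \<open>F' \<rightarrow> F\<close> is the same as a second pair \<open>(Z, V)\<close> of generators of \<open>F\<close>, with \<open>Z\<close>
  transcendental, that satisfies the equation of \<open>F'\<close>: as the quartic of \<open>F'\<close> is irreducible, the
  polynomials in \<open>K[Z][Y]\<close> that vanish at such a pair are its multiples, exactly as for \<open>(z', y')\<close>
  (\<open>ev2_eq_0_iff_dvd\<close>, \<open>ex1_K_isomorphism\<close>). So the theorem asks for all such pairs in \<open>F\<close>.

  In characteristic 2 the quartics are sums of few products. With \<open>T = z\<^sup>2 + a\<close> in type (a) and
  \<open>T = z\<^sup>2 + b\<close> in type (c), the element \<open>x = (y\<^sup>2 + z) / T\<close> satisfies \<open>(b x\<^sup>2 + x + d) T = b\<^sup>2 c\<^sup>3\<close> and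
  \<open>x\<^sup>2 + d x + c = a (z\<^sup>2 / T)\<^sup>2\<close>, respectively. Consequently \<open>F\<close> is reached from a rational function
  field by adjoining square roots: \<open>K(x) \<subset> K(x)(w) \<subset> F\<close> in type (a), \<open>K(z) \<subset> K(z)(y\<^sup>2) \<subset> F\<close> in type (b),
  and \<open>K(x) \<subset> K(x)(v) \<subset> K(x)(v)(w) \<subset> F\<close> in type (c). Squaring carries every field of the tower into the
  one below it. The equations of the second pair express \<open>X\<close> (the \<open>x\<close> of that pair, or \<open>Z\<close> in type
  (b)) rationally through squares and constants; used repeatedly, this puts \<open>X\<close> into the rational
  field at the bottom (the lemmas \<open>frobenius_images\<close>). By symmetry both pairs have the same bottom
  field, and \<open>automorphism_is_moebius\<close> makes \<open>X\<close> a linear fraction in \<open>x\<close>.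

  The other generators of the second tower are then written in the basis of the first tower and
  squared, which gives equations \<open>A\<^sup>2 + B\<^sup>2 g = h\<close> in a rational field, with \<open>g\<close> and \<open>h\<close> polynomials.
  Differentiation annihilates the squares and determines \<open>B\<close>; a square root in \<open>K(x)\<close> of a polynomial
  is a polynomial; and a constant that is not a square prevents leading terms from cancelling. So
  the unknowns are polynomials of very small degree (the lemmas \<open>square_combination\<close>), and comparing
  coefficients gives the normal form. In types (a) and (c) it shows first that \<open>X\<close> is affine in
  \<open>x\<close>, and finally that \<open>Z L\<close> and \<open>V L + y\<close> are linear in \<open>z\<close> for a linear polynomial \<open>L\<close> in \<open>z\<close>;
  \<open>common_normal_form\<close> reads the parameters off these.

  Conversely, the substitution multiplies the building blocks \<open>z\<^sup>2 + e\<close> and \<open>y\<^sup>2 + z\<close> of the quartics by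
  simple factors, because \<open>m\<^sup>2 + n\<^sup>2 e\<close> is a multiplicative norm form (\<open>substitution_squares\<close>), and it is
  invertible (\<open>linear_substitution_generates\<close>).
\<close>

section \<open>Characteristic two\<close>

lemma char2:
  fixes x y :: "'a::comm_ring_1"
  assumes "CHAR('a) = 2"
  shows "x + x = 0" "x + (x + y) = y" "- x = x" "x - y = x + y"
    "numeral (Num.Bit0 n) = (0::'a)" "numeral (Num.Bit1 n) = (1::'a)"
proof -
  have "(2::'a) = 0"
    using of_nat_CHAR[where 'a = 'a] assms by simp
  then show xx: "x + x = 0" for x :: 'a
    by (metis mult_2 mult_zero_left)
  then show "x + (x + y) = y"
    by (metis add.assoc add_0)
  show m: "- x = x" for x :: 'a
    using xx by (simp add: minus_unique)
  show "x - y = x + y"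
    using m by (metis diff_conv_add_uminus)
  show "numeral (Num.Bit0 n) = (0::'a)" for n
    by (simp add: numeral_Bit0 xx)
  then show "numeral (Num.Bit1 n) = (1::'a)"
    by (metis add_0 numeral_Bit0 numeral_Bit1)
qed

lemma char2_square_add:
  fixes x y :: "'a::comm_ring_1"
  assumes "CHAR('a) = 2"
  shows "(x + y)^2 = x^2 + y^2"
  by (simp add: power2_eq_square algebra_simps char2[OF assms])

lemma char2_square_inject:
  fixes x y :: "'a::idom"
  assumes "CHAR('a) = 2"
  shows "x^2 = y^2 \<longleftrightarrow> x = y"
  by (metis char2(1,3)[OF assms] power2_eq_iff)

lemma CHAR_poly_eq: "CHAR('a::comm_ring_1 poly) = CHAR('a)"
  by (rule CHAR_eqI) (simp_all add: of_nat_poly of_nat_eq_0_iff_char_dvd)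

lemma char2_add_eq_iff:
  fixes x y z :: "'a::comm_ring_1"
  assumes "CHAR('a) = 2"
  shows "x + y = z \<longleftrightarrow> x = z + y"
  by (metis add.assoc add.commute char2(2)[OF assms])

text \<open>
  Squaring is additive, so for \<open>u = v s + r\<close> the divisibility passes to \<open>v\<^sup>2 dvd r\<^sup>2\<close>; a nonzero
  remainder \<open>r\<close> has too small a degree for this.
\<close>
lemma char2_dvd_of_square_dvd:
  fixes u v :: "'a::field poly"
  assumes "CHAR('a) = 2" "v^2 dvd u^2" 
  shows "v dvd u"
proof (cases "v = 0")
  case True with assms show ?thesis by simp
next
  case False
  have c: "CHAR('a poly) = 2" using assms(1) by (simp add: CHAR_poly_eq)
  have "u^2 = (v * (u div v) + u mod v)^2" by simp
  also have "\<dots> = v^2 * (u div v)^2 + (u mod v)^2"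
    by (simp only: char2_square_add[OF c] power_mult_distrib)
  finally have "v^2 dvd (u mod v)^2"
    using assms(2) by (metis dvd_add_right_iff dvd_triv_left)
  moreover have "u mod v = 0 \<or> degree (u mod v) < degree v"
    by (rule degree_mod_less[OF False])
  moreover have "degree v \<le> degree (u mod v)" if "u mod v \<noteq> 0" "v^2 dvd (u mod v)^2"
    using dvd_imp_degree_le[OF that(2)] that(1) False by (simp add: degree_power_eq)
  ultimately have "u mod v = 0" by fastforce
  then show ?thesis by auto
qed

lemma char2_pderiv_square:
  fixes p :: "'a::field poly"
  assumes "CHAR('a) = 2"
  shows "pderiv (p^2) = 0"
  by (simp add: power2_eq_square pderiv_mult char2(1)[of "p * pderiv p"] CHAR_poly_eq assms mult.commute)

lemma char2_square_pCons:
  fixes p :: "'a::field poly"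
  assumes "CHAR('a) = 2"
  shows "(pCons a p)^2 = pCons (a^2) (pCons 0 (p^2))"
proof -
  have c: "CHAR('a poly) = 2" using assms by (simp add: CHAR_poly_eq)
  have "(pCons a p)^2 = ([:a:] + pCons 0 p)^2" by simp
  also have "\<dots> = [:a^2:] + pCons 0 (pCons 0 (p^2))"
    by (simp only: char2_square_add[OF c]) (simp add: power2_eq_square)
  finally show ?thesis by simp
qed

lemma char2_coeff_square:
  fixes p :: "'a::field poly"
  assumes "CHAR('a) = 2"
  shows "coeff (p^2) (2 * n) = (coeff p n)^2"
proof (induction p arbitrary: n)
  case (pCons a p)
  show ?case
    by (cases n) (simp_all only: char2_square_pCons[OF assms], simp_all add: pCons.IH)
qed simp

section \<open>Subfields and quadratic adjunctions\<close>

definition is_subfield :: "'f::field set \<Rightarrow> bool" where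
  "is_subfield S \<longleftrightarrow> 1 \<in> S \<and> (\<forall>u\<in>S. - u \<in> S \<and> inverse u \<in> S)
     \<and> (\<forall>u\<in>S. \<forall>v\<in>S. u + v \<in> S \<and> u * v \<in> S)"

lemma is_subfieldD:
  assumes "is_subfield S"
  shows "1 \<in> S" "0 \<in> S" "u \<in> S \<Longrightarrow> - u \<in> S" "u \<in> S \<Longrightarrow> inverse u \<in> S"
    "u \<in> S \<Longrightarrow> v \<in> S \<Longrightarrow> u + v \<in> S" "u \<in> S \<Longrightarrow> v \<in> S \<Longrightarrow> u * v \<in> S"
    "u \<in> S \<Longrightarrow> v \<in> S \<Longrightarrow> u / v \<in> S" "u \<in> S \<Longrightarrow> v \<in> S \<Longrightarrow> u - v \<in> S"
    "u \<in> S \<Longrightarrow> u ^ n \<in> S"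
proof -
  show a: "1 \<in> S" "u \<in> S \<Longrightarrow> - u \<in> S" "u \<in> S \<Longrightarrow> inverse u \<in> S"
    "u \<in> S \<Longrightarrow> v \<in> S \<Longrightarrow> u + v \<in> S" "u \<in> S \<Longrightarrow> v \<in> S \<Longrightarrow> u * v \<in> S" for u v
    using assms by (auto simp: is_subfield_def)
  show "0 \<in> S" using a by (metis add.right_inverse)
  show "u \<in> S \<Longrightarrow> v \<in> S \<Longrightarrow> u / v \<in> S" using a by (simp add: divide_inverse)
  show "u \<in> S \<Longrightarrow> v \<in> S \<Longrightarrow> u - v \<in> S" using a by (metis diff_conv_add_uminus)
  show "u \<in> S \<Longrightarrow> u ^ n \<in> S" using a by (induction n) auto
qed

lemma field_span_subset:
  assumes "is_subfield S" "X \<subseteq> S"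
  shows "field_span X \<subseteq> S"
proof
  fix u assume "u \<in> field_span X"
  then show "u \<in> S"
    by induction (use assms in \<open>auto intro: is_subfieldD\<close>)
qed

lemma is_subfield_field_span: "is_subfield (field_span X)"
  by (auto simp: is_subfield_def intro: field_span.intros)

text \<open>
  For a field \<open>S\<close> with \<open>w\<^sup>2 \<in> S\<close> this is the field \<open>S(w)\<close>, presented in the basis \<open>1, w\<close>.
\<close>
definition adj :: "'f::field set \<Rightarrow> 'f \<Rightarrow> 'f set" where
  "adj S w = {r + s * w | r s. r \<in> S \<and> s \<in> S}"

lemma adjI: "r \<in> S \<Longrightarrow> s \<in> S \<Longrightarrow> r + s * w \<in> adj S w"
  by (auto simp: adj_def)

lemma adjE:
  assumes "u \<in> adj S w"
  obtains r s where "u = r + s * w" "r \<in> S" "s \<in> S"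
  using assms by (auto simp: adj_def)

lemma subset_adj: "is_subfield S \<Longrightarrow> S \<subseteq> adj S w"
  using adjI[of _ S 0 w] by (auto dest: is_subfieldD(2))

lemma generator_in_adj: "is_subfield S \<Longrightarrow> w \<in> adj S w"
  using adjI[of 0 S 1 w] by (simp add: is_subfieldD)

lemma adj_eq_iff:
  fixes w :: "'f::field"
  assumes "is_subfield S" "w \<notin> S" "r \<in> S" "s \<in> S" "r' \<in> S" "s' \<in> S"
  shows "r + s * w = r' + s' * w \<longleftrightarrow> r = r' \<and> s = s'"
proof
  assume *: "r + s * w = r' + s' * w"
  have "s = s'"
  proof (rule ccontr)
    assume "s \<noteq> s'"
    then have "w = (r' - r) / (s - s')" using * by (simp add: field_simps)
    also have "\<dots> \<in> S" using assms by (intro is_subfieldD)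
    finally show False using assms by simp
  qed
  with * show "r = r' \<and> s = s'" by simp
qed simp

lemma square_adj:
  fixes w :: "'f::field"
  assumes "CHAR('f) = 2" "is_subfield S" "w^2 \<in> S" "u \<in> adj S w"
  shows "u^2 \<in> S"
proof -
  obtain r s where "u = r + s * w" "r \<in> S" "s \<in> S" using assms(4) by (rule adjE)
  then show ?thesis
    using assms by (simp add: char2_square_add power_mult_distrib is_subfieldD)
qed

text \<open>
  For inverses, \<open>u\<^sup>2\<close> lies in \<open>S\<close> and \<open>1 / u = u / u\<^sup>2\<close>.
\<close>
lemma is_subfield_adj:
  fixes w :: "'f::field"
  assumes c: "CHAR('f) = 2" and S: "is_subfield S" and w: "w^2 \<in> S"
  shows "is_subfield (adj S w)"
proof -
  note D = is_subfieldD[OF S]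
  have mult: "u * v \<in> adj S w" if uv: "u \<in> adj S w" "v \<in> adj S w" for u v
  proof -
    obtain r s where u: "u = r + s * w" "r \<in> S" "s \<in> S" using uv(1) by (rule adjE)
    obtain r' s' where v: "v = r' + s' * w" "r' \<in> S" "s' \<in> S" using uv(2) by (rule adjE)
    have "u * v = (r * r' + s * s' * w^2) + (r * s' + s * r') * w"
      by (simp add: u v power2_eq_square algebra_simps)
    then show ?thesis using u(2,3) v(2,3) w by (metis adjI D(5,6))
  qed
  have add: "u + v \<in> adj S w" if uv: "u \<in> adj S w" "v \<in> adj S w" for u v
  proof -
    obtain r s where u: "u = r + s * w" "r \<in> S" "s \<in> S" using uv(1) by (rule adjE)
    obtain r' s' where v: "v = r' + s' * w" "r' \<in> S" "s' \<in> S" using uv(2) by (rule adjE)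
    have "u + v = (r + r') + (s + s') * w" by (simp add: u v algebra_simps)
    then show ?thesis using u(2,3) v(2,3) by (metis adjI D(5))
  qed
  have inv: "inverse u \<in> adj S w" if "u \<in> adj S w" for u
  proof -
    have "inverse (u^2) \<in> adj S w"
      using square_adj[OF c S w that] D(4) subset_adj[OF S] by blast
    moreover have "inverse u = u * inverse (u^2)"
      by (cases "u = 0") (simp_all add: power2_eq_square)
    ultimately show ?thesis using mult that by metis
  qed
  show ?thesis
    unfolding is_subfield_def
    using subset_adj[OF S] D(1) mult add inv by (auto simp: char2(3)[OF c])
qed

section \<open>Polynomials over a field\<close>

lemma poly_degree_le_1: "degree p \<le> 1 \<Longrightarrow> \<exists>a b. p = [:a, b:]"
  by (metis degree1_coeffs degree_eq_zeroE le_neq_implies_less less_one pCons_0_0)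

lemma poly_degree_le_2: "degree p \<le> 2 \<Longrightarrow> \<exists>a b c. p = [:a, b, c:]"
proof (cases p)
  case (pCons a q)
  assume "degree p \<le> 2"
  then have "degree q \<le> 1" using pCons by (auto split: if_splits)
  then show ?thesis using pCons poly_degree_le_1[of q] by blast
qed

lemma degree_square_le:
  fixes p :: "'a::field poly"
  shows "degree (p^2) \<le> 2 * n \<Longrightarrow> degree p \<le> n"
  by (cases "p = 0") (auto simp: degree_power_eq)

text \<open>
  The Euclidean algorithm, in the form that yields the reduced representation of a fraction \<open>f / g\<close>.
\<close>
lemma bezout_quotients:
  fixes f g :: "'a::field poly"
  shows "\<exists>h f' g' p q. f = h * f' \<and> g = h * g' \<and> f' * p + g' * q = 1"
proof (induction "if g = 0 then 0 else Suc (degree g)" arbitrary: f g rule: less_induct)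
  case less
  show ?case
  proof (cases "g = 0")
    case True
    then show ?thesis by (intro exI[of _ f] exI[of _ 1] exI[of _ 0]) auto
  next
    case False
    have "(if f mod g = 0 then 0 else Suc (degree (f mod g))) < (if g = 0 then 0 else Suc (degree g))"
      using degree_mod_less[OF False, of f] False by auto
    from less[OF this] obtain h g' r p q where
      *: "g = h * g'" "f mod g = h * r" "g' * p + r * q = 1" by blast
    define s where "s = f div g"
    have "f = g * s + f mod g" by (simp add: s_def)
    then have "f = h * (g' * s + r)" using * by (metis distrib_left mult.assoc)
    moreover have "(g' * s + r) * q + g' * (p - s * q) = 1"
      using *(3) by (simp add: algebra_simps)
    ultimately show ?thesis using *(1) by blast
  qed
qed

lemma dvd_of_dvd_power_mult:
  fixes f g C :: "'a::field poly"
  assumes "f * p + g * q = 1" "g dvd f ^ n * C"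
  shows "g dvd C"
  using assms(2)
proof (induction n)
  case (Suc n)
  have "f ^ n * C = f ^ n * C * (f * p + g * q)" using assms(1) by simp
  also have "\<dots> = f ^ Suc n * C * p + g * (f ^ n * C * q)" by (simp add: algebra_simps)
  finally have "g dvd f ^ n * C" using Suc.prems by (metis dvd_add dvd_mult2 dvd_triv_left)
  then show ?case by (rule Suc.IH)
qed simp

section \<open>Rational functions inside an extension field\<close>

locale char2_ext = field_hom \<iota> for \<iota> :: "'k::field \<Rightarrow> 'f::field" +
  assumes CHAR_K: "CHAR('k) = 2"
begin

lemma CHAR_F: "CHAR('f) = 2"
proof (rule CHAR_eqI)
  have *: "of_nat n = (0::'f) \<longleftrightarrow> 2 dvd n" for n
  proof -
    have "of_nat n = \<iota> (of_nat n)" by (simp add: hom_distribs)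
    then have "of_nat n = (0::'f) \<longleftrightarrow> of_nat n = (0::'k)" by simp
    then show ?thesis by (simp add: of_nat_eq_0_iff_char_dvd CHAR_K)
  qed
  show "of_nat 2 = (0::'f)" using *[of 2] by simp
  show "\<And>n. of_nat n = (0::'f) \<Longrightarrow> 2 dvd n" using * by blast
qed

lemma CHAR_KX: "CHAR('k poly) = 2" by (simp add: CHAR_poly_eq CHAR_K)

lemmas char2_F = char2[OF CHAR_F]
lemmas char2_K = char2[OF CHAR_K]
lemmas char2_KX = char2[OF CHAR_KX]
lemmas sq_F = char2_square_add[OF CHAR_F]
lemmas sq_K = char2_square_add[OF CHAR_K]

definition ev :: "'f \<Rightarrow> 'k poly \<Rightarrow> 'f" where
  "ev x p = poly (map_poly \<iota> p) x"

interpretation map_poly_hom: map_poly_inj_idom_hom \<iota> ..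

lemma ev_simps [simp]:
  "ev x 0 = 0" "ev x 1 = 1" "ev x (p + q) = ev x p + ev x q" "ev x (p * q) = ev x p * ev x q"
  "ev x (p ^ n) = ev x p ^ n" "ev x (pCons c p) = \<iota> c + x * ev x p" "ev x (- p) = - ev x p"
  "ev x (p - q) = ev x p - ev x q" "ev x (Polynomial.smult c p) = \<iota> c * ev x p"
  by (simp_all add: ev_def hom_distribs)

lemma ev_sum: "ev x (sum f A) = (\<Sum>i\<in>A. ev x (f i))"
  by (induction A rule: infinite_finite_induct) auto

text \<open>
  The field \<open>K(x)\<close>. A quotient with a vanishing denominator is \<open>0\<close>, which is a member anyway.
\<close>
definition Kx :: "'f \<Rightarrow> 'f set" where
  "Kx x = {ev x p / ev x q | p q. True}"

lemma KxE:
  assumes "u \<in> Kx x"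
  obtains p q where "u = ev x p / ev x q" "ev x q \<noteq> 0"
proof -
  obtain p q where u: "u = ev x p / ev x q" using assms by (auto simp: Kx_def)
  show ?thesis
  proof (cases "ev x q = 0")
    case True
    then have "u = ev x 0 / ev x 1" using u by simp
    then show ?thesis using that[of 0 1] by simp
  qed (use that u in auto)
qed

lemma KxE2:
  assumes "u \<in> Kx x" "v \<in> Kx x"
  obtains p q r where "u = ev x p / ev x r" "v = ev x q / ev x r" "ev x r \<noteq> 0"
proof -
  obtain p q where u: "u = ev x p / ev x q" "ev x q \<noteq> 0" using assms(1) by (rule KxE)
  obtain p' q' where v: "v = ev x p' / ev x q'" "ev x q' \<noteq> 0" using assms(2) by (rule KxE)
  show ?thesis using that[of "p * q'" "q * q'" "p' * q"] u v by simp
qed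

lemma KxI: "ev x p / ev x q \<in> Kx x" by (auto simp: Kx_def)

lemma ev_in_Kx: "ev x p \<in> Kx x" using KxI[of x p 1] by simp

lemma is_subfield_Kx: "is_subfield (Kx x)"
  unfolding is_subfield_def
proof (intro conjI ballI)
  show "1 \<in> Kx x" using ev_in_Kx[of x 1] by simp
  fix u assume u: "u \<in> Kx x"
  then obtain p q where pq: "u = ev x p / ev x q" "ev x q \<noteq> 0" by (rule KxE)
  show "- u \<in> Kx x" using KxI[of x "- p" q] pq by simp
  show "inverse u \<in> Kx x" using KxI[of x q p] pq by simp
  fix v assume v: "v \<in> Kx x"
  obtain p q r where "u = ev x p / ev x r" "v = ev x q / ev x r" "ev x r \<noteq> 0"
    using u v by (rule KxE2)
  then show "u + v \<in> Kx x" "u * v \<in> Kx x"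
    using KxI[of x "p + q" r] KxI[of x "p * q" "r * r"] by (simp_all add: add_divide_distrib)
qed

lemmas Kx_closed = is_subfieldD[OF is_subfield_Kx]

lemma const_in_Kx [simp]: "\<iota> k \<in> Kx x" using ev_in_Kx[of x "[:k:]"] by simp
lemma gen_in_Kx [simp]: "x \<in> Kx x" using ev_in_Kx[of x "[:0, 1:]"] by simp

lemma Kx_subset:
  assumes S: "is_subfield S" "range \<iota> \<subseteq> S" "x \<in> S"
  shows "Kx x \<subseteq> S"
proof
  fix u assume "u \<in> Kx x"
  then obtain p q where u: "u = ev x p / ev x q" by (rule KxE)
  have "ev x p \<in> S" for p
    by (induction p) (use S(2,3) in \<open>auto intro!: is_subfieldD[OF S(1)]\<close>)
  then show "u \<in> S" using u is_subfieldD[OF S(1)] by simp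
qed

lemma Kx_const: "Kx (\<iota> c) \<subseteq> range \<iota>"
proof -
  have "is_subfield (range \<iota>)"
    unfolding is_subfield_def
    by (auto simp: image_iff simp flip: hom_one hom_add hom_mult hom_uminus hom_inverse)
  then show ?thesis by (rule Kx_subset) auto
qed

context
  fixes x assumes x: "transcendental_over \<iota> x"
begin

lemma ev_eq_0_iff [simp]: "ev x p = 0 \<longleftrightarrow> p = 0"
  using x ev_simps(1) by (auto simp: transcendental_over_def ev_def)

lemma ev_eq_iff: "ev x p = ev x q \<longleftrightarrow> p = q"
  using ev_eq_0_iff[of "p - q"] by (simp del: ev_eq_0_iff)

lemma not_const: "x \<noteq> \<iota> c"
  using ev_eq_0_iff[of "[:-c, 1:]"] by (auto simp: hom_distribs simp del: ev_eq_0_iff)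

text \<open>
  An instance of the integral closedness of \<open>K[x]\<close>.
\<close>
lemma square_root_polynomial:
  assumes "A \<in> Kx x" "A^2 = ev x h"
  obtains s where "A = ev x s" "s^2 = h"
proof -
  obtain p q where A: "A = ev x p / ev x q" "ev x q \<noteq> 0" using assms(1) by (rule KxE)
  have "ev x (p^2) = ev x (q^2 * h)"
    using assms(2) A by (simp add: field_simps)
  then have eq: "p^2 = q^2 * h" by (simp only: ev_eq_iff)
  then have "q^2 dvd p^2" by simp
  then have "q dvd p" by (rule char2_dvd_of_square_dvd[OF CHAR_K])
  then obtain s where s: "p = q * s" by (elim dvdE)
  have "s^2 = h" using eq A(2) by (simp add: s power_mult_distrib)
  moreover have "A = ev x s" using A s by simp
  ultimately show ?thesis using that by blast
qed

text \<open>
  Over a common denominator the equation reads \<open>p\<^sup>2 + q\<^sup>2 g = r\<^sup>2 h\<close>. Its derivative is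
  \<open>q\<^sup>2 g' = r\<^sup>2 h'\<close>, since squares have derivative \<open>0\<close> in characteristic 2.
\<close>
lemma derivative_of_square_combination:
  assumes "A \<in> Kx x" "B \<in> Kx x" "A^2 + B^2 * ev x g = ev x h"
  shows "B^2 * ev x (pderiv g) = ev x (pderiv h)"
proof -
  obtain p q r where A: "A = ev x p / ev x r" "B = ev x q / ev x r" "ev x r \<noteq> 0"
    using assms(1,2) by (rule KxE2)
  have "ev x (p^2 + q^2 * g) = ev x (r^2 * h)"
    using assms(3) A by (simp add: field_simps)
  then have "p^2 + q^2 * g = r^2 * h" by (simp only: ev_eq_iff)
  then have "pderiv (p^2 + q^2 * g) = pderiv (r^2 * h)" by simp
  then have "q^2 * pderiv g = r^2 * pderiv h"
    by (simp add: pderiv_add pderiv_mult char2_pderiv_square[OF CHAR_K])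
  then have "ev x q^2 * ev x (pderiv g) = ev x r^2 * ev x (pderiv h)"
    by (metis ev_simps(4,5))
  then have "(ev x q / ev x r)^2 * ev x (pderiv g) = ev x (pderiv h)"
    using A(3) by (simp add: field_simps)
  then show ?thesis using A(2) by simp
qed

text \<open>
  If \<open>g'\<close> is a constant, then \<open>B\<^sup>2\<close> is a polynomial by differentiation, hence \<open>B\<close> is one, and then so is
  \<open>A\<close>.
\<close>
lemma square_combination_polynomials:
  assumes "A \<in> Kx x" "B \<in> Kx x" "A^2 + B^2 * ev x g = ev x h"
    and g: "pderiv g = [:e:]" "e \<noteq> 0"
  obtains s t where "A = ev x t" "B = ev x s" "t^2 + s^2 * g = h" "Polynomial.smult e (s^2) = pderiv h"
proof -
  have "B^2 * \<iota> e = ev x (pderiv h)"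
    using derivative_of_square_combination[OF assms(1-3)] g by simp
  then have "B^2 = ev x (Polynomial.smult (inverse e) (pderiv h))"
    using g(2) by (simp add: hom_distribs field_simps)
  with assms(2) obtain s where s: "B = ev x s" "s^2 = Polynomial.smult (inverse e) (pderiv h)"
    by (rule square_root_polynomial)
  have "A^2 = ev x (h - s^2 * g)" using assms(3) s(1) by (simp add: algebra_simps)
  with assms(1) obtain t where t: "A = ev x t" "t^2 = h - s^2 * g"
    by (rule square_root_polynomial)
  show ?thesis
    by (rule that[of t s]) (use s t g in auto)
qed

lemma not_square_in_Kx:
  assumes "pderiv g \<noteq> 0" "A \<in> Kx x"
  shows "A^2 \<noteq> ev x g"
proof
  assume "A^2 = ev x g"
  then obtain s where "s^2 = g" using square_root_polynomial assms(2) by metis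
  then show False using assms(1) char2_pderiv_square[OF CHAR_K] by metis
qed

end
end

section \<open>Automorphisms of a rational function field\<close>

context char2_ext
begin

context
  fixes x assumes x: "transcendental_over \<iota> x"
begin

lemmas ev_iff = ev_eq_0_iff[OF x]

text \<open>
  The argument of the rational root theorem. If \<open>x = u(X) / v(X)\<close>, then \<open>X = f / g\<close> is a root of the
  polynomial with coefficients \<open>C i = u\<^sub>i - v\<^sub>i x\<close>. Clearing denominators shows that \<open>g\<close>, being prime to
  \<open>f\<close>, divides the leading coefficient \<open>C N\<close>, a nonzero polynomial of degree at most 1.
\<close>
lemma denominator_degree_le_1:
  assumes X: "X = ev x f / ev x g" "g \<noteq> 0" and bezout: "f * p + g * q = 1"
    and "x \<in> Kx X"
  shows "degree g \<le> 1"
proof -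
  obtain u v where uv: "x = ev X u / ev X v" "ev X v \<noteq> 0" using \<open>x \<in> Kx X\<close> by (rule KxE)
  define N where "N = max (degree u) (degree v)"
  define C where "C i = [:coeff u i, - coeff v i:]" for i
  have ev_sum_X: "ev X r = (\<Sum>i\<le>N. \<iota> (coeff r i) * X ^ i)" if "degree r \<le> N" for r
  proof -
    have "ev X (monom c i) = \<iota> c * X ^ i" for c i
      by (simp add: ev_def hom_distribs poly_monom map_poly_monom)
    then show ?thesis
      by (subst poly_as_sum_of_monoms'[OF that, symmetric]) (simp add: ev_sum)
  qed
  have "ev X u - x * ev X v = (\<Sum>i\<le>N. ev x (C i) * X ^ i)"
  proof -
    have "ev x (C i) = \<iota> (coeff u i) - x * \<iota> (coeff v i)" for i
      by (simp add: C_def hom_uminus)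
    moreover have "degree u \<le> N" "degree v \<le> N" by (simp_all add: N_def)
    ultimately show ?thesis
      by (simp only: ev_sum_X left_diff_distrib sum_subtractf sum_distrib_left mult.assoc)
  qed
  then have "ev x g ^ N * (ev X u - x * ev X v) = (\<Sum>i\<le>N. ev x g ^ N * (ev x (C i) * X ^ i))"
    by (simp only: sum_distrib_left)
  also have "\<dots> = (\<Sum>i\<le>N. ev x (C i * f ^ i * g ^ (N - i)))"
  proof (rule sum.cong)
    fix i assume "i \<in> {..N}"
    then have "ev x g ^ N = ev x g ^ (i + (N - i))" by simp
    also have "\<dots> = ev x g ^ i * ev x g ^ (N - i)" by (rule power_add)
    finally have "ev x g ^ N = ev x g ^ i * ev x g ^ (N - i)" .
    moreover have "ev x g ^ i * X ^ i = ev x f ^ i"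
      using X by (simp add: power_divide ev_iff)
    moreover have "ev x g ^ i * ev x g ^ (N - i) * (ev x (C i) * X ^ i)
        = ev x (C i) * (ev x g ^ i * X ^ i) * ev x g ^ (N - i)"
      by (simp only: mult.assoc mult.commute mult.left_commute)
    ultimately show "ev x g ^ N * (ev x (C i) * X ^ i) = ev x (C i * f ^ i * g ^ (N - i))"
      by (simp only: ev_simps)
  qed (rule refl)
  finally have "ev x (\<Sum>i\<le>N. C i * f ^ i * g ^ (N - i)) = ev x g ^ N * (ev X u - x * ev X v)"
    by (simp only: ev_sum)
  also have "\<dots> = 0" using uv by simp
  finally have "ev x (\<Sum>i\<le>N. C i * f ^ i * g ^ (N - i)) = 0" .
  then have "(\<Sum>i\<le>N. C i * f ^ i * g ^ (N - i)) = 0"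
    by (simp only: ev_iff)
  then have sum_0: "C N * f ^ N + (\<Sum>i<N. C i * f ^ i * g ^ (N - i)) = 0"
    by (simp only: lessThan_Suc_atMost[symmetric] sum.lessThan_Suc diff_self_eq_0 power_0 mult_1_right add.commute)
  have "g dvd (\<Sum>i<N. C i * f ^ i * g ^ (N - i))"
  proof (rule dvd_sum)
    fix i assume "i \<in> {..<N}"
    then have "g dvd g ^ (N - i)" by (intro dvd_power) simp
    then show "g dvd C i * f ^ i * g ^ (N - i)" by (rule dvd_mult)
  qed
  then have "g dvd - (\<Sum>i<N. C i * f ^ i * g ^ (N - i))" by (simp only: dvd_minus_iff)
  then have "g dvd C N * f ^ N" using eq_neg_iff_add_eq_0[THEN iffD2, OF sum_0] by (simp only:)
  then have "g dvd f ^ N * C N" by (simp only: mult.commute)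
  then have "g dvd C N" by (rule dvd_of_dvd_power_mult[OF bezout])
  moreover have "C N \<noteq> 0"
  proof
    assume "C N = 0"
    then have *: "coeff u N = 0" "coeff v N = 0" by (simp_all add: C_def)
    have "v \<noteq> 0" using uv(2) by auto
    have "u = 0 \<or> v = 0"
    proof (cases "N = degree v")
      case True
      then have "coeff v (degree v) = 0" using *(2) by simp
      then show ?thesis by simp
    next
      case False
      then have "N = degree u" by (simp add: N_def max_def split: if_splits)
      then have "coeff u (degree u) = 0" using *(1) by simp
      then show ?thesis by simp
    qed
    then have "u = 0" using \<open>v \<noteq> 0\<close> by simp
    then have "N = degree v" by (simp add: N_def)
    then have "coeff v (degree v) = 0" using *(2) by simp
    then show False using \<open>v \<noteq> 0\<close> by simp
  qed
  ultimately have "degree g \<le> degree (C N)" by (rule dvd_imp_degree_le)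
  also have "degree (C N) \<le> 1" by (simp add: C_def)
  finally show ?thesis .
qed

text \<open>
  The bound on the denominator applies to \<open>X = f / g\<close> and to \<open>1 / X = g / f\<close>. The determinant is nonzero
  because \<open>X\<close> would otherwise be a constant.
\<close>
lemma automorphism_is_moebius:
  assumes X: "X \<in> Kx x" "x \<in> Kx X"
  obtains \<alpha> \<beta> \<gamma> \<delta> where "X = (\<iota> \<alpha> * x + \<iota> \<beta>) / (\<iota> \<gamma> * x + \<iota> \<delta>)"
    "\<alpha> * \<delta> - \<beta> * \<gamma> \<noteq> 0" "\<iota> \<gamma> * x + \<iota> \<delta> \<noteq> 0"
proof -
  have X_not_const: "X \<noteq> \<iota> c" for c
  proof
    assume "X = \<iota> c"
    then have "x \<in> range \<iota>" using X(2) Kx_const[of c] by blast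
    then show False using not_const[OF x] by blast
  qed
  obtain f' g' where fg': "X = ev x f' / ev x g'" "ev x g' \<noteq> 0" using X(1) by (rule KxE)
  obtain h f g p q where fg: "f' = h * f" "g' = h * g" "f * p + g * q = 1"
    using bezout_quotients[of f' g'] by blast
  have nz: "h \<noteq> 0" "g \<noteq> 0" using fg fg' by auto
  have X': "X = ev x f / ev x g" using fg' fg nz by simp
  have "f \<noteq> 0" using X' X_not_const[of 0] by auto
  have "degree g \<le> 1" by (rule denominator_degree_le_1[OF X' nz(2) fg(3) X(2)])
  moreover have "degree f \<le> 1"
  proof (rule denominator_degree_le_1)
    show "inverse X = ev x g / ev x f" "f \<noteq> 0" using X' \<open>f \<noteq> 0\<close> by auto
    show "g * q + f * p = 1" using fg(3) by (simp add: add.commute)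
    have "inverse (inverse X) \<in> Kx (inverse X)" by (rule Kx_closed(4)) (rule gen_in_Kx)
    then have "Kx X \<subseteq> Kx (inverse X)" by (intro Kx_subset is_subfield_Kx) auto
    then show "x \<in> Kx (inverse X)" using X(2) by auto
  qed
  ultimately obtain \<alpha> \<beta> \<gamma> \<delta> where ab: "f = [:\<beta>, \<alpha>:]" "g = [:\<delta>, \<gamma>:]"
    using poly_degree_le_1[of f] poly_degree_le_1[of g] by blast
  have evs: "ev x f = \<iota> \<alpha> * x + \<iota> \<beta>" "ev x g = \<iota> \<gamma> * x + \<iota> \<delta>"
    by (simp_all only: ab ev_simps) (simp_all add: mult.commute add.commute)
  have Xab: "X = (\<iota> \<alpha> * x + \<iota> \<beta>) / (\<iota> \<gamma> * x + \<iota> \<delta>)"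
    by (simp only: X' evs)
  have den: "\<iota> \<gamma> * x + \<iota> \<delta> \<noteq> 0"
  proof -
    have "ev x g \<noteq> 0" using nz(2) by (simp add: ev_iff)
    then show ?thesis by (simp only: evs not_False_eq_True)
  qed
  have det: "\<alpha> * \<delta> - \<beta> * \<gamma> \<noteq> 0"
  proof
    assume "\<alpha> * \<delta> - \<beta> * \<gamma> = 0"
    then have "\<iota> (\<alpha> * \<delta>) = \<iota> (\<beta> * \<gamma>)" by simp
    then have *: "\<iota> \<alpha> * \<iota> \<delta> = \<iota> \<beta> * \<iota> \<gamma>" by (simp only: hom_mult)
    show False
    proof (cases "\<gamma> = 0")
      case True
      then have "\<delta> \<noteq> 0" using den by auto
      moreover have "\<alpha> = 0" using * True \<open>\<delta> \<noteq> 0\<close> by simp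
      ultimately have "X = \<iota> (\<beta> / \<delta>)" unfolding Xab using True by (simp only: hom_div) simp
      then show False using X_not_const by blast
    next
      case False
      have "(\<iota> \<alpha> * x + \<iota> \<beta>) * \<iota> \<gamma> = \<iota> \<alpha> * (\<iota> \<gamma> * x + \<iota> \<delta>)"
        using * by (simp add: algebra_simps)
      then have "X = \<iota> \<alpha> / \<iota> \<gamma>" unfolding Xab using False den by (simp add: frac_eq_eq)
      then have "X = \<iota> (\<alpha> / \<gamma>)" by (simp only: hom_div)
      then show False using X_not_const by blast
    qed
  qed
  show ?thesis by (rule that[OF Xab det den])
qed

end

end

section \<open>Function fields with the same irreducible equation\<close>

text \<open>
  The value \<open>P(z, y)\<close> of a polynomial \<open>P \<in> K[Z][Y]\<close>.
\<close>
definition ev2 :: "('k::field \<Rightarrow> 'f::field) \<Rightarrow> 'f \<Rightarrow> 'f \<Rightarrow> 'k poly poly \<Rightarrow> 'f" where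
  "ev2 \<iota> z y P = poly (map_poly (\<lambda>p. poly (map_poly \<iota> p) z) P) y"

lemma ev2_simps:
  assumes "field_hom \<iota>"
  shows "ev2 \<iota> z y 0 = 0" "ev2 \<iota> z y 1 = 1" "ev2 \<iota> z y (P + Q) = ev2 \<iota> z y P + ev2 \<iota> z y Q"
    "ev2 \<iota> z y (P * Q) = ev2 \<iota> z y P * ev2 \<iota> z y Q" "ev2 \<iota> z y (- P) = - ev2 \<iota> z y P"
    "ev2 \<iota> z y (P ^ n) = ev2 \<iota> z y P ^ n" "ev2 \<iota> z y [:p:] = poly (map_poly \<iota> p) z"
    "ev2 \<iota> z y [:0, 1:] = y" "ev2 \<iota> z y [:[:k:]:] = \<iota> k" "ev2 \<iota> z y [:[:0, 1:]:] = z"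
    "ev2 \<iota> z y (P - Q) = ev2 \<iota> z y P - ev2 \<iota> z y Q"
proof -
  interpret field_hom \<iota> by fact
  interpret m: map_poly_inj_idom_hom \<iota> ..
  interpret h: comm_ring_hom "\<lambda>p. poly (map_poly \<iota> p) z"
    by unfold_locales (simp_all add: m.hom_add m.hom_mult)
  interpret mh: map_poly_comm_ring_hom "\<lambda>p. poly (map_poly \<iota> p) z" ..
  have const: "map_poly (\<lambda>p. poly (map_poly \<iota> p) z) [:p:] = [:poly (map_poly \<iota> p) z:]" for p
    by (rule poly_eqI) (simp add: coeff_map_poly coeff_pCons split: nat.split)
  have const': "map_poly \<iota> [:k:] = [:\<iota> k:]" for k
    by (rule poly_eqI) (simp add: coeff_map_poly coeff_pCons split: nat.split)
  show "ev2 \<iota> z y 0 = 0" "ev2 \<iota> z y 1 = 1" "ev2 \<iota> z y (P + Q) = ev2 \<iota> z y P + ev2 \<iota> z y Q"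
    "ev2 \<iota> z y (P * Q) = ev2 \<iota> z y P * ev2 \<iota> z y Q" "ev2 \<iota> z y (- P) = - ev2 \<iota> z y P"
    "ev2 \<iota> z y (P ^ n) = ev2 \<iota> z y P ^ n" "ev2 \<iota> z y [:p:] = poly (map_poly \<iota> p) z"
    "ev2 \<iota> z y [:0, 1:] = y" "ev2 \<iota> z y [:[:k:]:] = \<iota> k" "ev2 \<iota> z y [:[:0, 1:]:] = z"
    "ev2 \<iota> z y (P - Q) = ev2 \<iota> z y P - ev2 \<iota> z y Q"
    by (simp_all add: ev2_def mh.hom_add mh.hom_mult mh.hom_uminus mh.hom_minus mh.hom_power const const')
qed

text \<open>
  Let \<open>R\<close> have the least degree in \<open>Y\<close> among the nonzero polynomials that vanish at \<open>(z, y)\<close>; this degree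
  is positive as \<open>z\<close> is transcendental. By pseudo-division every vanishing \<open>P\<close> satisfies \<open>c P = R S\<close> with a
  nonzero \<open>c \<in> K[Z]\<close>. The polynomial ring is factorial, so \<open>Q\<close> is prime. Applied to \<open>P = Q\<close>, the relation
  shows that \<open>Q\<close> divides \<open>R\<close>: it cannot divide \<open>S\<close>, as \<open>R\<close> would then divide \<open>c\<close>. Hence \<open>Q\<close> divides
  every \<open>c P\<close>, and so \<open>P\<close>.
\<close>
lemma ev2_eq_0_iff_dvd:
  fixes \<iota> :: "'k::field \<Rightarrow> 'f::field"
  assumes hom: "field_hom \<iota>" and z: "transcendental_over \<iota> z"
    and Q: "irreducible Q" "ev2 \<iota> z y Q = 0"
  shows "ev2 \<iota> z y P = 0 \<longleftrightarrow> Q dvd P"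
proof
  note [simp] = ev2_simps[OF hom]
  assume "Q dvd P" then show "ev2 \<iota> z y P = 0" using Q(2) by (auto elim!: dvdE)
next
  note E = ev2_simps[OF hom]
  have degree_pos: "degree R > 0" if "R \<noteq> 0" "ev2 \<iota> z y R = 0" for R
  proof (rule ccontr)
    assume "\<not> degree R > 0"
    then obtain r where r: "R = [:r:]" by (auto elim: degree_eq_zeroE)
    then have "r \<noteq> 0" "poly (map_poly \<iota> r) z = 0" using that E(7) by auto
    then show False using z by (auto simp: transcendental_over_def)
  qed
  define A where "A = {R. R \<noteq> 0 \<and> ev2 \<iota> z y R = 0}"
  have "Q \<in> A" using Q by (auto simp: A_def)
  then obtain R where R: "R \<in> A" and minimal: "\<And>S. S \<in> A \<Longrightarrow> degree R \<le> degree S"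
    using ex_has_least_nat[of "\<lambda>R. R \<in> A" Q degree] by blast
  have R': "R \<noteq> 0" "ev2 \<iota> z y R = 0" using R by (auto simp: A_def)
  have division: "\<exists>c S. c \<noteq> 0 \<and> [:c:] * P = R * S" if "ev2 \<iota> z y P = 0" for P
  proof -
    obtain S T where ST: "pseudo_divmod P R = (S, T)" by (cases "pseudo_divmod P R")
    define c where "c = lead_coeff R ^ (Suc (degree P) - degree R)"
    have eq: "[:c:] * P = R * S + T" and T: "T = 0 \<or> degree T < degree R"
      using pseudo_divmod[OF R'(1) ST] by (simp_all add: c_def)
    have "ev2 \<iota> z y [:c:] * ev2 \<iota> z y P = ev2 \<iota> z y R * ev2 \<iota> z y S + ev2 \<iota> z y T"
      by (simp only: eq E(3,4)[symmetric])
    then have T0: "ev2 \<iota> z y T = 0" using that R'(2) by simp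
    have "T = 0"
    proof (rule ccontr)
      assume "T \<noteq> 0"
      then have "degree R \<le> degree T" using T0 by (intro minimal) (simp add: A_def)
      then show False using T \<open>T \<noteq> 0\<close> by simp
    qed
    moreover have "c \<noteq> 0" using R'(1) by (simp add: c_def)
    ultimately show ?thesis using eq by auto
  qed
  have prime: "prime_elem Q" using Q(1) by simp
  have not_const: "\<not> Q dvd [:c:]" if "c \<noteq> 0" for c
  proof
    assume "Q dvd [:c:]"
    then have "degree Q \<le> degree [:c:]" using that by (intro dvd_imp_degree_le) auto
    then show False using degree_pos[of Q] Q by auto
  qed
  assume P: "ev2 \<iota> z y P = 0"
  obtain c S where cS: "c \<noteq> 0" "[:c:] * Q = R * S" using division[OF Q(2)] by blast
  have "Q dvd R * S" using cS(2) by (metis dvd_triv_right)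
  then have "Q dvd R \<or> Q dvd S" using prime by (simp add: prime_elem_dvd_mult_iff)
  then show "Q dvd P"
  proof
    assume "Q dvd R"
    obtain c' S' where "c' \<noteq> 0" "[:c':] * P = R * S'" using division[OF P] by blast
    then have "Q dvd [:c':] * P" using \<open>Q dvd R\<close> by simp
    then have "Q dvd [:c':] \<or> Q dvd P" by (simp only: prime_elem_dvd_mult_iff[OF prime])
    then show ?thesis using not_const \<open>c' \<noteq> 0\<close> by blast
  next
    assume "Q dvd S"
    then obtain M where "S = Q * M" by (elim dvdE)
    then have "Q * [:c:] = Q * (R * M)" using cS(2) by (simp only: ac_simps)
    moreover have "Q \<noteq> 0" using Q(1) by auto
    ultimately have "[:c:] = R * M" by (simp only: mult_cancel_left) simp
    then have "R dvd [:c:]" by simp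
    then have "degree R \<le> degree [:c:]" using cS(1) by (intro dvd_imp_degree_le) auto
    then show ?thesis using degree_pos[OF R'] by simp
  qed
qed

lemma field_span_eq_ev2_quotients:
  assumes hom: "field_hom \<iota>"
    and "u \<in> field_span (range \<iota> \<union> {z, y})"
  shows "\<exists>P Q. u = ev2 \<iota> z y P / ev2 \<iota> z y Q \<and> ev2 \<iota> z y Q \<noteq> 0"
proof -
  note E = ev2_simps[OF hom]
  show ?thesis
    using assms(2)
  proof induction
    case (incl u)
    have "\<exists>P. u = ev2 \<iota> z y P"
      using incl E(8)[of z y] E(9)[of z y] E(10)[of z y] by (metis UnE empty_iff imageE insertE)
    then show ?case by (metis div_by_1 E(2) one_neq_zero)
  next
    case one
    show ?case by (intro exI[of _ 1]) (simp add: E)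
  next
    case (minus u)
    then show ?case by (metis E(5) minus_divide_left)
  next
    case (add u v)
    then obtain P Q P' Q' where "u = ev2 \<iota> z y P / ev2 \<iota> z y Q" "ev2 \<iota> z y Q \<noteq> 0"
      "v = ev2 \<iota> z y P' / ev2 \<iota> z y Q'" "ev2 \<iota> z y Q' \<noteq> 0" by blast
    then show ?case
      by (intro exI[of _ "P * Q' + P' * Q"] exI[of _ "Q * Q'"]) (simp add: E add_frac_eq)
  next
    case (mult u v)
    then obtain P Q P' Q' where "u = ev2 \<iota> z y P / ev2 \<iota> z y Q" "ev2 \<iota> z y Q \<noteq> 0"
      "v = ev2 \<iota> z y P' / ev2 \<iota> z y Q'" "ev2 \<iota> z y Q' \<noteq> 0" by blast
    then show ?case
      by (intro exI[of _ "P * P'"] exI[of _ "Q * Q'"]) (simp add: E)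
  next
    case (inverse u)
    then obtain P Q where u: "u = ev2 \<iota> z y P / ev2 \<iota> z y Q" "ev2 \<iota> z y Q \<noteq> 0" by blast
    show ?case
    proof (cases "u = 0")
      case True
      then show ?thesis by (intro exI[of _ 0] exI[of _ 1]) (simp add: E)
    next
      case False
      then show ?thesis using u by (intro exI[of _ Q] exI[of _ P]) (simp add: inverse_eq_divide)
    qed
  qed
qed

lemma field_hom_eq_on_span:
  assumes "field_hom \<sigma>" "field_hom \<tau>" "\<And>u. u \<in> X \<Longrightarrow> \<sigma> u = \<tau> u" "u \<in> field_span X"
  shows "\<sigma> u = \<tau> u"
proof -
  interpret s: field_hom \<sigma> by fact
  interpret t: field_hom \<tau> by fact
  show ?thesis
    using assms(4)
    by induction (simp_all add: assms(3) s.hom_add t.hom_add s.hom_mult t.hom_mult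
        s.hom_uminus t.hom_uminus s.hom_inverse t.hom_inverse)
qed

text \<open>
  The same polynomials vanish at both pairs, namely the multiples of \<open>Q\<close>, so sending \<open>P(z', y')\<close> to
  \<open>P(Z, Y)\<close> is a well-defined bijection of the rings of values; it extends to the quotients, which
  exhaust both fields.
\<close>
lemma ex1_K_isomorphism:
  fixes \<iota> :: "'k::field \<Rightarrow> 'f::field" and \<iota>' :: "'k \<Rightarrow> 'g::field"
  assumes hom: "field_hom \<iota>" "field_hom \<iota>'"
    and span: "field_span (range \<iota> \<union> {Z, Y}) = UNIV" "field_span (range \<iota>' \<union> {z', y'}) = UNIV"
    and tr: "transcendental_over \<iota> Z" "transcendental_over \<iota>' z'"
    and Q: "irreducible Q" "ev2 \<iota> Z Y Q = 0" "ev2 \<iota>' z' y' Q = 0"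
  shows "\<exists>!\<sigma>. K_isomorphism \<iota>' \<iota> \<sigma> \<and> (\<sigma> z', \<sigma> y') = (Z, Y)"
proof (rule ex_ex1I)
  let ?E = "ev2 \<iota> Z Y" and ?E' = "ev2 \<iota>' z' y'"
  note E = ev2_simps[OF hom(1)] and E' = ev2_simps[OF hom(2)]
  have kernel: "?E' P = 0 \<longleftrightarrow> ?E P = 0" for P
    using ev2_eq_0_iff_dvd[OF hom(1) tr(1) Q(1,2)] ev2_eq_0_iff_dvd[OF hom(2) tr(2) Q(1,3)] by simp
  have quot': "\<exists>P Q. u = ?E' P / ?E' Q \<and> ?E' Q \<noteq> 0" for u
    using field_span_eq_ev2_quotients[OF hom(2)] span(2) by blast
  have quot: "\<exists>P Q. u = ?E P / ?E Q \<and> ?E Q \<noteq> 0" for u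
    using field_span_eq_ev2_quotients[OF hom(1)] span(1) by blast
  \<comment> \<open>a chosen representation of every element as a quotient\<close>
  obtain n d where nd: "\<And>u. u = ?E' (n u) / ?E' (d u)" "\<And>u. ?E' (d u) \<noteq> 0"
    using quot' by metis
  define \<sigma> where "\<sigma> u = ?E (n u) / ?E (d u)" for u
  have \<sigma>: "\<sigma> (?E' P / ?E' R) = ?E P / ?E R" if "?E' R \<noteq> 0" for P R
  proof -
    let ?u = "?E' P / ?E' R"
    have "?E' P / ?E' R = ?E' (n ?u) / ?E' (d ?u)" using nd(1)[of ?u] .
    then have "?E' P * ?E' (d ?u) = ?E' (n ?u) * ?E' R"
      using nd(2)[of ?u] that by (simp add: frac_eq_eq)
    then have "?E' (P * d ?u - n ?u * R) = 0" by (simp add: E')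
    then have "?E (P * d ?u - n ?u * R) = 0" by (simp only: kernel)
    then have "?E P * ?E (d ?u) = ?E (n ?u) * ?E R" by (simp add: E)
    then show ?thesis
      unfolding \<sigma>_def using that nd(2)[of ?u] kernel by (simp add: frac_eq_eq)
  qed
  have \<sigma>1: "\<sigma> (?E' P) = ?E P" for P using \<sigma>[of 1 P] by (simp add: E E')
  have add: "\<sigma> (u + v) = \<sigma> u + \<sigma> v" for u v
  proof -
    obtain P R P' R' where *: "u = ?E' P / ?E' R" "?E' R \<noteq> 0" "v = ?E' P' / ?E' R'" "?E' R' \<noteq> 0"
      using quot' by metis
    then have eq: "u + v = ?E' (P * R' + P' * R) / ?E' (R * R')" by (simp add: E' add_frac_eq)
    have "?E' (R * R') \<noteq> 0" using * by (simp add: E')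
    then have "\<sigma> (u + v) = ?E (P * R' + P' * R) / ?E (R * R')" unfolding eq by (rule \<sigma>)
    then show ?thesis using * kernel by (simp add: \<sigma> E add_frac_eq)
  qed
  have mult: "\<sigma> (u * v) = \<sigma> u * \<sigma> v" for u v
  proof -
    obtain P R P' R' where *: "u = ?E' P / ?E' R" "?E' R \<noteq> 0" "v = ?E' P' / ?E' R'" "?E' R' \<noteq> 0"
      using quot' by metis
    then have eq: "u * v = ?E' (P * P') / ?E' (R * R')" by (simp add: E')
    have "?E' (R * R') \<noteq> 0" using * by (simp add: E')
    then have "\<sigma> (u * v) = ?E (P * P') / ?E (R * R')" unfolding eq by (rule \<sigma>)
    then show ?thesis using * by (simp add: \<sigma> E)
  qed
  have "surj \<sigma>"
  proof -
    have "\<exists>v. u = \<sigma> v" for u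
    proof -
      obtain P R where *: "u = ?E P / ?E R" "?E R \<noteq> 0" using quot by blast
      then show ?thesis using \<sigma>[of R P] kernel by metis
    qed
    then show ?thesis by (auto simp: surj_def)
  qed
  have "field_isom \<sigma>"
  proof unfold_locales
    show "\<sigma> 0 = 0" "\<sigma> 1 = 1" using \<sigma>1[of 0] \<sigma>1[of 1] by (simp_all add: E E')
  qed (fact add mult \<open>surj \<sigma>\<close>)+
  moreover have "\<sigma> (\<iota>' k) = \<iota> k" for k using \<sigma>1[of "[:[:k:]:]"] by (simp only: E(9) E'(9))
  moreover have "\<sigma> z' = Z" using \<sigma>1[of "[:[:0, 1:]:]"] by (simp only: E(10) E'(10))
  moreover have "\<sigma> y' = Y" using \<sigma>1[of "[:0, 1:]"] by (simp only: E(8) E'(8))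
  ultimately show "\<exists>\<sigma>. K_isomorphism \<iota>' \<iota> \<sigma> \<and> (\<sigma> z', \<sigma> y') = (Z, Y)"
    by (auto simp: K_isomorphism_def)
next
  fix \<sigma> \<tau>
  assume *: "K_isomorphism \<iota>' \<iota> \<sigma> \<and> (\<sigma> z', \<sigma> y') = (Z, Y)" "K_isomorphism \<iota>' \<iota> \<tau> \<and> (\<tau> z', \<tau> y') = (Z, Y)"
  have "field_hom \<sigma>" "field_hom \<tau>" using * by (simp_all add: K_isomorphism_def field_isom_def)
  moreover have "\<sigma> u = \<tau> u" if "u \<in> range \<iota>' \<union> {z', y'}" for u
    using that * by (auto simp: K_isomorphism_def)
  moreover have "u \<in> field_span (range \<iota>' \<union> {z', y'})" for u using span(2) by blast
  ultimately have "\<sigma> u = \<tau> u" for u by (rule field_hom_eq_on_span)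
  then show "\<sigma> = \<tau>" by (rule ext)
qed

section \<open>Transcendental elements and linear square roots\<close>

text \<open>
  Iterated division by \<open>q\<close> writes \<open>P\<close> in the basis \<open>1, X\<close> of \<open>K[X]\<close> over \<open>K[q]\<close>.
\<close>
lemma quadratic_adic_expansion:
  fixes q P :: "'k::field poly"
  assumes "degree q = 2" "P \<noteq> 0"
  shows "\<exists>A B. (A \<noteq> 0 \<or> B \<noteq> 0) \<and> P = pcompose A q + pcompose B q * [:0, 1:]"
  using assms(2)
proof (induction "degree P" arbitrary: P rule: less_induct)
  case less
  have q: "q \<noteq> 0" using assms(1) by auto
  have "degree (P mod q) \<le> 1" using degree_mod_less[OF q, of P] assms(1) by auto
  then obtain u v where uv: "P mod q = [:u, v:]" using poly_degree_le_1 by blast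
  have P: "P = q * (P div q) + [:u, v:]" by (simp flip: uv)
  show ?case
  proof (cases "P div q = 0")
    case True
    then have "P = pcompose [:u:] q + pcompose [:v:] q * [:0, 1:]" using P by simp
    moreover have "[:u:] \<noteq> 0 \<or> [:v:] \<noteq> 0" using True P less.prems by auto
    ultimately show ?thesis by blast
  next
    case False
    have "degree q \<le> degree P" using False by (metis div_poly_less not_le)
    then have "degree (P div q) < degree P" using degree_div_less[of P q] assms(1) by simp
    then obtain A B where AB: "A \<noteq> 0 \<or> B \<noteq> 0" "P div q = pcompose A q + pcompose B q * [:0, 1:]"
      using less.hyps False by blast
    have "pcompose (pCons u A) q + pcompose (pCons v B) q * [:0, 1:]
        = q * (pcompose A q + pcompose B q * [:0, 1:]) + ([:u:] + [:v:] * [:0, 1:])"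
      by (simp only: pcompose_pCons algebra_simps)
    also have "\<dots> = P" using P AB(2) by simp
    finally show ?thesis using AB(1) by (metis pCons_eq_0_iff)
  qed
qed

context char2_ext
begin

lemma ev_pcompose: "ev x (pcompose p q) = ev (ev x q) p"
  by (induction p) (simp_all add: pcompose_pCons)

lemma transcendental_overI: "(\<And>p. ev x p = 0 \<Longrightarrow> p = 0) \<Longrightarrow> transcendental_over \<iota> x"
  by (auto simp: transcendental_over_def ev_def)

lemma transcendental_polynomial:
  assumes "transcendental_over \<iota> x" "degree p > 0"
  shows "transcendental_over \<iota> (ev x p)"
proof (rule transcendental_overI)
  fix r assume "ev (ev x p) r = 0"
  then have "pcompose r p = 0" using ev_eq_0_iff[OF assms(1)] by (simp flip: ev_pcompose)
  then show "r = 0" using assms(2) by (rule pcompose_eq_0)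
qed

lemma transcendental_inverse:
  assumes "transcendental_over \<iota> x"
  shows "transcendental_over \<iota> (inverse x)"
proof (rule transcendental_overI)
  fix p assume p: "ev (inverse x) p = 0"
  have x: "x \<noteq> 0" using not_const[OF assms, of 0] by simp
  have "map_poly \<iota> (reflect_poly p) = reflect_poly (map_poly \<iota> p)"
    by (rule poly_eqI) (simp add: coeff_reflect_poly coeff_map_poly)
  then have "ev x (reflect_poly p) = x ^ degree p * ev (inverse x) p"
    using poly_reflect_poly_nz[OF x, of "map_poly \<iota> p"]
    by (simp add: ev_def)
  then have "reflect_poly p = 0" using p ev_eq_0_iff[OF assms] by simp
  then show "p = 0" by simp
qed

text \<open>
  An algebraic relation of \<open>x\<close> over \<open>K\<close> can be rewritten as \<open>A(q(x)) + B(q(x)) x = 0\<close>. Here \<open>q(x)\<close> is a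
  polynomial in \<open>S\<close>, and \<open>x\<close> is not in \<open>K(S)\<close>, so \<open>A(h(S)) = B(h(S)) = 0\<close>, against the transcendence of
  \<open>S\<close>.
\<close>
lemma transcendental_of_quadratic:
  assumes S: "transcendental_over \<iota> S" and q: "degree q = 2" and h: "degree h > 0"
    and eq: "ev x q = ev S h" and x: "x \<notin> Kx S"
  shows "transcendental_over \<iota> x"
proof (rule transcendental_overI, rule ccontr)
  fix P assume P: "ev x P = 0" "P \<noteq> 0"
  obtain A B where AB: "A \<noteq> 0 \<or> B \<noteq> 0" "P = pcompose A q + pcompose B q * [:0, 1:]"
    using quadratic_adic_expansion[OF q P(2)] by blast
  have comp: "ev (ev x q) C = ev S (pcompose C h)" for C by (simp add: ev_pcompose eq)
  have 0: "ev S (pcompose A h) + ev S (pcompose B h) * x = 0"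
  proof -
    have "ev x P = ev (ev x q) A + ev (ev x q) B * x" unfolding AB(2) by (simp add: ev_pcompose)
    then show ?thesis using P(1) by (simp only: comp)
  qed
  have "ev S (pcompose B h) = 0"
  proof (rule ccontr)
    assume nz: "ev S (pcompose B h) \<noteq> 0"
    then have "x = - ev S (pcompose A h) / ev S (pcompose B h)"
      using 0 by (simp add: field_simps eq_neg_iff_add_eq_0)
    also have "\<dots> \<in> Kx S" by (intro Kx_closed ev_in_Kx)
    finally show False using x by simp
  qed
  then have "pcompose B h = 0" "pcompose A h = 0" using 0 ev_eq_0_iff[OF S] by auto
  then show False using AB(1) h pcompose_eq_0 by blast
qed

text \<open>
  Rewriting to normal form in characteristic 2, in \<open>F\<close> and in \<open>K\<close>.
\<close>
lemmas normF = power2_eq_square power3_eq_cube power4_eq_xxxx algebra_simps char2_F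
lemmas normK = power2_eq_square power3_eq_cube power4_eq_xxxx algebra_simps char2_K

lemma linear_nonzero:
  assumes "transcendental_over \<iota> z" "m \<noteq> 0 \<or> n \<noteq> 0"
  shows "\<iota> m + \<iota> n * z \<noteq> 0"
  using ev_eq_0_iff[OF assms(1), of "[:m, n:]"] assms(2) by (auto simp: mult.commute)

lemma square_root_degree_2:
  assumes z: "transcendental_over \<iota> z" and "A \<in> Kx z"
    "A^2 = \<iota> h0 + \<iota> h1 * z + \<iota> h2 * z^2"
  obtains p r where "A = \<iota> p + \<iota> r * z" "p^2 = h0" "r^2 = h2" "h1 = 0"
proof -
  have "A^2 = ev z [:h0, h1, h2:]" unfolding assms(3) by (simp add: algebra_simps power2_eq_square)
  with assms(2) obtain s where s: "A = ev z s" "s^2 = [:h0, h1, h2:]"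
    by (rule square_root_polynomial[OF z])
  have "degree s \<le> 1" by (rule degree_square_le) (simp add: s(2))
  then obtain p r where pr: "s = [:p, r:]" using poly_degree_le_1 by blast
  have "[:p^2, 0, r^2:] = [:h0, h1, h2:]"
    using s(2) by (simp add: pr char2_square_pCons[OF CHAR_K])
  then have "p^2 = h0" "h1 = 0" "r^2 = h2" by (auto split: if_splits)
  moreover have "A = \<iota> p + \<iota> r * z" using s(1) by (simp add: pr mult.commute)
  ultimately show ?thesis using that by blast
qed

text \<open>
  The form \<open>m\<^sup>2 + n\<^sup>2 e\<close> is anisotropic: it is the norm form of the quadratic extension obtained by
  adjoining a square root of \<open>e\<close>.
\<close>
lemma not_square_ratio:
  assumes "e \<notin> squares" "m^2 + n^2 * e = 0"
  shows "m = 0 \<and> n = (0::'k)"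
proof (rule ccontr)
  assume "\<not> (m = 0 \<and> n = 0)"
  then have "n \<noteq> 0" using assms(2) by auto
  moreover have "m^2 = n^2 * e" using assms(2) char2_K by (metis add_eq_0_iff)
  ultimately have "e = (m / n)^2" by (simp add: power_divide)
  then show False using assms(1) by (auto simp: squares_def)
qed

text \<open>
  The last step for types (a) and (c). The assumptions make \<open>(Z L)\<^sup>2\<close> and \<open>(V L + y)\<^sup>2\<close> polynomials of degree
  at most 2 in \<open>z\<close>, so that \<open>Z L = p + r z\<close> and \<open>V L + y = s + u z\<close>. The vanishing of the linear
  coefficient in the second square gives \<open>p n + r m = 1\<close>. The parameters \<open>\<mu>\<^sub>2, \<mu>\<^sub>3\<close> come from expressing \<open>s + u z\<close>
  through \<open>L = m + n z\<close> and \<open>n e + m z\<close>, which is possible because the determinant of the two is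
  \<open>\<alpha> \<noteq> 0\<close>.
\<close>
lemma common_normal_form:
  assumes z: "transcendental_over \<iota> z"
    and \<alpha>: "\<alpha> = m^2 + n^2 * e" "\<alpha> \<noteq> 0"
    and L: "L = \<iota> m + \<iota> n * z" and T: "T = z^2 + \<iota> e"
    and ZT: "Z^2 + \<iota> e' = T / (\<iota> \<alpha> * L^2)"
    and VZ: "V^2 + Z = (y^2 + z + \<iota> (\<beta> / \<alpha>) * T) / L^2"
    and mem: "Z \<in> Kx z" "V + y / L \<in> Kx z"
  obtains \<mu>\<^sub>2 \<mu>\<^sub>3 where
    "Z = (\<iota> ((\<mu>\<^sub>2^2 + \<mu>\<^sub>3^2 * e) / \<alpha>) + (\<iota> n * \<iota> e + \<iota> m * z) / L) / \<iota> \<alpha>"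
    "V = (\<iota> \<mu>\<^sub>2 + (\<iota> \<mu>\<^sub>3 * (\<iota> n * \<iota> e + \<iota> m * z) + \<iota> \<alpha> * y) / L) / \<iota> \<alpha>"
    "\<alpha>^2 * e' = e + ((\<mu>\<^sub>2^2 + \<mu>\<^sub>3^2 * e) / \<alpha>)^2" "\<beta> = \<mu>\<^sub>3^2 + m * n"
proof -
  define i where "i = inverse \<alpha>"
  define b where "b = \<beta> / \<alpha>"
  have i: "\<alpha> * i = 1" using \<alpha>(2) by (simp add: i_def)
  have b: "\<beta> = b * \<alpha>" using \<alpha>(2) by (simp add: b_def)
  have "m \<noteq> 0 \<or> n \<noteq> 0" using \<alpha> by auto
  then have L0: "L \<noteq> 0" unfolding L by (rule linear_nonzero[OF z])
  have LK: "L \<in> Kx z" unfolding L by (intro Kx_closed const_in_Kx gen_in_Kx)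
  have L2: "L^2 = \<iota> (m^2) + \<iota> (n^2) * z^2" by (simp add: L sq_F power_mult_distrib hom_power)
  have Z2: "Z^2 = \<iota> e' + T / (\<iota> \<alpha> * L^2)"
    using ZT char2_F by (metis add.commute add.left_commute)
  have \<iota>i: "\<iota> i = 1 / \<iota> \<alpha>" unfolding i_def hom_inverse by (simp add: divide_inverse)
  have "(Z * L)^2 = \<iota> e' * L^2 + T * \<iota> i"
    using L0 \<alpha>(2) by (simp add: power_mult_distrib Z2 \<iota>i field_simps)
  also have "\<dots> = \<iota> (e' * m^2 + e * i) + \<iota> 0 * z + \<iota> (e' * n^2 + i) * z^2"
    by (simp add: L2 T hom_add hom_mult hom_power algebra_simps)
  finally have ZL2: "(Z * L)^2 = \<dots>" .
  have "Z * L \<in> Kx z" by (intro Kx_closed mem LK)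
  from square_root_degree_2[OF z this ZL2] obtain p r where
    pr: "Z * L = \<iota> p + \<iota> r * z" "p^2 = e' * m^2 + e * i" "r^2 = e' * n^2 + i" by blast
  have "V^2 = Z + (y^2 + z + \<iota> b * T) / L^2"
    using VZ[folded b_def] char2_F by (metis add.commute add.left_commute)
  then have "V^2 * L^2 = (Z * L) * L + (y^2 + z + \<iota> b * T)"
    using L0 by (simp add: field_simps power2_eq_square)
  then have "V^2 * L^2 + y^2 = (Z * L) * L + z + \<iota> b * T"
    by (simp add: algebra_simps char2_F)
  then have "(V * L + y)^2 = (\<iota> p + \<iota> r * z) * L + z + \<iota> b * T"
    by (simp only: sq_F power_mult_distrib pr(1))
  also have "\<dots> = \<iota> (p * m + b * e) + \<iota> (p * n + r * m + 1) * z + \<iota> (r * n + b) * z^2"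
    by (simp add: L T hom_add hom_mult algebra_simps power2_eq_square)
  finally have VL2: "(V * L + y)^2 = \<dots>" .
  have "V * L + y = (V + y / L) * L" using L0 by (simp add: field_simps)
  also have "\<dots> \<in> Kx z" by (intro Kx_closed mem LK)
  finally have "V * L + y \<in> Kx z" .
  from square_root_degree_2[OF z this VL2] obtain s u where
    su: "V * L + y = \<iota> s + \<iota> u * z" "s^2 = p * m + b * e" "u^2 = r * n + b"
      "p * n + r * m + 1 = 0" by blast
  have pnrm: "p * n + r * m = 1" using su(4) char2_K by (metis add_eq_0_iff)
  define \<mu>\<^sub>2 where "\<mu>\<^sub>2 = m * s + n * e * u"
  define \<mu>\<^sub>3 where "\<mu>\<^sub>3 = n * s + m * u"
  define \<gamma> where "\<gamma> = p * m + e * r * n"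
  have "s^2 + e * u^2 = \<gamma>"
    by (simp add: su(2,3) \<gamma>_def algebra_simps char2_K)
  moreover have "\<mu>\<^sub>2^2 + \<mu>\<^sub>3^2 * e = \<alpha> * (s^2 + e * u^2)"
    by (simp add: \<mu>\<^sub>2_def \<mu>\<^sub>3_def \<alpha>(1) normK)
  ultimately have \<gamma>: "(\<mu>\<^sub>2^2 + \<mu>\<^sub>3^2 * e) / \<alpha> = \<gamma>" using \<alpha>(2) by simp
  have pa: "\<alpha> * p = \<gamma> * m + n * e"
  proof -
    have "\<gamma> * m + n * e * (p * n + r * m) = \<alpha> * p" by (simp add: \<gamma>_def \<alpha>(1) normK)
    then show ?thesis by (simp add: pnrm)
  qed
  have ra: "\<alpha> * r = \<gamma> * n + m"
  proof -
    have "\<gamma> * n + m * (p * n + r * m) = \<alpha> * r" by (simp add: \<gamma>_def \<alpha>(1) normK)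
    then show ?thesis by (simp add: pnrm)
  qed
  have sa: "\<alpha> * s = \<mu>\<^sub>2 * m + \<mu>\<^sub>3 * n * e" "\<alpha> * u = \<mu>\<^sub>2 * n + \<mu>\<^sub>3 * m"
    by (simp_all add: \<mu>\<^sub>2_def \<mu>\<^sub>3_def \<alpha>(1) normK)
  have i\<alpha>: "\<iota> \<alpha> \<noteq> 0" using \<alpha>(2) by simp
  have "\<iota> \<alpha> * (Z * L) = \<iota> (\<alpha> * p) + \<iota> (\<alpha> * r) * z" by (simp only: pr(1)) (simp add: hom_mult algebra_simps)
  also have "\<dots> = \<iota> \<gamma> * L + (\<iota> n * \<iota> e + \<iota> m * z)"
    by (simp add: pa ra L hom_mult hom_add algebra_simps)
  finally have *: "\<iota> \<alpha> * (Z * L) = \<dots>" .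
  have 1: "Z = (\<iota> ((\<mu>\<^sub>2^2 + \<mu>\<^sub>3^2 * e) / \<alpha>) + (\<iota> n * \<iota> e + \<iota> m * z) / L) / \<iota> \<alpha>"
    unfolding \<gamma> using * L0 i\<alpha> by (simp add: field_simps)
  have "V * L = \<iota> s + \<iota> u * z + y" using su(1) char2_F by (metis add.commute add.left_commute)
  then have "\<iota> \<alpha> * (V * L) = \<iota> (\<alpha> * s) + \<iota> (\<alpha> * u) * z + \<iota> \<alpha> * y"
    by (simp add: hom_mult algebra_simps)
  also have "\<dots> = \<iota> \<mu>\<^sub>2 * L + (\<iota> \<mu>\<^sub>3 * (\<iota> n * \<iota> e + \<iota> m * z) + \<iota> \<alpha> * y)"
    by (simp add: sa L hom_mult hom_add algebra_simps)
  finally have *: "\<iota> \<alpha> * (V * L) = \<dots>" .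
  have 2: "V = (\<iota> \<mu>\<^sub>2 + (\<iota> \<mu>\<^sub>3 * (\<iota> n * \<iota> e + \<iota> m * z) + \<iota> \<alpha> * y) / L) / \<iota> \<alpha>"
    using * L0 i\<alpha> by (simp add: field_simps)
  have "\<gamma>^2 = p^2 * m^2 + e^2 * r^2 * n^2" by (simp add: \<gamma>_def sq_K power_mult_distrib)
  also have "\<dots> = e' * \<alpha>^2 + e * (\<alpha> * i)"
    unfolding pr(2,3) by (simp add: \<alpha>(1) normK)
  finally have "\<gamma>^2 = e' * \<alpha>^2 + e" by (simp add: i)
  then have 3: "\<alpha>^2 * e' = e + ((\<mu>\<^sub>2^2 + \<mu>\<^sub>3^2 * e) / \<alpha>)^2"
    unfolding \<gamma> by (simp add: algebra_simps char2_K)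
  have "\<mu>\<^sub>3^2 + m * n = n^2 * s^2 + m^2 * u^2 + m * n * (p * n + r * m)"
    by (simp add: \<mu>\<^sub>3_def sq_K power_mult_distrib pnrm)
  also have "\<dots> = b * \<alpha>"
    unfolding su(2,3) by (simp add: \<alpha>(1) normK)
  finally have 4: "\<beta> = \<mu>\<^sub>3^2 + m * n" by (simp add: b)
  show ?thesis by (rule that[OF 1 2 3 4])
qed

end

section \<open>The quartics of type (a)\<close>

text \<open>
  The products that govern type (a): with \<open>t = y\<^sup>2 + z\<close> and \<open>T = z\<^sup>2 + a\<close> the quartic is homogeneous
  quadratic in \<open>t, T\<close> up to the term \<open>b\<^sup>2 c\<^sup>3 T\<close>.
\<close>
lemma quartic_a_char2:
  fixes z y :: "'r::comm_ring_1"
  assumes "CHAR('r) = 2"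
  shows "quartic_a a b c d z y
    = b * (y^2 + z)^2 + (z^2 + a) * (y^2 + z) + (z^2 + a) * (d * (z^2 + a) + b^2 * c^3)"
  by (simp add: quartic_a_def power2_eq_square power3_eq_cube power4_eq_xxxx algebra_simps char2[OF assms])

locale pair_a = char2_ext \<iota> for \<iota> :: "'k::field \<Rightarrow> 'f::field" +
  fixes z y :: 'f and a b c d :: 'k
  assumes span: "field_span (range \<iota> \<union> {z, y}) = UNIV"
    and z_trans: "transcendental_over \<iota> z"
    and quartic: "quartic_a (\<iota> a) (\<iota> b) (\<iota> c) (\<iota> d) z y = 0"
    and a_not_square: "a \<notin> squares" and b_nz: "b \<noteq> 0" and c_nz: "c \<noteq> 0"
begin

text \<open>
  Dividing the equation by \<open>T\<^sup>2\<close> gives \<open>q(x) T = e\<close>, so \<open>T \<in> K(x)\<close> and \<open>z\<close> is a square root over \<open>K(x)\<close>.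
  The multiples \<open>w\<close> and \<open>Y\<close> of \<open>z\<close> and \<open>y\<close> clear the denominators: \<open>w\<^sup>2\<close> is the polynomial \<open>G\<close> in \<open>x\<close>, whose
  derivative is the constant \<open>e\<close>.
\<close>
definition "e = b^2 * c^3"
definition "q = [:d, 1, b:]"
definition "G = Polynomial.smult a (q^2) + Polynomial.smult e q"
definition "T = z^2 + \<iota> a"
definition "x = (y^2 + z) / T"
definition "w = ev x q * z"
definition "Y = ev x q * y"
abbreviation "F\<^sub>1 \<equiv> adj (Kx x) w"

lemma e_nz: "e \<noteq> 0" using b_nz c_nz by (simp add: e_def)

lemma T_eq_ev: "T = ev z [:a, 0, 1:]" by (simp add: T_def power2_eq_square algebra_simps)

lemma T_nz: "T \<noteq> 0"
  using ev_eq_0_iff[OF z_trans, of "[:a, 0, 1:]"] by (simp add: T_eq_ev del: ev_simps)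

lemma y2: "y^2 = x * T + z"
proof -
  have "x * T = y^2 + z" using T_nz by (simp add: x_def)
  then show ?thesis by (simp add: char2_F algebra_simps)
qed

lemma z2: "z^2 = T + \<iota> a"
  by (simp add: T_def char2_F algebra_simps)

lemma q_T: "ev x q * T = \<iota> e"
proof -
  have t: "y^2 + z = x * T" using T_nz by (simp add: x_def)
  have "T * (ev x q * T + \<iota> e) = \<iota> b * (x * T)^2 + T * (x * T) + T * (\<iota> d * T + \<iota> b^2 * \<iota> c^3)"
    by (simp add: q_def e_def hom_mult hom_power algebra_simps power2_eq_square)
  also have "\<dots> = 0" using quartic unfolding quartic_a_char2[OF CHAR_F] by (simp add: t T_def)
  finally have "ev x q * T + \<iota> e = 0" using T_nz by simp
  then show ?thesis using char2_F(3) by (metis add_eq_0_iff)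
qed

lemma q_nz: "ev x q \<noteq> 0" using q_T e_nz by auto

text \<open>
  If \<open>x\<close> were a fraction \<open>p / r\<close> in \<open>S = 1 / T\<close>, then \<open>b p\<^sup>2 + p r = r\<^sup>2 (d + e S)\<close>, whose right-hand side has odd
  degree. The left-hand side has even degree if \<open>degree p > degree r\<close>, and too small a degree otherwise.
\<close>
lemma x_trans: "transcendental_over \<iota> x"
proof (rule transcendental_of_quadratic[where S = "inverse T" and h = "[:0, e:]" and q = q])
  show S: "transcendental_over \<iota> (inverse T)"
    unfolding T_eq_ev by (intro transcendental_inverse transcendental_polynomial z_trans) simp
  show "degree q = 2" using b_nz by (simp add: q_def)
  show "0 < degree [:0, e:]" using e_nz by simp
  show xq: "ev x q = ev (inverse T) [:0, e:]" using q_T T_nz by (simp add: field_simps)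
  show "x \<notin> Kx (inverse T)"
  proof
    assume "x \<in> Kx (inverse T)"
    then obtain p r where pr: "x = ev (inverse T) p / ev (inverse T) r" "ev (inverse T) r \<noteq> 0"
      by (rule KxE)
    have r: "r \<noteq> 0" using pr(2) by auto
    have "ev (inverse T) r^2 * ev x q = ev (inverse T) (Polynomial.smult b (p^2) + p * r + Polynomial.smult d (r^2))"
      using pr by (simp add: q_def field_simps power2_eq_square)
    then have "ev (inverse T) (Polynomial.smult b (p^2) + p * r + Polynomial.smult d (r^2)) = ev (inverse T) (r^2 * [:0, e:])"
      by (simp only: xq ev_simps)
    then have "Polynomial.smult b (p^2) + p * r + Polynomial.smult d (r^2) = r^2 * [:0, e:]"
      by (simp only: ev_eq_iff[OF S])
    then have "Polynomial.smult b (p^2) + p * r = r^2 * [:0, e:] + Polynomial.smult d (r^2)"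
      by (simp add: eq_diff_eq[symmetric] char2_KX)
    also have "\<dots> = r^2 * [:d, e:]" by simp
    finally have eq: "Polynomial.smult b (p^2) + p * r = r^2 * [:d, e:]" .
    have deg: "degree (r^2 * [:d, e:]) = 2 * degree r + 1"
      using r e_nz by (subst degree_mult_eq) (simp_all add: degree_power_eq)
    show False
    proof (cases "degree p > degree r")
      case True
      then have "p \<noteq> 0" by auto
      have "degree (Polynomial.smult b (p^2)) = 2 * degree p"
        using b_nz \<open>p \<noteq> 0\<close> by (simp add: degree_power_eq)
      moreover have "degree (p * r) = degree p + degree r" using r \<open>p \<noteq> 0\<close> by (rule degree_mult_eq[rotated])
      ultimately have "degree (Polynomial.smult b (p^2) + p * r) = 2 * degree p"
        using True by (simp add: degree_add_eq_left)
      then have "2 * degree p = 2 * degree r + 1" using deg by (simp only: eq)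
      then show False by presburger
    next
      case False
      have "degree (Polynomial.smult b (p^2)) \<le> 2 * degree r"
        using False degree_power_le[of p 2] by (intro order.trans[OF degree_smult_le]) linarith
      moreover have "degree (p * r) \<le> 2 * degree r" using False degree_mult_le[of p r] by linarith
      ultimately have "degree (Polynomial.smult b (p^2) + p * r) \<le> 2 * degree r" by (rule degree_add_le)
      then show False using deg by (simp only: eq)
    qed
  qed
qed

lemma w2: "w^2 = ev x G"
proof -
  have "w^2 = ev x q * (ev x q * T) + ev x q^2 * \<iota> a"
    by (simp only: w_def power_mult_distrib z2) (simp add: algebra_simps power2_eq_square)
  then show ?thesis by (simp only: q_T) (simp add: G_def algebra_simps)
qed

lemma Y2: "Y^2 = ev x q * (w + \<iota> e * x)"
proof -
  have "Y^2 = ev x q * ((ev x q * T) * x + ev x q * z)"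
    by (simp only: Y_def power_mult_distrib y2) (simp add: algebra_simps power2_eq_square)
  then show ?thesis by (simp only: q_T) (simp add: w_def algebra_simps)
qed

lemma pderiv_q: "pderiv q = [:1:]"
  by (simp add: q_def pderiv_pCons char2_K)

lemma pderiv_G: "pderiv G = [:e:]"
  by (simp add: G_def pderiv_add pderiv_smult char2_pderiv_square[OF CHAR_K] pderiv_q)

lemma w_notin: "w \<notin> Kx x"
  using not_square_in_Kx[OF x_trans, of G w] w2 e_nz by (auto simp: pderiv_G)

lemma w2_in: "w^2 \<in> Kx x" by (simp add: w2 ev_in_Kx)

lemma subfield_F1: "is_subfield F\<^sub>1"
  by (rule is_subfield_adj[OF CHAR_F is_subfield_Kx w2_in])

lemmas F1_closed = is_subfieldD[OF subfield_F1]

lemma Kx_subset_F1: "u \<in> Kx x \<Longrightarrow> u \<in> F\<^sub>1"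
  using subset_adj[OF is_subfield_Kx] by blast

lemma Y2_in: "Y^2 \<in> F\<^sub>1"
  unfolding Y2
  by (intro F1_closed Kx_subset_F1 ev_in_Kx generator_in_adj is_subfield_Kx const_in_Kx gen_in_Kx)

lemma F_eq: "adj F\<^sub>1 Y = UNIV"
proof -
  have S: "is_subfield (adj F\<^sub>1 Y)" by (rule is_subfield_adj[OF CHAR_F subfield_F1 Y2_in])
  note D = is_subfieldD[OF S]
  have sub: "u \<in> adj F\<^sub>1 Y" if "u \<in> F\<^sub>1" for u using subset_adj[OF subfield_F1] that by blast
  have "ev x q \<in> adj F\<^sub>1 Y" by (intro sub Kx_subset_F1 ev_in_Kx)
  moreover have "w \<in> adj F\<^sub>1 Y" by (intro sub generator_in_adj is_subfield_Kx)
  moreover have "Y \<in> adj F\<^sub>1 Y" by (rule generator_in_adj[OF subfield_F1])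
  ultimately have "w / ev x q \<in> adj F\<^sub>1 Y" "Y / ev x q \<in> adj F\<^sub>1 Y" by (auto intro: D)
  then have "{z, y} \<subseteq> adj F\<^sub>1 Y" using q_nz by (simp add: w_def Y_def)
  moreover have "range \<iota> \<subseteq> adj F\<^sub>1 Y" by (auto intro!: sub Kx_subset_F1)
  ultimately show ?thesis using field_span_subset[OF S, of "range \<iota> \<union> {z, y}"] span by auto
qed

lemma square_in_F1: "u^2 \<in> F\<^sub>1"
  by (rule square_adj[OF CHAR_F subfield_F1 Y2_in]) (simp add: F_eq)

lemma square_in_Kx: "u \<in> F\<^sub>1 \<Longrightarrow> u^2 \<in> Kx x"
  by (rule square_adj[OF CHAR_F is_subfield_Kx w2_in])

text \<open>
  \<open>X\<close> is a sum of constants and of terms in which \<open>Z\<close> and \<open>X\<close> enter only through their squares. Squares lie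
  in \<open>F\<^sub>1\<close>, hence \<open>X \<in> F\<^sub>1\<close>, and then \<open>Z = V\<^sup>2 + X (Z\<^sup>2 + a') \<in> F\<^sub>1\<close>. Now \<open>X\<close> is built from squares of
  elements of \<open>F\<^sub>1\<close>, and these lie in \<open>K(x)\<close>.
\<close>
lemma frobenius_images:
  assumes "Z^2 + \<iota> a' \<noteq> 0" "V^2 + Z = X * (Z^2 + \<iota> a')"
    "(\<iota> b' * X^2 + X + \<iota> d') * (Z^2 + \<iota> a') = \<iota> e'"
  shows "X \<in> Kx x" "Z \<in> F\<^sub>1"
proof -
  have X: "X = \<iota> e' / (Z^2 + \<iota> a') + \<iota> b' * X^2 + \<iota> d'"
  proof -
    have "\<iota> b' * X^2 + X + \<iota> d' = \<iota> e' / (Z^2 + \<iota> a')"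
      by (simp only: assms(3)[symmetric]) (use assms(1) in simp)
    then have "\<iota> e' / (Z^2 + \<iota> a') + \<iota> b' * X^2 + \<iota> d' = (\<iota> b' * X^2 + X + \<iota> d') + \<iota> b' * X^2 + \<iota> d'"
      by (simp only:)
    also have "\<dots> = X" by (simp add: algebra_simps char2_F)
    finally show ?thesis by (rule sym)
  qed
  have Z: "Z = V^2 + X * (Z^2 + \<iota> a')"
    unfolding assms(2)[symmetric] by (simp add: char2_F)
  have "\<iota> e' / (Z^2 + \<iota> a') + \<iota> b' * X^2 + \<iota> d' \<in> F\<^sub>1"
    by (intro F1_closed square_in_F1 Kx_subset_F1 const_in_Kx)
  then have X1: "X \<in> F\<^sub>1" using X by simp
  have "V^2 + X * (Z^2 + \<iota> a') \<in> F\<^sub>1"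
    by (intro F1_closed square_in_F1 Kx_subset_F1 const_in_Kx X1)
  then show Z1: "Z \<in> F\<^sub>1" using Z by simp
  have "\<iota> e' / (Z^2 + \<iota> a') + \<iota> b' * X^2 + \<iota> d' \<in> Kx x"
    by (intro Kx_closed square_in_Kx const_in_Kx X1 Z1)
  then show "X \<in> Kx x" using X by simp
qed

text \<open>
  By differentiation \<open>A = t\<close> and \<open>B = s\<close> are polynomials with \<open>t\<^sup>2 + s\<^sup>2 G = h\<close>. The leading coefficient of
  \<open>s\<^sup>2 G\<close> is a square times \<open>a\<close>, so that of \<open>t\<^sup>2\<close> cannot cancel it. Hence \<open>2 degree s + 4 \<le> degree h\<close>, unless
  \<open>s = 0\<close>.
\<close>
lemma square_combination:
  assumes "A \<in> Kx x" "B \<in> Kx x" "A^2 + B^2 * w^2 = ev x h" "degree h \<le> 5"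
  obtains t v where "A = ev x t" "B = \<iota> v" "degree t \<le> 2" "t^2 + Polynomial.smult (v^2) G = h"
    "[:e * v^2:] = pderiv h"
proof -
  obtain s t where st: "A = ev x t" "B = ev x s" "t^2 + s^2 * G = h" "Polynomial.smult e (s^2) = pderiv h"
    using square_combination_polynomials[OF x_trans assms(1,2) assms(3)[unfolded w2] pderiv_G e_nz] .
  have G: "coeff G 4 = a * b^2" "degree G = 4"
    using b_nz a_not_square
    by (auto simp: G_def q_def char2_square_pCons[OF CHAR_K] squares_def numeral_eq_Suc)
  have "degree s = 0"
  proof (rule ccontr)
    assume "degree s \<noteq> 0"
    define n where "n = degree s"
    have s: "s \<noteq> 0" "n > 0" using \<open>degree s \<noteq> 0\<close> by (auto simp: n_def)
    have "2 * (n + 2) = degree (s^2) + degree G" using s(1) G(2) by (simp add: n_def degree_power_eq)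
    then have "coeff (s^2 * G) (2 * (n + 2)) = lead_coeff (s^2) * lead_coeff G"
      by (simp only: coeff_mult_degree_sum)
    also have "\<dots> = (coeff s n)^2 * (a * b^2)" by (simp add: lead_coeff_power G n_def)
    finally have "coeff (s^2 * G) (2 * (n + 2)) = (coeff s n)^2 * (a * b^2)" .
    moreover have "coeff h (2 * (n + 2)) = 0" using assms(4) s(2) by (intro coeff_eq_0) simp
    ultimately have "(coeff t (n + 2))^2 + (coeff s n)^2 * (a * b^2) = 0"
      using st(3) char2_coeff_square[OF CHAR_K, of t "n + 2"] by (metis coeff_add)
    then have "(coeff t (n + 2))^2 + (coeff s n * b)^2 * a = 0"
      by (simp add: power_mult_distrib algebra_simps)
    then have "coeff s n * b = 0" using not_square_ratio[OF a_not_square] by blast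
    then show False using s b_nz by (simp add: n_def)
  qed
  then obtain v where v: "s = [:v:]" by (auto elim: degree_eq_zeroE)
  then have s2: "s^2 = [:v^2:]" by (simp add: power2_eq_square)
  have t2: "t^2 + Polynomial.smult (v^2) G = h" using st(3) by (simp add: s2)
  then have "t^2 = h + Polynomial.smult (v^2) G" by (metis add.commute char2_KX(2))
  then have "degree (t^2) \<le> 5" using assms(4) G(2) by (auto intro!: degree_add_le order.trans[OF degree_smult_le])
  then have "degree t \<le> 2" by (cases "t = 0") (auto simp: degree_power_eq)
  moreover have "[:e * v^2:] = pderiv h" using st(4) by (simp add: s2)
  moreover have "B = \<iota> v" using st(2) v by simp
  ultimately show ?thesis using that st(1) t2 by blast
qed

end

text \<open>
  The situation after \<open>F'\<close> is transported along an isomorphism: \<open>(Z, V)\<close> is the image of \<open>(z', y')\<close>.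
\<close>
locale two_pairs_a = pair_a \<iota> z y a b c d + P': pair_a \<iota> Z V a' b' c' d'
  for \<iota> :: "'k::field \<Rightarrow> 'f::field" and z y a b c d Z V a' b' c' d'
begin

abbreviation "X \<equiv> P'.x"
abbreviation "e' \<equiv> P'.e"
abbreviation "W \<equiv> P'.w"

lemma sums: "V^2 + Z = X * (Z^2 + \<iota> a')" "(\<iota> b' * X^2 + X + \<iota> d') * (Z^2 + \<iota> a') = \<iota> e'"
    "Z^2 + \<iota> a' \<noteq> 0" "ev X P'.q = \<iota> b' * X^2 + X + \<iota> d'"
proof -
  show "V^2 + Z = X * (Z^2 + \<iota> a')" by (simp add: P'.y2 char2_F flip: P'.T_def)
  show q: "ev X P'.q = \<iota> b' * X^2 + X + \<iota> d'" by (simp add: P'.q_def algebra_simps power2_eq_square)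
  show "(\<iota> b' * X^2 + X + \<iota> d') * (Z^2 + \<iota> a') = \<iota> e'" using P'.q_T by (simp only: q P'.T_def)
  show "Z^2 + \<iota> a' \<noteq> 0" using P'.T_nz unfolding P'.T_def .
qed

lemma X_in_Kx: "X \<in> Kx x" and Z_in_F1: "Z \<in> F\<^sub>1"
  using frobenius_images[OF sums(3,1,2)] by auto

text \<open>
  Write \<open>X = n / l\<close> with linear \<open>n, l\<close>. Expanding \<open>W l\<^sup>2\<close> in the basis \<open>1, w\<close> leads to a polynomial \<open>h\<close> whose
  derivative is \<open>e'\<close> times the determinant times \<open>l\<^sup>2\<close>. By \<open>square_combination\<close> this derivative is a
  constant, hence so is \<open>l\<close>.
\<close>
lemma affine:
  obtains \<alpha> \<beta> where "X = \<iota> \<alpha> * x + \<iota> \<beta>" "\<alpha> \<noteq> 0"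
proof -
  interpret R: two_pairs_a \<iota> Z V a' b' c' d' z y a b c d ..
  obtain \<alpha> \<beta> \<gamma> \<delta> where m: "X = (\<iota> \<alpha> * x + \<iota> \<beta>) / (\<iota> \<gamma> * x + \<iota> \<delta>)"
      "\<alpha> * \<delta> - \<beta> * \<gamma> \<noteq> 0" "\<iota> \<gamma> * x + \<iota> \<delta> \<noteq> 0"
    using automorphism_is_moebius[OF x_trans X_in_Kx R.X_in_Kx] .
  define l where "l = [:\<delta>, \<gamma>:]"
  define n where "n = [:\<beta>, \<alpha>:]"
  define r where "r = Polynomial.smult b' (n^2) + n * l + Polynomial.smult d' (l^2)"
  have evl: "ev x l = \<iota> \<gamma> * x + \<iota> \<delta>" "ev x n = X * ev x l"
    using m(1,3) by (simp_all add: l_def n_def mult.commute add.commute)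
  have l0: "ev x l \<noteq> 0" using m(3) evl(1) by simp
  have evr: "ev x r = ev X P'.q * ev x l^2"
    by (simp add: r_def evl(2) sums(4) algebra_simps power2_eq_square)
  have "W \<in> F\<^sub>1" unfolding P'.w_def sums(4)
    by (intro F1_closed Z_in_F1 const_in_Kx Kx_subset_F1 X_in_Kx)
  then have "W * ev x l^2 \<in> F\<^sub>1"
    by (rule F1_closed(6)) (intro Kx_subset_F1 Kx_closed(9) ev_in_Kx)
  then obtain A B where AB: "W * ev x l^2 = A + B * w" "A \<in> Kx x" "B \<in> Kx x" by (rule adjE)
  define h where "h = Polynomial.smult a' (r^2) + Polynomial.smult e' r * l^2"
  have "A^2 + B^2 * w^2 = (W * ev x l^2)^2" by (simp add: AB(1) sq_F power_mult_distrib)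
  also have "\<dots> = W^2 * ev x l^4" by (simp add: power_mult_distrib flip: power_mult)
  also have "\<dots> = ev x h"
    unfolding P'.w2 by (simp add: P'.G_def h_def evr algebra_simps power2_eq_square power4_eq_xxxx)
  finally have comb: "A^2 + B^2 * w^2 = ev x h" .
  have r: "r = [:b' * \<beta>^2 + \<beta> * \<delta> + d' * \<delta>^2, \<alpha> * \<delta> + \<beta> * \<gamma>, b' * \<alpha>^2 + \<alpha> * \<gamma> + d' * \<gamma>^2:]"
    by (simp add: r_def l_def n_def char2_square_pCons[OF CHAR_K] algebra_simps)
  have l2: "l^2 = [:\<delta>^2, 0, \<gamma>^2:]" by (simp add: l_def char2_square_pCons[OF CHAR_K])
  have "degree h \<le> 4"
    unfolding h_def r l2 by (simp add: char2_square_pCons[OF CHAR_K])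
  then have "degree h \<le> 5" by simp
  from square_combination[OF AB(2,3) comb this] obtain v where v: "[:e * v^2:] = pderiv h"
    by blast
  have "pderiv h = [:e' * (\<alpha> * \<delta> + \<beta> * \<gamma>) * \<delta>^2, 0, e' * (\<alpha> * \<delta> + \<beta> * \<gamma>) * \<gamma>^2:]"
    unfolding h_def pderiv_add pderiv_mult pderiv_smult char2_pderiv_square[OF CHAR_K] r
    by (simp add: pderiv_pCons l2 char2_K algebra_simps)
  then have "e' * (\<alpha> * \<delta> + \<beta> * \<gamma>) * \<gamma>^2 = 0" using v by (auto split: if_splits)
  then have "\<gamma> = 0" using P'.e_nz m(2) char2_K by simp
  moreover have "\<delta> \<noteq> 0" "\<alpha> \<noteq> 0" using m(2) \<open>\<gamma> = 0\<close> by auto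
  ultimately show ?thesis
    using that[of "\<alpha> / \<delta>" "\<beta> / \<delta>"] m(1) by (simp add: hom_div add_divide_distrib)
qed

text \<open>
  Climbing the tower: \<open>W = t + \<kappa> w\<close>, and then \<open>q'(X) V = P + R w + (Q + S w) Y\<close>. Comparing the squares of both
  sides in the basis \<open>1, w\<close> gives two equations of the shape treated by \<open>square_combination\<close>; they force
  \<open>b = b' \<alpha>\<close>, \<open>\<kappa> = 1\<close>, and \<open>Q = m\<close>, \<open>S q(x) = n\<close> with constants \<open>m, n\<close> such that \<open>\<alpha> = m\<^sup>2 + n\<^sup>2 a\<close>. For
  \<open>L = m + n z\<close> this means \<open>q'(X) = q(x) L\<^sup>2\<close>, and the assumptions of \<open>common_normal_form\<close> follow.
\<close>
lemma normal_form:
  obtains \<mu>\<^sub>2 \<mu>\<^sub>3 \<mu>\<^sub>4 \<mu>\<^sub>5 where "constants_a a b c d a' b' c' d' \<mu>\<^sub>2 \<mu>\<^sub>3 \<mu>\<^sub>4 \<mu>\<^sub>5"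
    "(Z, V) = images_a \<iota> z y a \<mu>\<^sub>2 \<mu>\<^sub>3 \<mu>\<^sub>4 \<mu>\<^sub>5"
proof -
  obtain \<alpha> \<beta> where X: "X = \<iota> \<alpha> * x + \<iota> \<beta>" and \<alpha>: "\<alpha> \<noteq> 0" by (rule affine)
  define r\<^sub>0 where "r\<^sub>0 = b' * \<beta>^2 + \<beta> + d'"
  define r where "r = [:r\<^sub>0, \<alpha>, b' * \<alpha>^2:]"
  have evX: "ev X P'.q = ev x r"
    by (simp only: sums(4)) (simp add: X r_def r\<^sub>0_def hom_add hom_mult hom_power normF)
  have r_nz: "ev x r \<noteq> 0" using P'.q_nz unfolding evX .
  have W_def: "W = ev x r * Z" by (simp only: P'.w_def evX)
  have W2: "W^2 = ev x (Polynomial.smult a' (r^2) + Polynomial.smult e' r)"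
    unfolding P'.w2 by (simp add: P'.G_def evX)

  \<comment> \<open>first step of the tower: \<open>w\<close>\<close>
  have "W \<in> F\<^sub>1" unfolding W_def by (intro F1_closed(6) Z_in_F1 Kx_subset_F1 ev_in_Kx)
  then obtain A B where AB: "W = A + B * w" "A \<in> Kx x" "B \<in> Kx x" by (rule adjE)
  have comb: "A^2 + B^2 * w^2 = ev x (Polynomial.smult a' (r^2) + Polynomial.smult e' r)"
    unfolding W2[symmetric] AB(1) by (simp add: sq_F power_mult_distrib)
  have deg: "degree (Polynomial.smult a' (r^2) + Polynomial.smult e' r) \<le> 5"
    by (simp add: r_def char2_square_pCons[OF CHAR_K])
  obtain t \<kappa> where t: "A = ev x t" "B = \<iota> \<kappa>" "degree t \<le> 2"
      "t^2 + Polynomial.smult (\<kappa>^2) G = Polynomial.smult a' (r^2) + Polynomial.smult e' r"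
      "[:e * \<kappa>^2:] = pderiv (Polynomial.smult a' (r^2) + Polynomial.smult e' r)"
    using square_combination[OF AB(2,3) comb deg] .
  have e': "e' * \<alpha> = \<kappa>^2 * e"
    using t(5) by (simp add: pderiv_add pderiv_smult char2_pderiv_square[OF CHAR_K] r_def
        pderiv_pCons char2_K mult.commute split: if_splits)
  then have \<kappa>: "\<kappa> \<noteq> 0" using P'.e_nz \<alpha> by auto
  obtain t0 t1 t2 where t012: "t = [:t0, t1, t2:]" using poly_degree_le_2[OF t(3)] by blast
  have t_coeffs: "t1^2 + \<kappa>^2 * (a + e * b) = a' * \<alpha>^2 + e' * b' * \<alpha>^2"
      "t2^2 + \<kappa>^2 * (a * b^2) = a' * (b' * \<alpha>^2)^2"
    using t(4) by (simp_all add: t012 G_def q_def r_def char2_square_pCons[OF CHAR_K])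
  have W: "W = ev x t + \<iota> \<kappa> * w" by (simp only: AB(1) t(1,2))

  \<comment> \<open>second step of the tower: \<open>Y\<close>\<close>
  obtain P\<^sub>1 Q\<^sub>1 where PQ1: "ev x r * V = P\<^sub>1 + Q\<^sub>1 * Y" "P\<^sub>1 \<in> F\<^sub>1" "Q\<^sub>1 \<in> F\<^sub>1"
    using F_eq by (metis UNIV_I adjE)
  obtain P R where PR: "P\<^sub>1 = P + R * w" "P \<in> Kx x" "R \<in> Kx x" using PQ1(2) by (rule adjE)
  obtain Q S where QS: "Q\<^sub>1 = Q + S * w" "Q \<in> Kx x" "S \<in> Kx x" using PQ1(3) by (rule adjE)
  have "(ev x r * V)^2 = (P^2 + R^2 * w^2) + (Q^2 + S^2 * w^2) * (ev x q * (w + \<iota> e * x))"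
    by (simp only: PQ1(1) PR(1) QS(1) sq_F power_mult_distrib Y2)
  moreover have "(ev x r * V)^2 = ev x r * (ev x t + \<iota> \<kappa> * w + \<iota> e' * X)"
    using P'.Y2 unfolding P'.Y_def evX W .
  ultimately have eq: "ev x r * (ev x t + \<iota> e' * X) + (ev x r * \<iota> \<kappa>) * w
     = (P^2 + R^2 * w^2 + (Q^2 + S^2 * w^2) * ev x q * \<iota> e * x) + ((Q^2 + S^2 * w^2) * ev x q) * w"
    by (simp add: algebra_simps)
  have "ev x r * (ev x t + \<iota> e' * X) = P^2 + R^2 * w^2 + (Q^2 + S^2 * w^2) * ev x q * \<iota> e * x
    \<and> ev x r * \<iota> \<kappa> = (Q^2 + S^2 * w^2) * ev x q"
    by (rule adj_eq_iff[OF is_subfield_Kx w_notin, THEN iffD1, rotated 4, OF eq])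
      (intro Kx_closed(5-6) Kx_closed(9)[OF PR(2)] Kx_closed(9)[OF PR(3)] const_in_Kx gen_in_Kx
        Kx_closed(9)[OF QS(2)] Kx_closed(9)[OF QS(3)] ev_in_Kx w2_in X_in_Kx)+
  note split = this[THEN conjunct1] this[THEN conjunct2]
  have "(Q * ev x q)^2 + (S * ev x q)^2 * w^2 = (Q^2 + S^2 * w^2) * ev x q * ev x q"
    by (simp add: algebra_simps power2_eq_square)
  also have "\<dots> = ev x (Polynomial.smult \<kappa> (r * q))"
    by (simp add: split(2)[symmetric])
  finally have comb: "(Q * ev x q)^2 + (S * ev x q)^2 * w^2 = ev x (Polynomial.smult \<kappa> (r * q))" .
  \<comment> \<open>the cubic coefficient of \<open>r q\<close> must vanish, which gives \<open>b = b' \<alpha>\<close>\<close>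
  have rq: "r * q = [:r\<^sub>0 * d, r\<^sub>0 + \<alpha> * d, r\<^sub>0 * b + \<alpha> + b' * \<alpha>^2 * d, \<alpha> * b + b' * \<alpha>^2, b' * \<alpha>^2 * b:]"
    by (simp add: r_def q_def algebra_simps)
  have "degree (Polynomial.smult \<kappa> (r * q)) \<le> 5" by (simp add: rq)
  with comb obtain t' n where n: "S * ev x q = \<iota> n" "[:e * n^2:] = pderiv (Polynomial.smult \<kappa> (r * q))"
    using square_combination[of "Q * ev x q" "S * ev x q"] QS(2,3) Kx_closed(6) ev_in_Kx by metis
  have "e * n^2 = \<kappa> * (r\<^sub>0 + \<alpha> * d)" "\<kappa> * (\<alpha> * b + b' * \<alpha>^2) = 0"
    using n(2) by (simp_all add: rq pderiv_smult pderiv_pCons char2_K split: if_splits)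
  then have en: "e * n^2 = \<kappa> * (r\<^sub>0 + \<alpha> * d)" and b: "b = b' * \<alpha>"
    using \<kappa> \<alpha> char2_K by (auto simp: power2_eq_square add_eq_0_iff)
  have b\<alpha>: "b' * \<alpha>^2 = \<alpha> * b" by (simp add: b power2_eq_square)
  have "Polynomial.smult \<kappa> r = Polynomial.smult (\<kappa> * \<alpha>) q + [:e * n^2:]"
    by (simp add: en b\<alpha> r_def q_def algebra_simps char2_K)
  then have "ev x (Polynomial.smult \<kappa> r) = ev x (Polynomial.smult (\<kappa> * \<alpha>) q + [:e * n^2:])" by simp
  then have \<kappa>r: "ev x r * \<iota> \<kappa> = \<iota> \<kappa> * \<iota> \<alpha> * ev x q + \<iota> (e * n^2)"
    by (simp add: hom_mult mult.commute)
  have "Q^2 * ev x q^2 = ev x r * \<iota> \<kappa> * ev x q + (S * ev x q)^2 * w^2"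
    unfolding split(2) by (simp add: normF)
  also have "\<dots> = \<iota> (\<kappa> * \<alpha> + n^2 * a) * ev x q^2"
    by (simp only: n(1) \<kappa>r w2 G_def ev_simps) (simp add: hom_add hom_mult hom_power normF)
  finally have "Q^2 = \<iota> (\<kappa> * \<alpha> + n^2 * a)" using q_nz by simp
  then have "Q^2 = ev x [:\<kappa> * \<alpha> + n^2 * a:]" by simp
  with QS(2) obtain s where s: "Q = ev x s" "s^2 = [:\<kappa> * \<alpha> + n^2 * a:]"
    by (rule square_root_polynomial[OF x_trans])
  have "degree s \<le> 0" by (rule degree_square_le) (simp add: s(2))
  then obtain m where "s = [:m:]" by (auto elim: degree_eq_zeroE)
  then have m: "Q = \<iota> m" "m^2 = \<kappa> * \<alpha> + n^2 * a"
    using s by (auto simp: power2_eq_square)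

  \<comment> \<open>the coefficients of \<open>1\<close> in the comparison of squares; its cubic coefficient gives \<open>\<kappa> = 1\<close>\<close>
  define h where "h = r * (t + Polynomial.smult e' [:\<beta>, \<alpha>:]) + Polynomial.smult \<kappa> (r * [:0, e:])"
  have "P^2 + R^2 * w^2 = ev x r * (ev x t + \<iota> e' * X) + (ev x r * \<iota> \<kappa>) * \<iota> e * x"
    unfolding split by (simp add: normF)
  also have "\<dots> = ev x h" by (simp add: h_def X hom_mult hom_add algebra_simps)
  finally have comb: "P^2 + R^2 * w^2 = ev x h" .
  have h: "h = [:r\<^sub>0 * (t0 + e' * \<beta>), \<alpha> * (t0 + e' * \<beta>) + r\<^sub>0 * (t1 + e' * \<alpha> + \<kappa> * e),
      b' * \<alpha>^2 * (t0 + e' * \<beta>) + \<alpha> * (t1 + e' * \<alpha> + \<kappa> * e) + r\<^sub>0 * t2,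
      b' * \<alpha>^2 * (t1 + e' * \<alpha> + \<kappa> * e) + \<alpha> * t2, b' * \<alpha>^2 * t2:]"
    by (simp add: h_def r_def t012 algebra_simps)
  have "degree h \<le> 5" by (simp add: h)
  with comb PR(2,3) obtain p \<rho> where p: "P = ev x p" "R = \<iota> \<rho>" "degree p \<le> 2"
      "p^2 + Polynomial.smult (\<rho>^2) G = h" "[:e * \<rho>^2:] = pderiv h"
    using square_combination[of P R h] by blast
  have h1: "e * \<rho>^2 = \<alpha> * (t0 + e' * \<beta>) + r\<^sub>0 * (t1 + e' * \<alpha> + \<kappa> * e)"
    and h3: "b' * \<alpha>^2 * (t1 + e' * \<alpha> + \<kappa> * e) + \<alpha> * t2 = 0"
    using p(5) by (simp_all add: h pderiv_pCons char2_K split: if_splits)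
  have eb: "e' * b' * \<alpha>^2 = \<kappa>^2 * e * b"
    using e' b by (metis mult.assoc mult.commute power2_eq_square)
  have t1: "t1^2 = a' * \<alpha>^2 + \<kappa>^2 * a"
    using t_coeffs(1) unfolding eb char2_add_eq_iff[OF CHAR_K] by (simp add: algebra_simps char2_K)
  have "t2^2 = (t1 * b)^2"
  proof -
    have "t2^2 = a' * (b' * \<alpha>^2)^2 + \<kappa>^2 * (a * b^2)"
      using t_coeffs(2) unfolding char2_add_eq_iff[OF CHAR_K] .
    also have "\<dots> = (t1 * b)^2" by (simp add: power_mult_distrib t1 b\<alpha> algebra_simps)
    finally show ?thesis .
  qed
  then have t2: "t2 = t1 * b" by (simp add: char2_square_inject[OF CHAR_K])
  have "b' * \<alpha>^2 * (t1 + e' * \<alpha> + \<kappa> * e) + \<alpha> * t2 = \<alpha> * b * e * (\<kappa> * (\<kappa> + 1))"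
    unfolding b\<alpha> e' t2 by (simp add: normK)
  then have "\<alpha> * b * e * (\<kappa> * (\<kappa> + 1)) = 0" using h3 by (simp only:)
  then have "\<kappa> + 1 = 0" using \<alpha> b_nz e_nz \<kappa> by simp
  then have \<kappa>1: "\<kappa> = 1" by (simp add: add_eq_0_iff char2_K)
  have e'\<alpha>: "e' * \<alpha> = e" using e' \<kappa>1 by simp
  have \<alpha>_eq: "\<alpha> = m^2 + n^2 * a" using m(2) \<kappa>1 by (simp add: algebra_simps char2_K)
  \<comment> \<open>\<open>t\<close>, \<open>r\<close> and \<open>p\<close> are linear in \<open>q\<close>, so dividing by \<open>q(x)\<close> leaves only \<open>1 / q(x) = T / e\<close>, which is in \<open>K(z)\<close>\<close>
  have t: "t = Polynomial.smult t1 q + [:t0 + t1 * d:]"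
    by (simp add: t012 q_def t2 algebra_simps char2_K)
  define c\<^sub>0 where "c\<^sub>0 = t0 + t1 * d + e' * \<beta>"
  define \<nu> where "\<nu> = e * n^2"
  have r: "r = Polynomial.smult \<alpha> q + [:\<nu>:]"
    using \<open>Polynomial.smult \<kappa> r = _\<close> by (simp add: \<kappa>1 \<nu>_def)
  have "h = (Polynomial.smult \<alpha> q + [:\<nu>:]) * (Polynomial.smult t1 q + [:c\<^sub>0:])"
  proof -
    have "t + Polynomial.smult e' [:\<beta>, \<alpha>:] + [:0, e:] = Polynomial.smult t1 q + [:c\<^sub>0:]"
      using e'\<alpha> by (simp add: t q_def c\<^sub>0_def algebra_simps char2_K)
    moreover have "h = r * (t + Polynomial.smult e' [:\<beta>, \<alpha>:] + [:0, e:])"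
      by (simp add: h_def \<kappa>1 distrib_left)
    ultimately show ?thesis by (simp only: r)
  qed
  then have "p^2 = Polynomial.smult (\<alpha> * t1 + \<rho>^2 * a) (q^2)
      + Polynomial.smult (\<alpha> * c\<^sub>0 + \<nu> * t1 + \<rho>^2 * e) q + [:\<nu> * c\<^sub>0:]"
    using p(4) unfolding char2_add_eq_iff[OF CHAR_KX] G_def
    by (simp add: algebra_simps smult_add_left smult_add_right power2_eq_square)
  moreover obtain p0 p1 p2 where p012: "p = [:p0, p1, p2:]" using poly_degree_le_2[OF p(3)] by blast
  ultimately have p_coeffs: "\<alpha> * c\<^sub>0 + \<nu> * t1 + \<rho>^2 * e = 0" "p1^2 = \<alpha> * t1 + \<rho>^2 * a"
      "p2^2 = (\<alpha> * t1 + \<rho>^2 * a) * b^2"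
    by (simp_all add: q_def char2_square_pCons[OF CHAR_K])
  then have "p2^2 = (p1 * b)^2" by (simp add: power_mult_distrib)
  then have "p2 = p1 * b" by (simp add: char2_square_inject[OF CHAR_K])
  then have p': "p = Polynomial.smult p1 q + [:p0 + p1 * d:]"
    by (simp add: p012 q_def algebra_simps char2_K)

  define L where "L = \<iota> m + \<iota> n * z"
  have L2: "L^2 = \<iota> \<alpha> + \<iota> n^2 * T"
    by (simp add: L_def sq_F power_mult_distrib z2 \<alpha>_eq hom_add hom_mult hom_power algebra_simps char2_F)
  have "m \<noteq> 0 \<or> n \<noteq> 0" using \<alpha> \<alpha>_eq by auto
  then have L_nz: "L \<noteq> 0" unfolding L_def by (rule linear_nonzero[OF z_trans])
  have r_L: "ev x r = ev x q * L^2"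
  proof -
    have "ev x r = \<iota> \<alpha> * ev x q + \<iota> n^2 * (ev x q * T)"
      by (simp add: r \<nu>_def q_T[symmetric] hom_mult hom_power ac_simps)
    then show ?thesis by (simp add: L2 algebra_simps)
  qed
  have inv_q: "1 / ev x q = T / \<iota> e" using q_T q_nz e_nz by (simp add: field_simps)
  have Kz: "1 / ev x q \<in> Kx z" "L \<in> Kx z"
    unfolding inv_q T_def L_def by (intro Kx_closed const_in_Kx gen_in_Kx)+
  have "ev x q * (Z * L^2) = ev x t + w" using W unfolding W_def r_L \<kappa>1 by (simp add: ac_simps)
  also have "\<dots> = ev x q * (\<iota> t1 + \<iota> (t0 + t1 * d) * (1 / ev x q) + z)"
    using q_nz by (simp add: t w_def field_simps)
  finally have "Z * L^2 = \<iota> t1 + \<iota> (t0 + t1 * d) * (1 / ev x q) + z"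
    using q_nz by simp
  then have "Z = (\<iota> t1 + \<iota> (t0 + t1 * d) * (1 / ev x q) + z) / L^2"
    using L_nz by (simp add: field_simps)
  moreover have "\<dots> \<in> Kx z" by (intro Kx_closed Kz const_in_Kx gen_in_Kx)
  ultimately have Z_mem: "Z \<in> Kx z" by simp
  have Sw: "S * w = \<iota> n * z" using n(1) by (simp add: w_def mult.assoc[symmetric])
  have "ev x q * (V * L^2) = (ev x p + \<iota> \<rho> * w) + (\<iota> m + S * w) * Y"
    using PQ1(1) unfolding r_L PR(1) QS(1) p(1,2) m(1) by (simp add: ac_simps)
  also have "\<dots> = ev x q * (\<iota> p1 + \<iota> (p0 + p1 * d) * (1 / ev x q) + \<iota> \<rho> * z + L * y)"
    unfolding Sw using q_nz by (simp add: p' w_def Y_def L_def field_simps)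
  finally have "V * L^2 = \<iota> p1 + \<iota> (p0 + p1 * d) * (1 / ev x q) + \<iota> \<rho> * z + L * y"
    using q_nz by simp
  then have "V = (\<iota> p1 + \<iota> (p0 + p1 * d) * (1 / ev x q) + \<iota> \<rho> * z + L * y) / L^2"
    using L_nz by (simp add: field_simps)
  then have "V + y / L = (\<iota> p1 + \<iota> (p0 + p1 * d) * (1 / ev x q) + \<iota> \<rho> * z) / L^2"
    using L_nz by (simp add: add_divide_distrib power2_eq_square add.assoc char2_F)
  moreover have "\<dots> \<in> Kx z" by (intro Kx_closed Kz const_in_Kx gen_in_Kx)
  ultimately have V_mem: "V + y / L \<in> Kx z" by simp
  have ZT: "Z^2 + \<iota> a' = T / (\<iota> \<alpha> * L^2)"
  proof -
    have "ev x q * (\<iota> \<alpha> * L^2 * (Z^2 + \<iota> a')) = \<iota> \<alpha> * \<iota> e'"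
      using P'.q_T unfolding P'.T_def evX r_L by (simp add: ac_simps)
    also have "\<dots> = \<iota> e" by (simp add: e'\<alpha>[symmetric] hom_mult mult.commute)
    also have "\<dots> = ev x q * T" by (rule q_T[symmetric])
    finally have "\<iota> \<alpha> * L^2 * (Z^2 + \<iota> a') = T" using q_nz by simp
    then show ?thesis using \<alpha> L_nz by (simp add: field_simps)
  qed
  have VZ: "V^2 + Z = (y^2 + z + \<iota> (\<beta> / \<alpha>) * T) / L^2"
  proof -
    have "V^2 + Z = (\<iota> \<alpha> * x + \<iota> \<beta>) * (T / (\<iota> \<alpha> * L^2))"
      unfolding sums(1) ZT X ..
    also have "\<dots> = (x * T + \<iota> (\<beta> / \<alpha>) * T) / L^2"
      using \<alpha> L_nz by (simp add: hom_div field_simps)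
    also have "x * T = y^2 + z" by (simp add: y2 char2_F)
    finally show ?thesis .
  qed
  obtain \<mu>\<^sub>2 \<mu>\<^sub>3 where nf:
    "Z = (\<iota> ((\<mu>\<^sub>2^2 + \<mu>\<^sub>3^2 * a) / \<alpha>) + (\<iota> n * \<iota> a + \<iota> m * z) / L) / \<iota> \<alpha>"
    "V = (\<iota> \<mu>\<^sub>2 + (\<iota> \<mu>\<^sub>3 * (\<iota> n * \<iota> a + \<iota> m * z) + \<iota> \<alpha> * y) / L) / \<iota> \<alpha>"
    "\<alpha>^2 * a' = a + ((\<mu>\<^sub>2^2 + \<mu>\<^sub>3^2 * a) / \<alpha>)^2" "\<beta> = \<mu>\<^sub>3^2 + m * n"
    using common_normal_form[OF z_trans \<alpha>_eq \<alpha> L_def T_def ZT VZ Z_mem V_mem] .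

  \<comment> \<open>The relations \<open>b = b' \<alpha>\<close> and \<open>e' \<alpha> = e\<close> make \<open>\<theta> = c' / c\<close> a cube root of \<open>\<alpha>\<close>. Dividing the\<close>
  \<comment> \<open>four parameters by \<open>\<theta>\<close> turns \<open>\<alpha>\<close>, which is quadratic in \<open>m, n\<close>, into \<open>\<epsilon> = \<theta>\<close>.\<close>
  define \<theta> where "\<theta> = c' / c"
  have c': "c' = \<theta> * c" using c_nz by (simp add: \<theta>_def)
  have \<theta>_nz: "\<theta> \<noteq> 0" using c_nz P'.c_nz by (simp add: \<theta>_def)
  have "b'^2 * c'^3 * \<alpha> = b^2 * c^3" using e'\<alpha> by (simp only: P'.e_def e_def)
  then have "b'^2 * c^3 * \<alpha> * \<theta>^3 = b'^2 * c^3 * \<alpha> * \<alpha>"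
    by (simp add: c' b power_mult_distrib power2_eq_square ac_simps)
  then have \<theta>3: "\<alpha> = \<theta>^3" using P'.b_nz c_nz \<alpha> by simp
  define m\<^sub>4 n\<^sub>5 k\<^sub>2 k\<^sub>3 where defs: "m\<^sub>4 = m / \<theta>" "n\<^sub>5 = n / \<theta>" "k\<^sub>2 = \<mu>\<^sub>2 / \<theta>" "k\<^sub>3 = \<mu>\<^sub>3 / \<theta>"
  have mn: "m = \<theta> * m\<^sub>4" "n = \<theta> * n\<^sub>5" "\<mu>\<^sub>2 = \<theta> * k\<^sub>2" "\<mu>\<^sub>3 = \<theta> * k\<^sub>3"
    using \<theta>_nz by (simp_all add: defs)
  have eps: "eps a m\<^sub>4 n\<^sub>5 = \<theta>"
  proof -
    have "\<theta>^2 * eps a m\<^sub>4 n\<^sub>5 = \<theta>^2 * \<theta>"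
      using \<alpha>_eq by (simp add: eps_def mn \<theta>3 algebra_simps power2_eq_square power3_eq_cube)
    then show ?thesis using \<theta>_nz by simp
  qed
  have gam: "gam a k\<^sub>2 k\<^sub>3 m\<^sub>4 n\<^sub>5 = (\<mu>\<^sub>2^2 + \<mu>\<^sub>3^2 * a) / \<alpha>"
    using \<theta>_nz by (simp add: gam_def eps mn \<theta>3 field_simps power2_eq_square power3_eq_cube)
  show ?thesis
  proof (rule that[of k\<^sub>2 k\<^sub>3 m\<^sub>4 n\<^sub>5])
    have "(m\<^sub>4, n\<^sub>5) \<noteq> (0, 0)" using \<open>m \<noteq> 0 \<or> n \<noteq> 0\<close> mn by auto
    moreover have "\<theta>^6 * a' = a + (gam a k\<^sub>2 k\<^sub>3 m\<^sub>4 n\<^sub>5)^2"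
      using nf(3) unfolding gam by (simp add: \<theta>3 flip: power_mult)
    moreover have "\<theta>^3 * b' = b" by (simp add: b \<theta>3)
    moreover have "d' = \<theta> * (m\<^sub>4 * n\<^sub>5 + k\<^sub>3^2)^2 * b + \<theta>^2 * (m\<^sub>4 * n\<^sub>5 + k\<^sub>3^2)
        + \<theta>^2 * (n\<^sub>5^2 * b^2 * c^3 + \<theta> * d)"
    proof -
      have "r\<^sub>0 + \<alpha> * d = e * n^2" using en by (simp add: \<kappa>1)
      moreover have "d' = (r\<^sub>0 + \<alpha> * d) + \<alpha> * d + b' * \<beta>^2 + \<beta>"
        by (simp add: r\<^sub>0_def algebra_simps char2_K)
      ultimately have "d' = e * n^2 + \<alpha> * d + b' * \<beta>^2 + \<beta>" by (simp only:)
      also have "b' * \<beta>^2 = \<theta> * (m\<^sub>4 * n\<^sub>5 + k\<^sub>3^2)^2 * b"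
        unfolding b nf(4) by (simp add: mn \<theta>3 power2_eq_square power3_eq_cube algebra_simps)
      also have "\<beta> = \<theta>^2 * (m\<^sub>4 * n\<^sub>5 + k\<^sub>3^2)"
        unfolding nf(4) by (simp add: mn power2_eq_square algebra_simps)
      finally show ?thesis
        by (simp add: e_def mn \<theta>3 power2_eq_square power3_eq_cube algebra_simps)
    qed
    ultimately show "constants_a a b c d a' b' c' d' k\<^sub>2 k\<^sub>3 m\<^sub>4 n\<^sub>5"
      unfolding constants_a_def eps Let_def using c' by blast
    define L' where "L' = \<iota> m\<^sub>4 + \<iota> n\<^sub>5 * z"
    define N' where "N' = \<iota> n\<^sub>5 * \<iota> a + \<iota> m\<^sub>4 * z"
    have LN: "L = \<iota> \<theta> * L'" "\<iota> n * \<iota> a + \<iota> m * z = \<iota> \<theta> * N'"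
      by (simp_all add: L_def L'_def N'_def mn hom_mult algebra_simps)
    have nz: "\<iota> \<theta> \<noteq> 0" "L' \<noteq> 0" using \<theta>_nz L_nz LN(1) by auto
    have "Z = 1 / \<iota> \<theta>^3 * (\<iota> (gam a k\<^sub>2 k\<^sub>3 m\<^sub>4 n\<^sub>5) + N' / L')"
      using nf(1) nz unfolding gam LN by (simp add: \<theta>3 hom_power)
    moreover have "V = 1 / \<iota> \<theta>^2 * (\<iota> k\<^sub>2 + (\<iota> k\<^sub>3 * N' + \<iota> \<theta> * y) / L')"
    proof -
      have "V = (\<iota> \<theta> * \<iota> k\<^sub>2 + (\<iota> \<theta> * \<iota> k\<^sub>3 * (\<iota> \<theta> * N') + \<iota> \<theta>^3 * y) / (\<iota> \<theta> * L')) / \<iota> \<theta>^3"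
        using nf(2) unfolding LN mn(3,4) \<theta>3 hom_mult hom_power .
      also have "\<dots> = 1 / \<iota> \<theta>^2 * (\<iota> k\<^sub>2 + (\<iota> k\<^sub>3 * N' + \<iota> \<theta> * y) / L')"
        using nz by (simp add: field_simps power2_eq_square power3_eq_cube)
      finally show ?thesis .
    qed
    ultimately show "(Z, V) = images_a \<iota> z y a k\<^sub>2 k\<^sub>3 m\<^sub>4 n\<^sub>5"
      unfolding images_a_def eps Let_def by (simp add: L'_def N'_def)
  qed
qed

end

section \<open>The quartics of type (b)\<close>

locale pair_b = char2_ext \<iota> for \<iota> :: "'k::field \<Rightarrow> 'f::field" +
  fixes z y :: 'f and a b c :: 'k
  assumes span: "field_span (range \<iota> \<union> {z, y}) = UNIV"
    and z_trans: "transcendental_over \<iota> z"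
    and quartic: "quartic_b (\<iota> a) (\<iota> b) (\<iota> c) z y = 0"
    and b_not_square: "b \<notin> squares"
begin

definition "f = [:c, b, 0, 1, a:]"
definition "w = y^2"
abbreviation "F\<^sub>1 \<equiv> adj (Kx z) w"

lemma w2: "w^2 = ev z f"
proof -
  have "y^4 + (\<iota> a * z^4 + z^3 + \<iota> b * z + \<iota> c) = 0"
    using quartic by (simp add: quartic_b_def add.assoc)
  then have "y^4 = \<iota> a * z^4 + z^3 + \<iota> b * z + \<iota> c" by (simp add: add_eq_0_iff char2_F)
  then show ?thesis
    by (simp add: w_def f_def algebra_simps power2_eq_square power3_eq_cube power4_eq_xxxx)
qed

lemma pderiv_f: "pderiv f = [:b, 0, 1:]"
  by (simp add: f_def pderiv_pCons char2_K char2_KX)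

lemma w_notin: "w \<notin> Kx z"
  using not_square_in_Kx[OF z_trans, of f w] w2 by (auto simp: pderiv_f)

lemma w2_in: "w^2 \<in> Kx z" by (simp add: w2 ev_in_Kx)

lemma subfield_F1: "is_subfield F\<^sub>1"
  by (rule is_subfield_adj[OF CHAR_F is_subfield_Kx w2_in])

lemmas F1_closed = is_subfieldD[OF subfield_F1]

lemma Kx_subset_F1: "u \<in> Kx z \<Longrightarrow> u \<in> F\<^sub>1"
  using subset_adj[OF is_subfield_Kx] by blast

lemma y2_in: "y^2 \<in> F\<^sub>1"
  unfolding w_def[symmetric] by (rule generator_in_adj[OF is_subfield_Kx])

lemma F_eq: "adj F\<^sub>1 y = UNIV"
proof -
  have S: "is_subfield (adj F\<^sub>1 y)" by (rule is_subfield_adj[OF CHAR_F subfield_F1 y2_in])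
  have sub: "u \<in> adj F\<^sub>1 y" if "u \<in> F\<^sub>1" for u using subset_adj[OF subfield_F1] that by blast
  have "range \<iota> \<union> {z, y} \<subseteq> adj F\<^sub>1 y"
    using generator_in_adj[OF subfield_F1] by (auto intro!: sub Kx_subset_F1)
  then show ?thesis using field_span_subset[OF S, of "range \<iota> \<union> {z, y}"] span by auto
qed

lemma square_in_F1: "u^2 \<in> F\<^sub>1"
  by (rule square_adj[OF CHAR_F subfield_F1 y2_in]) (simp add: F_eq)

lemma square_in_Kx: "u \<in> F\<^sub>1 \<Longrightarrow> u^2 \<in> Kx z"
  by (rule square_adj[OF CHAR_F is_subfield_Kx w2_in])

lemma ev_quadratic_nz: "ev z [:b, 0, 1:] \<noteq> 0"
  using ev_eq_0_iff[OF z_trans, of "[:b, 0, 1:]"] by (simp del: ev_simps)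

text \<open>
  The equation expresses \<open>Z\<close> through \<open>V\<^sup>4\<close>, \<open>Z\<^sup>4\<close> and \<open>Z\<^sup>2\<close>. These are squares, so \<open>Z \<in> F\<^sub>1\<close>; then they are
  squares of elements of \<open>F\<^sub>1\<close>, so \<open>Z \<in> K(z)\<close>.
\<close>
lemma frobenius_images:
  assumes "Z^2 + \<iota> b' \<noteq> 0" "(V^2)^2 = \<iota> a' * (Z^2)^2 + Z * (Z^2 + \<iota> b') + \<iota> c'"
  shows "Z \<in> Kx z"
proof -
  have "((V^2)^2 + \<iota> a' * (Z^2)^2 + \<iota> c') = Z * (Z^2 + \<iota> b')"
    unfolding assms(2) by (simp add: algebra_simps char2_F)
  then have Z: "((V^2)^2 + \<iota> a' * (Z^2)^2 + \<iota> c') / (Z^2 + \<iota> b') = Z"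
    using assms(1) by simp
  have "((V^2)^2 + \<iota> a' * (Z^2)^2 + \<iota> c') / (Z^2 + \<iota> b') \<in> F\<^sub>1"
    by (intro F1_closed square_in_F1 Kx_subset_F1 const_in_Kx)
  then have Z1: "Z \<in> F\<^sub>1" by (simp only: Z)
  have "((V^2)^2 + \<iota> a' * (Z^2)^2 + \<iota> c') / (Z^2 + \<iota> b') \<in> Kx z"
    by (intro Kx_closed(3-8) square_in_Kx square_in_F1 const_in_Kx Z1 Kx_closed(5))
  then show ?thesis by (simp only: Z)
qed

text \<open>
  Here the derivative of \<open>f\<close> is \<open>z\<^sup>2 + b\<close>, so differentiation gives \<open>B\<^sup>2 (z\<^sup>2 + b) = h'\<close>, and
  \<open>B (z\<^sup>2 + b)\<close> is a square root of the polynomial \<open>h' (z\<^sup>2 + b)\<close>. It has degree at most 2; its coefficients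
  satisfy \<open>(s\<^sub>0 + b s\<^sub>2)\<^sup>2 + s\<^sub>1\<^sup>2 b = 0\<close>, and as \<open>b\<close> is not a square, the root is \<open>s\<^sub>2 (z\<^sup>2 + b)\<close>.
\<close>
lemma square_combination:
  assumes "A \<in> Kx z" "B \<in> Kx z" "A^2 + B^2 * w^2 = ev z h" "pderiv h = [:h\<^sub>0, 0, h\<^sub>2:]"
  obtains t v where "A = ev z t" "B = \<iota> v" "t^2 + Polynomial.smult (v^2) f = h"
    "v^2 = h\<^sub>2" "h\<^sub>0 = b * h\<^sub>2"
proof -
  have "B^2 * ev z [:b, 0, 1:] = ev z [:h\<^sub>0, 0, h\<^sub>2:]"
    using derivative_of_square_combination[OF z_trans assms(1-3)[unfolded w2]]
    by (simp only: pderiv_f assms(4))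
  then have "(B * ev z [:b, 0, 1:])^2 = ev z ([:h\<^sub>0, 0, h\<^sub>2:] * [:b, 0, 1:])"
    by (simp only: power_mult_distrib power2_eq_square[of "ev z [:b, 0, 1:]"] mult.assoc[symmetric])
      (simp only: ev_simps)
  moreover have "B * ev z [:b, 0, 1:] \<in> Kx z" by (intro Kx_closed(6) assms ev_in_Kx)
  ultimately obtain s where s: "B * ev z [:b, 0, 1:] = ev z s" "s^2 = [:h\<^sub>0, 0, h\<^sub>2:] * [:b, 0, 1:]"
    by (metis square_root_polynomial[OF z_trans])
  have "degree s \<le> 2" by (rule degree_square_le) (simp add: s(2))
  then obtain s0 s1 s2 where s012: "s = [:s0, s1, s2:]" using poly_degree_le_2 by blast
  have eqs: "s0^2 = b * h\<^sub>0" "s1^2 = h\<^sub>0 + b * h\<^sub>2" "s2^2 = h\<^sub>2"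
    using s(2) by (simp_all add: s012 char2_square_pCons[OF CHAR_K] algebra_simps split: if_splits)
  have "(s0 + b * s2)^2 + s1^2 * b = 0"
    by (simp only: sq_K power_mult_distrib eqs) (simp add: algebra_simps power2_eq_square char2_K)
  then have "s0 + b * s2 = 0 \<and> s1 = 0" by (rule not_square_ratio[OF b_not_square])
  then have s': "s0 = b * s2" "s1 = 0" by (simp_all add: char2_K add_eq_0_iff)
  then have "B * ev z [:b, 0, 1:] = \<iota> s2 * ev z [:b, 0, 1:]"
    by (simp only: s(1) s012) (simp add: hom_mult algebra_simps)
  then have B: "B = \<iota> s2" using ev_quadratic_nz by simp
  have "h\<^sub>0 = b * h\<^sub>2" using eqs(2) s'(2) by (simp add: char2_K add_eq_0_iff)
  have "A^2 = ev z (h + Polynomial.smult (s2^2) f)"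
    using assms(3) by (simp add: w2 B hom_power char2_F add.assoc flip: assms(3))
  with assms(1) obtain t where t: "A = ev z t" "t^2 = h + Polynomial.smult (s2^2) f"
    by (rule square_root_polynomial[OF z_trans])
  have "t^2 + Polynomial.smult (s2^2) f = h" by (simp add: t(2) add.assoc char2_KX)
  then show ?thesis using that t(1) B eqs(3) \<open>h\<^sub>0 = b * h\<^sub>2\<close> by blast
qed

end

locale two_pairs_b = pair_b \<iota> z y a b c + P': pair_b \<iota> Z V a' b' c'
  for \<iota> :: "'k::field \<Rightarrow> 'f::field" and z y a b c Z V a' b' c'
begin

lemma Z_in_Kx: "Z \<in> Kx z"
proof (rule frobenius_images)
  show "Z^2 + \<iota> b' \<noteq> 0"
    using P'.ev_quadratic_nz by (simp add: algebra_simps power2_eq_square)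
  show "(V^2)^2 = \<iota> a' * (Z^2)^2 + Z * (Z^2 + \<iota> b') + \<iota> c'"
    using P'.w2 by (simp add: P'.w_def P'.f_def algebra_simps power2_eq_square)
qed

text \<open>
  \<open>Z = n / l\<close> is a linear fraction. The fourth power of \<open>V l\<close> is a quartic polynomial \<open>h\<close> in \<open>z\<close> with
  \<open>h' = \<Delta> (u\<^sub>0 + u\<^sub>2 z\<^sup>2)\<close>. Taking square roots twice, once in \<open>K(z)(w)\<close> and once in \<open>F\<close>, both with
  \<open>square_combination\<close>, leaves \<open>V l = p\<^sub>0 + p\<^sub>1 z + k y\<close>; the relations are the coefficients of its fourth
  power.
\<close>
lemma linear_images:
  obtains \<alpha> \<beta> \<gamma> \<delta> p0 p1 k where
    "Z = (\<iota> \<beta> + \<iota> \<alpha> * z) / (\<iota> \<delta> + \<iota> \<gamma> * z)"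
    "V = (\<iota> p0 + \<iota> p1 * z + \<iota> k * y) / (\<iota> \<delta> + \<iota> \<gamma> * z)"
    "\<alpha> * \<delta> + \<beta> * \<gamma> \<noteq> 0"
    "k^4 = (\<alpha> * \<delta> + \<beta> * \<gamma>) * (\<alpha>^2 + b' * \<gamma>^2)"
    "\<beta>^2 + b' * \<delta>^2 = b * (\<alpha>^2 + b' * \<gamma>^2)"
    "\<beta> * \<delta> = b * \<alpha> * \<gamma>"
    "p0^4 = a' * \<beta>^4 + \<beta> * \<delta> * (\<beta>^2 + b' * \<delta>^2) + c' * \<delta>^4 + k^4 * c"
    "p1^4 = a' * \<alpha>^4 + \<alpha> * \<gamma> * (\<alpha>^2 + b' * \<gamma>^2) + c' * \<gamma>^4 + k^4 * a"
proof -
  interpret R: two_pairs_b \<iota> Z V a' b' c' z y a b c ..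
  obtain \<alpha> \<beta> \<gamma> \<delta> where m: "Z = (\<iota> \<alpha> * z + \<iota> \<beta>) / (\<iota> \<gamma> * z + \<iota> \<delta>)"
      "\<alpha> * \<delta> - \<beta> * \<gamma> \<noteq> 0" "\<iota> \<gamma> * z + \<iota> \<delta> \<noteq> 0"
    using automorphism_is_moebius[OF z_trans Z_in_Kx R.Z_in_Kx] .
  define \<Delta> where "\<Delta> = \<alpha> * \<delta> + \<beta> * \<gamma>"
  have \<Delta>: "\<Delta> \<noteq> 0" using m(2) by (simp add: \<Delta>_def char2_K)
  define l where "l = [:\<delta>, \<gamma>:]"
  define n where "n = [:\<beta>, \<alpha>:]"
  define u0 where "u0 = \<beta>^2 + b' * \<delta>^2"
  define u2 where "u2 = \<alpha>^2 + b' * \<gamma>^2"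
  define h where "h = Polynomial.smult a' ((n^2)^2) + n * l * (n^2 + Polynomial.smult b' (l^2)) + Polynomial.smult c' ((l^2)^2)"
  have evl: "ev z l = \<iota> \<gamma> * z + \<iota> \<delta>" "ev z n = Z * ev z l"
    using m(1,3) by (simp_all add: l_def n_def mult.commute add.commute)
  have l0: "ev z l \<noteq> 0" using m(3) evl(1) by simp
  have V4: "(V^2)^2 = \<iota> a' * (Z^2)^2 + Z * (Z^2 + \<iota> b') + \<iota> c'"
    using P'.w2 by (simp add: P'.w_def P'.f_def algebra_simps power2_eq_square)
  have V4l: "((V * ev z l)^2)^2 = ev z h"
  proof -
    have "((V * ev z l)^2)^2 = (V^2)^2 * (ev z l^2)^2" by (simp add: power_mult_distrib)
    also have "\<dots> = ev z h"
      unfolding V4 by (simp add: h_def evl(2) algebra_simps power2_eq_square)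
    finally show ?thesis .
  qed
  have l2: "l^2 = [:\<delta>^2, 0, \<gamma>^2:]" and n2: "n^2 = [:\<beta>^2, 0, \<alpha>^2:]"
    by (simp_all add: l_def n_def char2_square_pCons[OF CHAR_K])
  have nl: "n * l = [:\<beta> * \<delta>, \<Delta>, \<alpha> * \<gamma>:]"
    by (simp add: l_def n_def \<Delta>_def algebra_simps)
  have h: "h = [:a' * \<beta>^4 + \<beta> * \<delta> * u0 + c' * \<delta>^4, \<Delta> * u0, \<alpha> * \<gamma> * u0 + \<beta> * \<delta> * u2, \<Delta> * u2,
      a' * \<alpha>^4 + \<alpha> * \<gamma> * u2 + c' * \<gamma>^4:]"
  proof -
    have 1: "n^2 + Polynomial.smult b' (l^2) = [:u0, 0, u2:]"
      by (simp add: n2 l2 u0_def u2_def)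
    have 2: "(n^2)^2 = [:\<beta>^4, 0, 0, 0, \<alpha>^4:]" "(l^2)^2 = [:\<delta>^4, 0, 0, 0, \<gamma>^4:]"
      by (simp_all add: n2 l2 char2_square_pCons[OF CHAR_K] flip: power_mult)
    show ?thesis unfolding h_def 1 2 nl by (simp add: algebra_simps)
  qed
  have dh: "pderiv h = [:\<Delta> * u0, 0, \<Delta> * u2:]" by (simp add: h pderiv_pCons char2_K)

  have "(V * ev z l)^2 \<in> F\<^sub>1" by (rule square_in_F1)
  then obtain A B where AB: "(V * ev z l)^2 = A + B * w" "A \<in> Kx z" "B \<in> Kx z" by (rule adjE)
  have comb: "A^2 + B^2 * w^2 = ev z h"
    unfolding V4l[symmetric] AB(1) by (simp add: sq_F power_mult_distrib)
  obtain t \<kappa> where t: "A = ev z t" "B = \<iota> \<kappa>" "t^2 + Polynomial.smult (\<kappa>^2) f = h"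
      "\<kappa>^2 = \<Delta> * u2" "\<Delta> * u0 = b * (\<Delta> * u2)"
    using square_combination[OF AB(2,3) comb dh] .
  have u0: "u0 = b * u2" using t(5) \<Delta> by (simp add: algebra_simps)
  have "\<kappa>^2 \<noteq> 0"
  proof
    assume "\<kappa>^2 = 0"
    then have "u2 = 0" "u0 = 0" using t(4) \<Delta> u0 by auto
    then have "\<alpha>^2 + \<gamma>^2 * b' = 0" "\<beta>^2 + \<delta>^2 * b' = 0" by (simp_all add: u0_def u2_def mult.commute)
    then have "\<gamma> = 0" "\<delta> = 0" using not_square_ratio[OF P'.b_not_square] by blast+
    then show False using \<Delta> by (simp add: \<Delta>_def)
  qed
  have "degree (t^2) \<le> 2 * 2"
  proof -
    have "t^2 = h + Polynomial.smult (\<kappa>^2) f"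
      by (simp add: t(3)[symmetric] add.assoc char2_KX)
    then show ?thesis by (simp add: h f_def)
  qed
  then obtain t0 t1 t2 where t012: "t = [:t0, t1, t2:]"
    using degree_square_le poly_degree_le_2 by blast

  obtain P\<^sub>1 Q\<^sub>1 where PQ1: "V * ev z l = P\<^sub>1 + Q\<^sub>1 * y" "P\<^sub>1 \<in> F\<^sub>1" "Q\<^sub>1 \<in> F\<^sub>1"
    using F_eq by (metis UNIV_I adjE)
  obtain P R where PR: "P\<^sub>1 = P + R * w" "P \<in> Kx z" "R \<in> Kx z" using PQ1(2) by (rule adjE)
  obtain Q S where QS: "Q\<^sub>1 = Q + S * w" "Q \<in> Kx z" "S \<in> Kx z" using PQ1(3) by (rule adjE)
  have "(V * ev z l)^2 = (P^2 + R^2 * w^2) + (Q^2 + S^2 * w^2) * w"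
    unfolding PQ1(1) PR(1) QS(1) by (simp only: sq_F power_mult_distrib w_def[symmetric])
  then have eq: "ev z t + \<iota> \<kappa> * w = (P^2 + R^2 * w^2) + (Q^2 + S^2 * w^2) * w"
    using AB(1) t(1,2) by simp
  have "ev z t = P^2 + R^2 * w^2 \<and> \<iota> \<kappa> = Q^2 + S^2 * w^2"
    by (rule adj_eq_iff[OF is_subfield_Kx w_notin, THEN iffD1, rotated 4, OF eq])
      (intro Kx_closed(5-6) Kx_closed(9)[OF PR(2)] Kx_closed(9)[OF PR(3)] const_in_Kx
        Kx_closed(9)[OF QS(2)] Kx_closed(9)[OF QS(3)] ev_in_Kx w2_in)+
  note split = this[THEN conjunct1, symmetric] this[THEN conjunct2, symmetric]
  have "Q^2 + S^2 * w^2 = ev z [:\<kappa>:]" using split(2) by simp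
  moreover have "pderiv [:\<kappa>:] = [:0, 0, 0:]" by (simp add: pderiv_pCons)
  ultimately obtain s k' where s: "Q = ev z s" "S = \<iota> k'" "k'^2 = 0" "s^2 + Polynomial.smult (k'^2) f = [:\<kappa>:]"
    using square_combination[OF QS(2,3)] by metis
  then have S: "S = 0" and s2: "s^2 = [:\<kappa>:]" by auto
  have "degree s \<le> 0" by (rule degree_square_le) (simp add: s2)
  then obtain k where "s = [:k:]" by (auto elim: degree_eq_zeroE)
  then have k: "Q = \<iota> k" "k^2 = \<kappa>" using s(1) s2 by (auto simp: power2_eq_square)
  have "pderiv t = [:t1, 0, 0:]" by (simp add: t012 pderiv_pCons char2_K)
  with split(1) PR(2,3) obtain p r where p: "P = ev z p" "R = \<iota> r" "p^2 + Polynomial.smult (r^2) f = t" "r^2 = 0" "t1 = b * 0"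
    using square_combination[of P R t t1 0] by blast
  then have R: "R = 0" and p2: "p^2 = t" and t1: "t1 = 0" by auto
  have "degree p \<le> 1" by (rule degree_square_le) (simp add: p2 t012)
  then obtain p0 p1 where p01: "p = [:p0, p1:]" using poly_degree_le_1 by blast
  have "t = [:p0^2, 0, p1^2:]" using p2 by (simp add: p01 char2_square_pCons[OF CHAR_K])
  then have "t^2 = [:p0^4, 0, 0, 0, p1^4:]"
    by (simp add: char2_square_pCons[OF CHAR_K] flip: power_mult)
  moreover have "\<kappa>^2 = k^4" unfolding k(2)[symmetric] by (simp flip: power_mult)
  ultimately have "[:p0^4 + k^4 * c, k^4 * b, 0, k^4, p1^4 + k^4 * a:] = h"
    using t(3) by (simp add: f_def)
  note this[unfolded h pCons_eq_iff]
  then have eqs: "p0^4 + k^4 * c = a' * \<beta>^4 + \<beta> * \<delta> * u0 + c' * \<delta>^4"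
      "p1^4 + k^4 * a = a' * \<alpha>^4 + \<alpha> * \<gamma> * u2 + c' * \<gamma>^4"
      "0 = \<alpha> * \<gamma> * u0 + \<beta> * \<delta> * u2"
    by blast+
  have "u2 \<noteq> 0" using \<open>\<kappa>^2 \<noteq> 0\<close> t(4) by auto
  moreover have "u2 * (\<alpha> * \<gamma> * b + \<beta> * \<delta>) = 0" using eqs(3)[symmetric] by (simp add: u0 algebra_simps)
  ultimately have bd: "\<beta> * \<delta> = b * \<alpha> * \<gamma>" by (simp add: add_eq_0_iff char2_K ac_simps)
  show ?thesis
  proof (rule that[of \<beta> \<alpha> \<delta> \<gamma> p0 p1 k])
    show "Z = (\<iota> \<beta> + \<iota> \<alpha> * z) / (\<iota> \<delta> + \<iota> \<gamma> * z)" using m(1) by (simp add: add.commute)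
    have "V * ev z l = \<iota> p0 + \<iota> p1 * z + \<iota> k * y"
      by (simp add: PQ1(1) PR(1) QS(1) R S p(1) p01 k(1) mult.commute)
    then have "V = (\<iota> p0 + \<iota> p1 * z + \<iota> k * y) / ev z l" using l0 by (simp add: field_simps)
    then show "V = (\<iota> p0 + \<iota> p1 * z + \<iota> k * y) / (\<iota> \<delta> + \<iota> \<gamma> * z)"
      by (simp only: evl(1) add.commute)
    show "\<alpha> * \<delta> + \<beta> * \<gamma> \<noteq> 0" using \<Delta> by (simp add: \<Delta>_def)
    show "k^4 = (\<alpha> * \<delta> + \<beta> * \<gamma>) * (\<alpha>^2 + b' * \<gamma>^2)"
      using t(4) \<open>\<kappa>^2 = k^4\<close> by (simp add: \<Delta>_def u2_def)
    show "\<beta>^2 + b' * \<delta>^2 = b * (\<alpha>^2 + b' * \<gamma>^2)" using u0 by (simp only: u0_def u2_def)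
    show "\<beta> * \<delta> = b * \<alpha> * \<gamma>" by (rule bd)
    show "p0^4 = a' * \<beta>^4 + \<beta> * \<delta> * (\<beta>^2 + b' * \<delta>^2) + c' * \<delta>^4 + k^4 * c"
      "p1^4 = a' * \<alpha>^4 + \<alpha> * \<gamma> * (\<alpha>^2 + b' * \<gamma>^2) + c' * \<gamma>^4 + k^4 * a"
      using eqs(1,2) unfolding u0_def u2_def by (simp_all add: eq_diff_eq[symmetric] char2_K(4))
  qed
qed

text \<open>
  The relations make \<open>(\<beta>, \<alpha>)\<close> the multiple by \<open>\<phi>\<close> of \<open>(b \<gamma>, \<delta>)\<close>. A common factor of the coefficients of the
  linear fractions is free; it is chosen as \<open>\<rho>\<close> so that \<open>\<epsilon>\<^sup>2 \<phi> = 1\<close>. Then \<open>\<mu>\<^sub>1, \<mu>\<^sub>2\<close> come from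
  \<open>s = \<rho> p\<^sub>0\<close> and \<open>u = \<rho> p\<^sub>1\<close> by inverting a matrix of determinant \<open>\<epsilon>\<close>, and the two fourth-power relations become
  those for \<open>a'\<close> and \<open>c'\<close>.
\<close>
lemma normal_form:
  obtains \<mu>\<^sub>1 \<mu>\<^sub>2 \<mu>\<^sub>4 \<mu>\<^sub>5 where "constants_b a b c a' b' c' \<mu>\<^sub>1 \<mu>\<^sub>2 \<mu>\<^sub>4 \<mu>\<^sub>5"
    "(Z, V) = images_b \<iota> z y b \<mu>\<^sub>1 \<mu>\<^sub>2 \<mu>\<^sub>4 \<mu>\<^sub>5"
proof -
  obtain \<alpha> \<beta> \<gamma> \<delta> p0 p1 k where im:
    "Z = (\<iota> \<beta> + \<iota> \<alpha> * z) / (\<iota> \<delta> + \<iota> \<gamma> * z)"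
    "V = (\<iota> p0 + \<iota> p1 * z + \<iota> k * y) / (\<iota> \<delta> + \<iota> \<gamma> * z)" and
    \<Delta>: "\<alpha> * \<delta> + \<beta> * \<gamma> \<noteq> 0" and
    k4: "k^4 = (\<alpha> * \<delta> + \<beta> * \<gamma>) * (\<alpha>^2 + b' * \<gamma>^2)" and
    u0: "\<beta>^2 + b' * \<delta>^2 = b * (\<alpha>^2 + b' * \<gamma>^2)" and
    bd: "\<beta> * \<delta> = b * \<alpha> * \<gamma>" and
    p0: "p0^4 = a' * \<beta>^4 + \<beta> * \<delta> * (\<beta>^2 + b' * \<delta>^2) + c' * \<delta>^4 + k^4 * c" and
    p1: "p1^4 = a' * \<alpha>^4 + \<alpha> * \<gamma> * (\<alpha>^2 + b' * \<gamma>^2) + c' * \<gamma>^4 + k^4 * a"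
    by (rule linear_images)
  define \<epsilon>\<^sub>0 where "\<epsilon>\<^sub>0 = \<delta>^2 + \<gamma>^2 * b"
  have nz: "\<delta> \<noteq> 0 \<or> \<gamma> \<noteq> 0" using \<Delta> by auto
  have \<epsilon>\<^sub>0: "\<epsilon>\<^sub>0 \<noteq> 0" using not_square_ratio[OF b_not_square, of \<delta> \<gamma>] nz by (auto simp: \<epsilon>\<^sub>0_def)
  define \<phi> where "\<phi> = (\<alpha> * \<delta> + \<beta> * \<gamma>) / \<epsilon>\<^sub>0"
  have \<phi>: "\<phi> \<noteq> 0" "\<alpha> * \<delta> + \<beta> * \<gamma> = \<phi> * \<epsilon>\<^sub>0" using \<Delta> \<epsilon>\<^sub>0 by (simp_all add: \<phi>_def)
  have "\<epsilon>\<^sub>0 * \<beta> = b * \<gamma> * (\<alpha> * \<delta> + \<beta> * \<gamma>)"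
  proof -
    have "\<epsilon>\<^sub>0 * \<beta> = \<delta> * (\<beta> * \<delta>) + b * \<gamma> * \<beta> * \<gamma>" by (simp add: \<epsilon>\<^sub>0_def normK)
    then show ?thesis by (simp add: bd normK)
  qed
  then have \<beta>: "\<beta> = \<phi> * (b * \<gamma>)" using \<epsilon>\<^sub>0 by (simp add: \<phi>(2))
  have "\<epsilon>\<^sub>0 * \<alpha> = \<delta> * (\<alpha> * \<delta> + \<beta> * \<gamma>)"
  proof -
    have "\<epsilon>\<^sub>0 * \<alpha> = \<delta>^2 * \<alpha> + \<gamma> * (b * \<alpha> * \<gamma>)" by (simp add: \<epsilon>\<^sub>0_def normK)
    then have "\<epsilon>\<^sub>0 * \<alpha> = \<delta>^2 * \<alpha> + \<gamma> * (\<beta> * \<delta>)" by (simp only: bd)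
    then show ?thesis by (simp add: normK)
  qed
  then have \<alpha>: "\<alpha> = \<phi> * \<delta>" using \<epsilon>\<^sub>0 by (simp add: \<phi>(2))
  have "b' * \<epsilon>\<^sub>0 = (\<beta>^2 + b' * \<delta>^2) + b * (\<alpha>^2 + b' * \<gamma>^2) + (\<beta>^2 + b * \<alpha>^2)"
    by (simp add: \<epsilon>\<^sub>0_def normK)
  also have "\<dots> = \<phi>^2 * b * \<epsilon>\<^sub>0" unfolding u0 by (simp add: \<alpha> \<beta> \<epsilon>\<^sub>0_def normK)
  finally have b': "b' = \<phi>^2 * b" using \<epsilon>\<^sub>0 by simp
  have u2: "\<alpha>^2 + b' * \<gamma>^2 = \<phi>^2 * \<epsilon>\<^sub>0" by (simp add: \<alpha> b' \<epsilon>\<^sub>0_def normK)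
  have k4': "k^4 = \<phi>^3 * \<epsilon>\<^sub>0^2" unfolding k4 u2 \<phi>(2) by (simp add: power2_eq_square power3_eq_cube)
  have k: "k \<noteq> 0" using k4' \<phi>(1) \<epsilon>\<^sub>0 by auto

  define \<rho> where "\<rho> = k / (\<epsilon>\<^sub>0 * \<phi>)"
  have \<rho>: "\<rho> \<noteq> 0" using k \<phi>(1) \<epsilon>\<^sub>0 by (simp add: \<rho>_def)
  define \<mu>\<^sub>4 where "\<mu>\<^sub>4 = \<rho> * \<delta>"
  define \<mu>\<^sub>5 where "\<mu>\<^sub>5 = \<rho> * \<gamma>"
  define \<epsilon> where "\<epsilon> = eps b \<mu>\<^sub>4 \<mu>\<^sub>5"
  have \<epsilon>: "\<epsilon> = \<mu>\<^sub>4^2 + \<mu>\<^sub>5^2 * b" by (simp add: \<epsilon>_def eps_def)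
  have \<epsilon>\<rho>: "\<epsilon> = \<rho>^2 * \<epsilon>\<^sub>0" by (simp add: \<epsilon> \<mu>\<^sub>4_def \<mu>\<^sub>5_def \<epsilon>\<^sub>0_def normK)
  have \<epsilon>_nz: "\<epsilon> \<noteq> 0" using \<rho> \<epsilon>\<^sub>0 by (simp add: \<epsilon>\<rho>)
  have k\<rho>: "k = \<rho> * \<epsilon>\<^sub>0 * \<phi>" using \<phi>(1) \<epsilon>\<^sub>0 by (simp add: \<rho>_def)
  have "\<phi>^3 * \<epsilon>\<^sub>0^2 * (\<rho>^4 * \<epsilon>\<^sub>0^2 * \<phi>) = \<phi>^3 * \<epsilon>\<^sub>0^2 * 1"
    using k4' unfolding k\<rho> by (simp add: power_mult_distrib power2_eq_square power3_eq_cube power4_eq_xxxx ac_simps)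
  then have "\<rho>^4 * \<epsilon>\<^sub>0^2 * \<phi> = 1" using \<phi>(1) \<epsilon>\<^sub>0 by (simp only: mult_cancel_left) simp
  then have \<epsilon>\<phi>: "\<epsilon>^2 * \<phi> = 1" unfolding \<epsilon>\<rho> by (simp add: power_mult_distrib flip: power_mult)
  then have \<phi>_eq: "\<phi> = 1 / \<epsilon>^2" using \<epsilon>_nz by (simp add: field_simps)
  define s where "s = \<rho> * p0"
  define u where "u = \<rho> * p1"
  define \<mu>\<^sub>1 where "\<mu>\<^sub>1 = \<epsilon> * (\<mu>\<^sub>4 * s + b * \<mu>\<^sub>5 * u)"
  define \<mu>\<^sub>2 where "\<mu>\<^sub>2 = \<epsilon> * (\<mu>\<^sub>5 * s + \<mu>\<^sub>4 * u)"
  have pow4: "(v + v')^4 = v^4 + v'^4" for v v' :: 'k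
  proof -
    have "(v + v')^4 = ((v + v')^2)^2" by (simp flip: power_mult)
    then show ?thesis by (simp add: sq_K flip: power_mult)
  qed
  have e2: "\<epsilon>^2 = \<mu>\<^sub>4^4 + \<mu>\<^sub>5^4 * b^2" by (simp add: \<epsilon> sq_K power_mult_distrib flip: power_mult)
  have e4: "\<epsilon>^4 = \<mu>\<^sub>4^8 + \<mu>\<^sub>5^8 * b^4" by (simp add: \<epsilon> pow4 power_mult_distrib flip: power_mult)
  have scaled: "\<rho> * \<alpha> = \<phi> * \<mu>\<^sub>4" "\<rho> * \<beta> = \<phi> * (b * \<mu>\<^sub>5)" "\<rho> * k = \<epsilon> * \<phi>"
    by (simp_all add: \<alpha> \<beta> \<mu>\<^sub>4_def \<mu>\<^sub>5_def k\<rho> \<epsilon>\<rho> power2_eq_square)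
  have powers: "\<epsilon>^8 * \<phi>^4 = 1" "\<epsilon>^9 * \<phi>^3 = \<epsilon>^3" "\<epsilon>^12 * \<phi>^4 = \<epsilon>^4"
  proof -
    show 1: "\<epsilon>^8 * \<phi>^4 = 1"
      using arg_cong[OF \<epsilon>\<phi>, of "\<lambda>v. v^4"] by (simp add: power_mult_distrib flip: power_mult)
    have "\<epsilon>^9 * \<phi>^3 = (\<epsilon>^2 * \<phi>)^3 * \<epsilon>^3" by (simp add: numeral_eq_Suc ac_simps)
    then show "\<epsilon>^9 * \<phi>^3 = \<epsilon>^3" by (simp add: \<epsilon>\<phi>)
    have "\<epsilon>^12 * \<phi>^4 = \<epsilon>^4 * (\<epsilon>^8 * \<phi>^4)" by (simp add: mult.assoc[symmetric] flip: power_add)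
    then show "\<epsilon>^12 * \<phi>^4 = \<epsilon>^4" by (simp add: 1)
  qed
  have "u^4 = a' * (\<rho> * \<alpha>)^4 + (\<rho> * \<alpha>) * (\<rho> * \<gamma>) * (\<phi>^2 * (\<rho>^2 * \<epsilon>\<^sub>0)) + c' * (\<rho> * \<gamma>)^4 + (\<rho> * k)^4 * a"
    by (simp only: u_def power_mult_distrib p1[unfolded u2])
      (simp add: algebra_simps power2_eq_square power4_eq_xxxx)
  then have u4: "u^4 = a' * \<phi>^4 * \<mu>\<^sub>4^4 + \<phi>^3 * \<epsilon> * \<mu>\<^sub>4 * \<mu>\<^sub>5 + c' * \<mu>\<^sub>5^4 + \<epsilon>^4 * \<phi>^4 * a"
    by (simp only: scaled \<epsilon>\<rho>[symmetric] \<mu>\<^sub>5_def[symmetric])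
      (simp add: power_mult_distrib power2_eq_square power3_eq_cube ac_simps)
  have E1: "\<epsilon>^8 * u^4 = a' * \<mu>\<^sub>4^4 + \<epsilon>^3 * \<mu>\<^sub>4 * \<mu>\<^sub>5 + \<epsilon>^8 * c' * \<mu>\<^sub>5^4 + \<epsilon>^4 * a"
  proof -
    have "\<epsilon>^8 * u^4 = a' * (\<epsilon>^8 * \<phi>^4) * \<mu>\<^sub>4^4 + (\<epsilon>^9 * \<phi>^3) * \<mu>\<^sub>4 * \<mu>\<^sub>5 + \<epsilon>^8 * c' * \<mu>\<^sub>5^4 + (\<epsilon>^12 * \<phi>^4) * a"
      unfolding u4 by (simp add: algebra_simps numeral_eq_Suc)
    then show ?thesis by (simp only: powers) simp
  qed
  have "s^4 = a' * (\<rho> * \<beta>)^4 + (\<rho> * \<beta>) * (\<rho> * \<delta>) * (b * (\<phi>^2 * (\<rho>^2 * \<epsilon>\<^sub>0))) + c' * (\<rho> * \<delta>)^4 + (\<rho> * k)^4 * c"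
    by (simp only: s_def power_mult_distrib p0[unfolded u0 u2])
      (simp add: algebra_simps power2_eq_square power4_eq_xxxx)
  then have s4: "s^4 = a' * \<phi>^4 * b^4 * \<mu>\<^sub>5^4 + \<phi>^3 * \<epsilon> * b^2 * \<mu>\<^sub>4 * \<mu>\<^sub>5 + c' * \<mu>\<^sub>4^4 + \<epsilon>^4 * \<phi>^4 * c"
    by (simp only: scaled \<epsilon>\<rho>[symmetric] \<mu>\<^sub>4_def[symmetric])
      (simp add: power_mult_distrib power2_eq_square power3_eq_cube ac_simps)
  have E0: "\<epsilon>^8 * s^4 = a' * b^4 * \<mu>\<^sub>5^4 + \<epsilon>^3 * b^2 * \<mu>\<^sub>4 * \<mu>\<^sub>5 + \<epsilon>^8 * c' * \<mu>\<^sub>4^4 + \<epsilon>^4 * c"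
  proof -
    have "\<epsilon>^8 * s^4 = a' * (\<epsilon>^8 * \<phi>^4) * b^4 * \<mu>\<^sub>5^4 + (\<epsilon>^9 * \<phi>^3) * b^2 * \<mu>\<^sub>4 * \<mu>\<^sub>5 + \<epsilon>^8 * c' * \<mu>\<^sub>4^4 + (\<epsilon>^12 * \<phi>^4) * c"
      unfolding s4 by (simp add: algebra_simps numeral_eq_Suc)
    then show ?thesis by (simp only: powers) simp
  qed
  have "\<epsilon>^4 * \<mu>\<^sub>2^4 = \<mu>\<^sub>5^4 * (\<epsilon>^8 * s^4) + \<mu>\<^sub>4^4 * (\<epsilon>^8 * u^4)"
    by (simp only: \<mu>\<^sub>2_def pow4 power_mult_distrib) (simp add: algebra_simps numeral_eq_Suc)
  also have "\<dots> = a' * (\<mu>\<^sub>4^8 + \<mu>\<^sub>5^8 * b^4) + \<epsilon>^3 * \<mu>\<^sub>4 * \<mu>\<^sub>5 * (\<mu>\<^sub>4^4 + \<mu>\<^sub>5^4 * b^2)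
      + \<epsilon>^4 * (c * \<mu>\<^sub>5^4 + a * \<mu>\<^sub>4^4)"
    unfolding E0 E1 by (simp add: algebra_simps char2_K flip: power_add)
  also have "\<dots> = \<epsilon>^4 * (a' + \<epsilon> * \<mu>\<^sub>4 * \<mu>\<^sub>5 + c * \<mu>\<^sub>5^4 + a * \<mu>\<^sub>4^4)"
    by (simp only: e2[symmetric] e4[symmetric]) (simp add: algebra_simps numeral_eq_Suc)
  finally have "\<mu>\<^sub>2^4 = a' + \<epsilon> * \<mu>\<^sub>4 * \<mu>\<^sub>5 + c * \<mu>\<^sub>5^4 + a * \<mu>\<^sub>4^4" using \<epsilon>_nz by simp
  then have a': "a' = \<epsilon>^2 * a + \<epsilon> * \<mu>\<^sub>4 * \<mu>\<^sub>5 + \<mu>\<^sub>2^4 + \<mu>\<^sub>5^4 * (c + a * b^2)"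
    by (simp add: e2 algebra_simps char2_K)
  have "\<epsilon>^4 * \<mu>\<^sub>1^4 = \<mu>\<^sub>4^4 * (\<epsilon>^8 * s^4) + b^4 * \<mu>\<^sub>5^4 * (\<epsilon>^8 * u^4)"
    by (simp only: \<mu>\<^sub>1_def pow4 power_mult_distrib) (simp add: algebra_simps numeral_eq_Suc)
  also have "\<dots> = \<epsilon>^8 * c' * (\<mu>\<^sub>4^8 + \<mu>\<^sub>5^8 * b^4) + \<epsilon>^3 * \<mu>\<^sub>4 * \<mu>\<^sub>5 * b^2 * (\<mu>\<^sub>4^4 + \<mu>\<^sub>5^4 * b^2)
      + \<epsilon>^4 * (c * \<mu>\<^sub>4^4 + a * b^4 * \<mu>\<^sub>5^4)"
    unfolding E0 E1 by (simp add: algebra_simps char2_K flip: power_add)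
  also have "\<dots> = \<epsilon>^4 * (\<epsilon>^8 * c' + \<epsilon> * \<mu>\<^sub>4 * \<mu>\<^sub>5 * b^2 + c * \<mu>\<^sub>4^4 + a * b^4 * \<mu>\<^sub>5^4)"
    by (simp only: e2[symmetric] e4[symmetric]) (simp add: algebra_simps numeral_eq_Suc)
  finally have m1: "\<mu>\<^sub>1^4 = \<epsilon>^8 * c' + \<epsilon> * \<mu>\<^sub>4 * \<mu>\<^sub>5 * b^2 + c * \<mu>\<^sub>4^4 + a * b^4 * \<mu>\<^sub>5^4"
    using \<epsilon>_nz by simp
  have c': "\<epsilon>^6 * c' = c + (gam b \<mu>\<^sub>1 \<mu>\<^sub>2 \<mu>\<^sub>4 \<mu>\<^sub>5)^2 + (\<epsilon> * \<mu>\<^sub>4 * \<mu>\<^sub>5 + \<mu>\<^sub>2^4) * inverse (\<epsilon>^2) * b^2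
      + inverse (\<epsilon>^2) * \<mu>\<^sub>5^4 * (c + a * b^2) * b^2" (is "_ = ?r")
  proof -
    define i where "i = inverse (\<epsilon>^2)"
    have i: "\<epsilon>^2 * i = 1" using \<epsilon>_nz by (simp add: i_def)
    have "(gam b \<mu>\<^sub>1 \<mu>\<^sub>2 \<mu>\<^sub>4 \<mu>\<^sub>5)^2 = i * (\<mu>\<^sub>1^4 + \<mu>\<^sub>2^4 * b^2)"
      by (simp add: gam_def \<epsilon>_def[symmetric] i_def power_mult_distrib sq_K power_inverse flip: power_mult)
    then have "\<epsilon>^2 * ?r = \<epsilon>^2 * c + (\<epsilon>^2 * i) * (\<mu>\<^sub>1^4 + \<mu>\<^sub>2^4 * b^2 + (\<epsilon> * \<mu>\<^sub>4 * \<mu>\<^sub>5 + \<mu>\<^sub>2^4) * b^2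
        + \<mu>\<^sub>5^4 * (c + a * b^2) * b^2)"
      by (simp only: i_def[symmetric]) (simp only: algebra_simps)
    also have "\<dots> = \<epsilon>^8 * c'"
      by (simp only: i mult_1_left m1) (simp add: e2 algebra_simps char2_K flip: power_add)
    also have "\<dots> = \<epsilon>^2 * (\<epsilon>^6 * c')" by (simp add: mult.assoc[symmetric] flip: power_add)
    finally have "?r = \<epsilon>^6 * c'" using \<epsilon>_nz by (subst (asm) mult_left_cancel) auto
    then show ?thesis by (rule sym)
  qed
  show ?thesis
  proof (rule that[of \<mu>\<^sub>1 \<mu>\<^sub>2 \<mu>\<^sub>4 \<mu>\<^sub>5])
    have "(\<mu>\<^sub>4, \<mu>\<^sub>5) \<noteq> (0, 0)" using nz \<rho> by (auto simp: \<mu>\<^sub>4_def \<mu>\<^sub>5_def)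
    moreover have "\<epsilon>^4 * b' = b"
    proof -
      have "\<epsilon>^4 * b' = (\<epsilon>^2 * \<phi>)^2 * b" by (simp add: b' power_mult_distrib flip: power_mult)
      then show ?thesis by (simp add: \<epsilon>\<phi>)
    qed
    ultimately show "constants_b a b c a' b' c' \<mu>\<^sub>1 \<mu>\<^sub>2 \<mu>\<^sub>4 \<mu>\<^sub>5"
      unfolding constants_b_def Let_def \<epsilon>_def[symmetric] using a' c' by blast
    define L where "L = \<iota> \<mu>\<^sub>4 + \<iota> \<mu>\<^sub>5 * z"
    define N where "N = \<iota> \<mu>\<^sub>5 * \<iota> b + \<iota> \<mu>\<^sub>4 * z"
    have L: "L = \<iota> \<rho> * (\<iota> \<delta> + \<iota> \<gamma> * z)"
      by (simp add: L_def \<mu>\<^sub>4_def \<mu>\<^sub>5_def hom_mult algebra_simps)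
    have frac: "v / (\<iota> \<delta> + \<iota> \<gamma> * z) = (\<iota> \<rho> * v) / L" for v
      unfolding L using \<rho> by simp
    have L_nz: "L \<noteq> 0"
      unfolding L_def using \<open>(\<mu>\<^sub>4, \<mu>\<^sub>5) \<noteq> (0, 0)\<close> by (intro linear_nonzero[OF z_trans]) auto
    have \<iota>\<phi>: "\<iota> \<phi> = 1 / \<iota> \<epsilon>^2" unfolding \<phi>_eq hom_div hom_power by simp
    have "\<iota> \<rho> * (\<iota> \<beta> + \<iota> \<alpha> * z) = \<iota> (\<rho> * \<beta>) + \<iota> (\<rho> * \<alpha>) * z" by (simp add: hom_mult algebra_simps)
    also have "\<dots> = \<iota> \<phi> * N" by (simp only: scaled) (simp add: N_def hom_mult algebra_simps)
    finally have "Z = 1 / \<iota> \<epsilon>^2 * (N / L)" unfolding im(1) frac by (simp add: \<iota>\<phi>)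
    have det: "\<epsilon>^2 * s = \<mu>\<^sub>1 * \<mu>\<^sub>4 + \<mu>\<^sub>2 * \<mu>\<^sub>5 * b" "\<epsilon>^2 * u = \<mu>\<^sub>1 * \<mu>\<^sub>5 + \<mu>\<^sub>2 * \<mu>\<^sub>4"
    proof -
      have "\<epsilon>^2 * s = \<epsilon> * ((\<mu>\<^sub>4^2 + \<mu>\<^sub>5^2 * b) * s)" unfolding \<epsilon>[symmetric] by (simp add: power2_eq_square)
      also have "\<dots> = \<mu>\<^sub>1 * \<mu>\<^sub>4 + \<mu>\<^sub>2 * \<mu>\<^sub>5 * b" by (simp add: \<mu>\<^sub>1_def \<mu>\<^sub>2_def normK)
      finally show "\<epsilon>^2 * s = \<mu>\<^sub>1 * \<mu>\<^sub>4 + \<mu>\<^sub>2 * \<mu>\<^sub>5 * b" .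
      have "\<epsilon>^2 * u = \<epsilon> * ((\<mu>\<^sub>4^2 + \<mu>\<^sub>5^2 * b) * u)" unfolding \<epsilon>[symmetric] by (simp add: power2_eq_square)
      also have "\<dots> = \<mu>\<^sub>1 * \<mu>\<^sub>5 + \<mu>\<^sub>2 * \<mu>\<^sub>4" by (simp add: \<mu>\<^sub>1_def \<mu>\<^sub>2_def normK)
      finally show "\<epsilon>^2 * u = \<mu>\<^sub>1 * \<mu>\<^sub>5 + \<mu>\<^sub>2 * \<mu>\<^sub>4" .
    qed
    have "\<iota> \<epsilon>^2 * (\<iota> \<rho> * (\<iota> p0 + \<iota> p1 * z + \<iota> k * y))
        = \<iota> (\<epsilon>^2 * s) + \<iota> (\<epsilon>^2 * u) * z + \<iota> (\<epsilon> * (\<epsilon>^2 * \<phi>)) * y"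
    proof -
      have "\<epsilon> * (\<epsilon>^2 * \<phi>) = \<epsilon>^2 * (\<rho> * k)" by (simp add: scaled ac_simps)
      then show ?thesis by (simp only:) (simp add: s_def u_def hom_mult hom_power algebra_simps)
    qed
    also have "\<dots> = \<iota> \<mu>\<^sub>1 * L + (\<iota> \<mu>\<^sub>2 * N + \<iota> \<epsilon> * y)"
      unfolding det \<epsilon>\<phi> by (simp add: L_def N_def hom_mult hom_add algebra_simps)
    finally have "\<iota> \<rho> * (\<iota> p0 + \<iota> p1 * z + \<iota> k * y) = (\<iota> \<mu>\<^sub>1 * L + (\<iota> \<mu>\<^sub>2 * N + \<iota> \<epsilon> * y)) / \<iota> \<epsilon>^2"
      using \<epsilon>_nz by (simp add: field_simps)
    then have "V = 1 / \<iota> \<epsilon>^2 * (\<iota> \<mu>\<^sub>1 + (\<iota> \<mu>\<^sub>2 * N + \<iota> \<epsilon> * y) / L)"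
      unfolding im(2) frac using L_nz by (simp add: add_divide_distrib mult.commute)
    with \<open>Z = 1 / \<iota> \<epsilon>^2 * (N / L)\<close> show "(Z, V) = images_b \<iota> z y b \<mu>\<^sub>1 \<mu>\<^sub>2 \<mu>\<^sub>4 \<mu>\<^sub>5"
      unfolding images_b_def Let_def \<epsilon>_def[symmetric] L_def N_def by simp
  qed
qed

end

section \<open>The quartics of type (c)\<close>

text \<open>
  The products that govern type (c): the quartic is homogeneous quadratic in \<open>y\<^sup>2 + z\<close>, \<open>z\<^sup>2 + b\<close> and \<open>z\<^sup>2\<close>.
\<close>
lemma quartic_c_char2:
  fixes z y :: "'r::comm_ring_1"
  assumes "CHAR('r) = 2"
  shows "quartic_c a b c d z y
    = (y^2 + z)^2 + d * (z^2 + b) * (y^2 + z) + c * (z^2 + b)^2 + a * (z^2)^2"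
  by (simp add: quartic_c_def power2_eq_square power3_eq_cube power4_eq_xxxx algebra_simps char2[OF assms])

locale pair_c = char2_ext \<iota> for \<iota> :: "'k::field \<Rightarrow> 'f::field" +
  fixes z y :: 'f and a b c d :: 'k
  assumes span: "field_span (range \<iota> \<union> {z, y}) = UNIV"
    and z_trans: "transcendental_over \<iota> z"
    and quartic: "quartic_c (\<iota> a) (\<iota> b) (\<iota> c) (\<iota> d) z y = 0"
    and a_not_square: "a \<notin> squares" and b_not_square: "b \<notin> squares" and d_nz: "d \<noteq> 0"
begin

text \<open>
  Dividing the equation by \<open>T\<^sup>2\<close> gives the conic \<open>q(x) = a v\<^sup>2\<close>. As \<open>v + 1 = b / T\<close>, the factor \<open>v + 1\<close> in \<open>w\<close>
  and \<open>Y\<close> removes \<open>T\<close> from their squares: \<open>w\<^sup>2 = b (v\<^sup>2 + v)\<close> and \<open>Y\<^sup>2 = (v + 1) (w + b x)\<close>.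
\<close>
definition "q = [:c, d, 1:]"
definition "T = z^2 + \<iota> b"
definition "x = (y^2 + z) / T"
definition "v = z^2 / T"
definition "w = z * (v + 1)"
definition "Y = y * (v + 1)"
abbreviation "F\<^sub>2 \<equiv> adj (Kx x) v"
abbreviation "F\<^sub>1 \<equiv> adj F\<^sub>2 w"

lemma a_nz: "a \<noteq> 0" and b_nz: "b \<noteq> 0"
  using a_not_square b_not_square by (auto simp: squares_def intro: image_eqI[where x = 0])

lemma T_eq_ev: "T = ev z [:b, 0, 1:]" by (simp add: T_def power2_eq_square algebra_simps)

lemma T_nz: "T \<noteq> 0"
  using ev_eq_0_iff[OF z_trans, of "[:b, 0, 1:]"] by (simp add: T_eq_ev del: ev_simps)

lemma xT: "x * T = y^2 + z" using T_nz by (simp add: x_def)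

lemma v_T: "v = 1 + \<iota> b / T" and v1: "v + 1 = \<iota> b / T"
proof -
  have "v + 1 = (z^2 + T) / T" using T_nz by (simp add: v_def field_simps)
  also have "z^2 + T = \<iota> b" by (simp add: T_def char2_F)
  finally show "v + 1 = \<iota> b / T" .
  then have "v = \<iota> b / T + 1" by (rule char2_add_eq_iff[OF CHAR_F, THEN iffD1])
  then show "v = 1 + \<iota> b / T" by (simp only: add.commute)
qed

lemma v1_nz: "v + 1 \<noteq> 0" using v1 b_nz T_nz by simp

lemma conic: "ev x q = \<iota> a * v^2"
proof -
  have z2: "z^2 = v * T" using T_nz by (simp add: v_def)
  have "(ev x q + \<iota> a * v^2) * T^2 = quartic_c (\<iota> a) (\<iota> b) (\<iota> c) (\<iota> d) z y"
    unfolding quartic_c_char2[OF CHAR_F] T_def[symmetric] xT[symmetric] unfolding z2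
    by (simp add: q_def algebra_simps power2_eq_square)
  then have "ev x q + \<iota> a * v^2 = 0" using T_nz quartic by simp
  then show ?thesis by (simp add: add_eq_0_iff char2_F)
qed

text \<open>
  If \<open>x\<close> were a fraction \<open>p / r\<close> in \<open>S = 1 / T\<close>, then \<open>p\<^sup>2 + d p r + c r\<^sup>2 = r\<^sup>2 (a + a b\<^sup>2 S\<^sup>2)\<close>. In the degree
  \<open>2 N\<close> with \<open>N = max (degree p) (degree r + 1)\<close> only \<open>p\<^sup>2\<close> and \<open>a b\<^sup>2 r\<^sup>2 S\<^sup>2\<close> contribute, and as \<open>a\<close> is not a
  square, both coefficients vanish.
\<close>
lemma x_trans: "transcendental_over \<iota> x"
proof (rule transcendental_of_quadratic[where S = "inverse T" and h = "[:a, 0, a * b^2:]" and q = q])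
  show S: "transcendental_over \<iota> (inverse T)"
    unfolding T_eq_ev by (intro transcendental_inverse transcendental_polynomial z_trans) simp
  show "degree q = 2" by (simp add: q_def)
  show "0 < degree [:a, 0, a * b^2:]" using a_nz b_nz by simp
  show xq: "ev x q = ev (inverse T) [:a, 0, a * b^2:]"
    unfolding conic v_T sq_F
    by (simp add: hom_mult hom_power power_divide divide_inverse algebra_simps power2_eq_square)
  show "x \<notin> Kx (inverse T)"
  proof
    assume "x \<in> Kx (inverse T)"
    then obtain p r where pr: "x = ev (inverse T) p / ev (inverse T) r" "ev (inverse T) r \<noteq> 0"
      by (rule KxE)
    have r: "r \<noteq> 0" using pr(2) by auto
    have "ev (inverse T) r^2 * ev x q = ev (inverse T) (p^2 + Polynomial.smult d (p * r) + Polynomial.smult c (r^2))"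
      using pr by (simp add: q_def field_simps power2_eq_square)
    then have "ev (inverse T) (p^2 + Polynomial.smult d (p * r) + Polynomial.smult c (r^2))
        = ev (inverse T) (r^2 * [:a, 0, a * b^2:])"
      by (simp only: xq ev_simps)
    then have eq: "p^2 + Polynomial.smult d (p * r) + Polynomial.smult c (r^2) = r^2 * [:a, 0, a * b^2:]"
      by (simp only: ev_eq_iff[OF S])
    define N where "N = max (degree p) (Suc (degree r))"
    obtain n where n: "N = Suc n" by (cases N) (simp_all add: N_def)
    have N: "degree p \<le> N" "Suc (degree r) \<le> N" by (simp_all add: N_def)
    have coeff_pr: "coeff (p * r) (2 * N) = 0"
      using degree_mult_le[of p r] N by (intro coeff_eq_0) linarith
    have coeff_r: "coeff (r^2) (2 * N) = 0"
      using degree_power_le[of r 2] N by (intro coeff_eq_0) linarith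
    have rhs: "r^2 * [:a, 0, a * b^2:] = Polynomial.smult a (r^2) + pCons 0 (pCons 0 (Polynomial.smult (a * b^2) (r^2)))"
      by simp
    have "coeff (pCons 0 (pCons 0 (Polynomial.smult (a * b^2) (r^2)))) (2 * N) = a * b^2 * (coeff r n)^2"
      by (simp add: n char2_coeff_square[OF CHAR_K])
    then have pn: "(coeff p N)^2 = a * b^2 * (coeff r n)^2"
      using arg_cong[OF eq, of "\<lambda>f. coeff f (2 * N)"] coeff_pr coeff_r
      unfolding rhs by (simp add: char2_coeff_square[OF CHAR_K])
    have "(coeff p N)^2 + (b * coeff r n)^2 * a = a * b^2 * (coeff r n)^2 + a * b^2 * (coeff r n)^2"
      unfolding pn by (simp add: power_mult_distrib)
    then have "(coeff p N)^2 + (b * coeff r n)^2 * a = 0" by (simp only: char2_K(1))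
    then have "coeff p N = 0 \<and> b * coeff r n = 0" by (rule not_square_ratio[OF a_not_square])
    then have 0: "coeff p N = 0" "coeff r n = 0" using b_nz by simp_all
    show False
    proof (cases "degree p \<le> Suc (degree r)")
      case True
      then have "n = degree r" using n by (simp add: N_def)
      then show False using 0(2) r by simp
    next
      case False
      then have "N = degree p" by (simp add: N_def)
      then show False using 0(1) False by auto
    qed
  qed
qed

text \<open>
  The square of \<open>v\<close> as a polynomial in \<open>x\<close>; its derivative is a nonzero constant.
\<close>
definition "q\<^sub>a = Polynomial.smult (inverse a) q"

lemma v2: "v^2 = ev x q\<^sub>a"
proof -
  have "ev x q\<^sub>a = \<iota> (inverse a * a) * v^2" by (simp add: q\<^sub>a_def conic hom_mult)
  then show ?thesis using a_nz by simp
qed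

lemma pderiv_qa: "pderiv q\<^sub>a = [:d / a:]"
proof -
  have "pderiv q = [:d:]" by (simp add: q_def pderiv_pCons char2_K char2_KX)
  then have "pderiv q\<^sub>a = [:inverse a * d:]" by (simp add: q\<^sub>a_def pderiv_smult)
  moreover have "inverse a * d = d / a" by (simp only: divide_inverse mult.commute)
  ultimately show ?thesis by (simp only:)
qed

lemma v_notin: "v \<notin> Kx x"
  using not_square_in_Kx[OF x_trans, of q\<^sub>a v] v2 d_nz a_nz by (auto simp: pderiv_qa)

lemma v2_in: "v^2 \<in> Kx x" by (simp add: v2 ev_in_Kx)

lemma subfield_F2: "is_subfield F\<^sub>2"
  by (rule is_subfield_adj[OF CHAR_F is_subfield_Kx v2_in])

lemmas F2_closed = is_subfieldD[OF subfield_F2]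

lemma Kx_subset_F2: "u \<in> Kx x \<Longrightarrow> u \<in> F\<^sub>2"
  using subset_adj[OF is_subfield_Kx] by blast

lemma v_in_F2: "v \<in> F\<^sub>2" by (rule generator_in_adj[OF is_subfield_Kx])

lemma square_F2_in_Kx: "u \<in> F\<^sub>2 \<Longrightarrow> u^2 \<in> Kx x"
  by (rule square_adj[OF CHAR_F is_subfield_Kx v2_in])

lemma w2: "w^2 = \<iota> b * v^2 + \<iota> b * v"
proof -
  have z2: "z^2 = v * T" using T_nz by (simp add: v_def)
  have "w^2 = v * (T * (v + 1)) * (v + 1)"
    by (simp only: w_def power_mult_distrib z2) (simp add: power2_eq_square ac_simps)
  also have "T * (v + 1) = \<iota> b" using T_nz by (simp add: v1)
  finally show ?thesis by (simp add: algebra_simps power2_eq_square)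
qed

lemma w2_in: "w^2 \<in> F\<^sub>2"
  unfolding w2 by (intro F2_closed(5-6) v_in_F2 Kx_subset_F2 const_in_Kx v2_in)

lemma w_notin: "w \<notin> F\<^sub>2"
proof
  assume "w \<in> F\<^sub>2"
  then have "w^2 \<in> Kx x" by (rule square_F2_in_Kx)
  then have "w^2 / \<iota> b - v^2 \<in> Kx x" by (intro Kx_closed(3-8) const_in_Kx v2_in)
  moreover have "w^2 / \<iota> b - v^2 = v" using b_nz by (simp add: w2 add_divide_distrib)
  ultimately show False using v_notin by simp
qed

lemma subfield_F1: "is_subfield F\<^sub>1"
  by (rule is_subfield_adj[OF CHAR_F subfield_F2 w2_in])

lemmas F1_closed = is_subfieldD[OF subfield_F1]

lemma F2_subset_F1: "u \<in> F\<^sub>2 \<Longrightarrow> u \<in> F\<^sub>1"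
  using subset_adj[OF subfield_F2] by blast

lemma square_F1_in_F2: "u \<in> F\<^sub>1 \<Longrightarrow> u^2 \<in> F\<^sub>2"
  by (rule square_adj[OF CHAR_F subfield_F2 w2_in])

lemma Y2: "Y^2 = (v + 1) * (w + \<iota> b * x)"
proof -
  have y2: "y^2 = x * T + z" unfolding xT by (simp add: char2_F)
  have "Y^2 = (v + 1) * (x * (T * (v + 1)) + z * (v + 1))"
    by (simp only: Y_def power_mult_distrib y2) (simp add: algebra_simps power2_eq_square)
  also have "T * (v + 1) = \<iota> b" using T_nz by (simp add: v1)
  finally show ?thesis by (simp add: w_def algebra_simps)
qed

lemma Y2_in: "Y^2 \<in> F\<^sub>1"
  unfolding Y2
  by (intro F1_closed(5-6) generator_in_adj subfield_F2 F2_subset_F1 F2_closed(1,5) v_in_F2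
      Kx_subset_F2 const_in_Kx gen_in_Kx)

lemma F_eq: "adj F\<^sub>1 Y = UNIV"
proof -
  have S: "is_subfield (adj F\<^sub>1 Y)" by (rule is_subfield_adj[OF CHAR_F subfield_F1 Y2_in])
  note D = is_subfieldD[OF S]
  have sub: "u \<in> adj F\<^sub>1 Y" if "u \<in> F\<^sub>1" for u using subset_adj[OF subfield_F1] that by blast
  have "v + 1 \<in> adj F\<^sub>1 Y" by (intro sub F2_subset_F1 F2_closed(1,5) v_in_F2)
  moreover have "w \<in> adj F\<^sub>1 Y" by (intro sub generator_in_adj subfield_F2)
  moreover have "Y \<in> adj F\<^sub>1 Y" by (rule generator_in_adj[OF subfield_F1])
  ultimately have "w / (v + 1) \<in> adj F\<^sub>1 Y" "Y / (v + 1) \<in> adj F\<^sub>1 Y" by (auto intro: D)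
  then have "{z, y} \<subseteq> adj F\<^sub>1 Y" using v1_nz by (simp add: w_def Y_def)
  moreover have "range \<iota> \<subseteq> adj F\<^sub>1 Y" by (auto intro!: sub F2_subset_F1 Kx_subset_F2)
  ultimately show ?thesis using field_span_subset[OF S, of "range \<iota> \<union> {z, y}"] span by auto
qed

lemma square_in_F1: "u^2 \<in> F\<^sub>1"
  by (rule square_adj[OF CHAR_F subfield_F1 Y2_in]) (simp add: F_eq)

text \<open>
  Since \<open>d' \<noteq> 0\<close>, the conic expresses \<open>X\<close> through \<open>X\<^sup>2\<close> and \<open>(Z\<^sup>2 / (Z\<^sup>2 + b'))\<^sup>2\<close>. So \<open>X\<close> goes down one field of
  the tower each time its arguments do: into \<open>F\<^sub>1\<close> as all squares lie there, into \<open>F\<^sub>2\<close> once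
  \<open>X, Z \<in> F\<^sub>1\<close> is known, and finally into \<open>K(x)\<close>.
\<close>
lemma frobenius_images:
  assumes T': "Z^2 + \<iota> b' \<noteq> 0" and V: "V^2 + Z = X * (Z^2 + \<iota> b')"
    and X: "X^2 + \<iota> d' * X + \<iota> c' = \<iota> a' * (Z^2 / (Z^2 + \<iota> b'))^2" and d': "d' \<noteq> 0"
  shows "X \<in> Kx x" "Z \<in> F\<^sub>1" "Z^2 / (Z^2 + \<iota> b') \<in> F\<^sub>2"
proof -
  define v' where "v' = Z^2 / (Z^2 + \<iota> b')"
  have X: "(X^2 + \<iota> c' + \<iota> a' * v'^2) / \<iota> d' = X"
  proof -
    have "X^2 + \<iota> c' + \<iota> a' * v'^2 = \<iota> d' * X"
      unfolding v'_def X[symmetric] by (simp add: algebra_simps char2_F)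
    then show ?thesis using d' by simp
  qed
  have Z: "V^2 + X * (Z^2 + \<iota> b') = Z"
    unfolding V[symmetric] by (simp add: char2_F)
  have const1: "\<iota> k \<in> F\<^sub>1" for k by (intro F2_subset_F1 Kx_subset_F2 const_in_Kx)
  have const2: "\<iota> k \<in> F\<^sub>2" for k by (intro Kx_subset_F2 const_in_Kx)
  have "(X^2 + \<iota> c' + \<iota> a' * v'^2) / \<iota> d' \<in> F\<^sub>1"
    by (intro F1_closed(3-8) square_in_F1 const1)
  then have X1: "X \<in> F\<^sub>1" by (simp only: X)
  have "V^2 + X * (Z^2 + \<iota> b') \<in> F\<^sub>1"
    by (intro F1_closed(3-8) square_in_F1 const1 X1)
  then show Z1: "Z \<in> F\<^sub>1" by (simp only: Z)
  show "Z^2 / (Z^2 + \<iota> b') \<in> F\<^sub>2" by (intro F2_closed(3-8) square_F1_in_F2 const2 Z1)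
  then have v': "v' \<in> F\<^sub>2" by (simp only: v'_def)
  have "(X^2 + \<iota> c' + \<iota> a' * v'^2) / \<iota> d' \<in> F\<^sub>2"
    by (intro F2_closed(3-8) F2_closed(9)[OF v'] square_F1_in_F2 const2 X1)
  then have X2: "X \<in> F\<^sub>2" by (simp only: X)
  have "(X^2 + \<iota> c' + \<iota> a' * v'^2) / \<iota> d' \<in> Kx x"
    by (intro Kx_closed(3-8) square_F2_in_Kx const_in_Kx X2 v')
  then show "X \<in> Kx x" by (simp only: X)
qed

text \<open>
  By differentiation \<open>B\<^sup>2\<close> is a constant, as \<open>h\<close> is quadratic and \<open>q\<^sub>a\<close> has a constant derivative. Then \<open>A\<^sup>2\<close> is a
  polynomial of degree at most 2, and comparing coefficients gives the three relations.
\<close>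
lemma square_combination:
  assumes "A \<in> Kx x" "B \<in> Kx x" "A^2 + B^2 * v^2 = \<iota> h\<^sub>0 + \<iota> h\<^sub>1 * x + \<iota> h\<^sub>2 * x^2"
  obtains u\<^sub>0 u\<^sub>1 k where "A = \<iota> u\<^sub>0 + \<iota> u\<^sub>1 * x" "B = \<iota> k"
    "a * u\<^sub>1^2 + k^2 = a * h\<^sub>2" "a * u\<^sub>0^2 + k^2 * c = a * h\<^sub>0" "k^2 * d = a * h\<^sub>1"
proof -
  have "A^2 + B^2 * ev x q\<^sub>a = ev x [:h\<^sub>0, h\<^sub>1, h\<^sub>2:]"
    using assms(3) unfolding v2 by (simp add: algebra_simps power2_eq_square)
  moreover have "d / a \<noteq> 0" using d_nz a_nz by simp
  ultimately obtain s t where st: "A = ev x t" "B = ev x s" "t^2 + s^2 * q\<^sub>a = [:h\<^sub>0, h\<^sub>1, h\<^sub>2:]"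
      "Polynomial.smult (d / a) (s^2) = pderiv [:h\<^sub>0, h\<^sub>1, h\<^sub>2:]"
    using square_combination_polynomials[OF x_trans assms(1,2) _ pderiv_qa] by metis
  have "Polynomial.smult (d / a) (s^2) = [:h\<^sub>1:]"
    unfolding st(4) by (simp add: pderiv_pCons char2_K char2_KX)
  then have "degree (Polynomial.smult (d / a) (s^2)) = 0" by simp
  then have "degree (s^2) \<le> 2 * 0" using d_nz a_nz by simp
  then obtain k where k: "s = [:k:]" using degree_square_le[of s 0] by (auto elim: degree_eq_zeroE)
  have t2: "t^2 + Polynomial.smult (k^2) q\<^sub>a = [:h\<^sub>0, h\<^sub>1, h\<^sub>2:]"
    using st(3) by (simp add: k power2_eq_square)
  then have "t^2 = [:h\<^sub>0, h\<^sub>1, h\<^sub>2:] + Polynomial.smult (k^2) q\<^sub>a"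
    by (rule char2_add_eq_iff[OF CHAR_KX, THEN iffD1])
  then have "degree (t^2) \<le> 2 * 1" by (simp add: q\<^sub>a_def q_def)
  then obtain u\<^sub>0 u\<^sub>1 where u: "t = [:u\<^sub>0, u\<^sub>1:]" using degree_square_le poly_degree_le_1 by blast
  have "[:u\<^sub>0^2 + k^2 * (inverse a * c), k^2 * (inverse a * d), u\<^sub>1^2 + k^2 * inverse a:] = [:h\<^sub>0, h\<^sub>1, h\<^sub>2:]"
    using t2 by (simp add: u char2_square_pCons[OF CHAR_K] q\<^sub>a_def q_def)
  then have "u\<^sub>0^2 + k^2 * (inverse a * c) = h\<^sub>0" "k^2 * (inverse a * d) = h\<^sub>1" "u\<^sub>1^2 + k^2 * inverse a = h\<^sub>2"
    by (auto simp only: pCons_eq_iff)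
  then have "a * u\<^sub>1^2 + k^2 = a * h\<^sub>2" "a * u\<^sub>0^2 + k^2 * c = a * h\<^sub>0" "k^2 * d = a * h\<^sub>1"
    using a_nz by (auto simp: field_simps)
  moreover have "A = \<iota> u\<^sub>0 + \<iota> u\<^sub>1 * x" "B = \<iota> k" by (simp_all add: st k u mult.commute)
  ultimately show ?thesis using that by blast
qed

text \<open>
  In \<open>A = U + W v\<close> the coefficient of \<open>x\<^sup>2\<close> in \<open>A\<^sup>2\<close> vanishes, which gives \<open>k\<^sup>2 + u\<^sub>1\<^sup>2 a = 0\<close> for the constant
  \<open>W = k\<close> and the coefficient \<open>u\<^sub>1\<close> of \<open>x\<close> in \<open>U\<close>; as \<open>a\<close> is not a square, both are \<open>0\<close>.
\<close>
lemma square_linear: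
  assumes "A \<in> F\<^sub>2" "A^2 = \<iota> h\<^sub>0 + \<iota> h\<^sub>1 * x"
  obtains u where "A = \<iota> u" "u^2 = h\<^sub>0" "h\<^sub>1 = 0"
proof -
  obtain U W where UW: "A = U + W * v" "U \<in> Kx x" "W \<in> Kx x" using assms(1) by (rule adjE)
  have "U^2 + W^2 * v^2 = \<iota> h\<^sub>0 + \<iota> h\<^sub>1 * x + \<iota> 0 * x^2"
    using assms(2) by (simp add: UW(1) sq_F power_mult_distrib)
  from square_combination[OF UW(2,3) this] obtain u\<^sub>0 u\<^sub>1 k where
    *: "U = \<iota> u\<^sub>0 + \<iota> u\<^sub>1 * x" "W = \<iota> k" "a * u\<^sub>1^2 + k^2 = a * 0"
    "a * u\<^sub>0^2 + k^2 * c = a * h\<^sub>0" "k^2 * d = a * h\<^sub>1" .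
  have "k^2 + u\<^sub>1^2 * a = 0" using *(3) by (simp add: ac_simps)
  then have "k = 0 \<and> u\<^sub>1 = 0" by (rule not_square_ratio[OF a_not_square])
  then show ?thesis using that * UW(1) a_nz by simp
qed

lemma square_conic:
  assumes "A \<in> F\<^sub>2" "A^2 = \<iota> h\<^sub>0 + \<iota> h\<^sub>2 * v^2"
  obtains u k where "A = \<iota> u + \<iota> k * v" "u^2 = h\<^sub>0" "k^2 = h\<^sub>2"
proof -
  obtain U W where UW: "A = U + W * v" "U \<in> Kx x" "W \<in> Kx x" using assms(1) by (rule adjE)
  have "U^2 + W^2 * v^2 = \<iota> (h\<^sub>0 + h\<^sub>2 * inverse a * c) + \<iota> (h\<^sub>2 * inverse a * d) * x + \<iota> (h\<^sub>2 * inverse a) * x^2"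
  proof -
    have "U^2 + W^2 * v^2 = \<iota> h\<^sub>0 + \<iota> h\<^sub>2 * ev x q\<^sub>a"
      using assms(2) by (simp add: UW(1) sq_F power_mult_distrib flip: v2)
    then show ?thesis by (simp add: q\<^sub>a_def q_def hom_add hom_mult algebra_simps power2_eq_square)
  qed
  from square_combination[OF UW(2,3) this] obtain u\<^sub>0 u\<^sub>1 k where
    *: "U = \<iota> u\<^sub>0 + \<iota> u\<^sub>1 * x" "W = \<iota> k" "a * u\<^sub>1^2 + k^2 = a * (h\<^sub>2 * inverse a)"
    "a * u\<^sub>0^2 + k^2 * c = a * (h\<^sub>0 + h\<^sub>2 * inverse a * c)" "k^2 * d = a * (h\<^sub>2 * inverse a * d)" .
  have ia: "a * (h\<^sub>2 * inverse a) = h\<^sub>2" using a_nz by simp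
  have "k^2 * d = h\<^sub>2 * d" using *(5) ia by (metis mult.assoc)
  then have k: "k^2 = h\<^sub>2" using d_nz by simp
  have "a * u\<^sub>1^2 + h\<^sub>2 = h\<^sub>2" using *(3) unfolding ia k .
  then have "u\<^sub>1 = 0" using a_nz by simp
  moreover have "a * u\<^sub>0^2 + h\<^sub>2 * c = a * h\<^sub>0 + h\<^sub>2 * c"
    using *(4) unfolding k by (simp only: distrib_left mult.assoc[symmetric] ia[unfolded mult.assoc[symmetric]])
  then have "u\<^sub>0^2 = h\<^sub>0" using a_nz by simp
  ultimately show ?thesis using that[of u\<^sub>0 k] * UW(1) k by simp
qed

end

locale two_pairs_c = pair_c \<iota> z y a b c d + P': pair_c \<iota> Z V a' b' c' d'
  for \<iota> :: "'k::field \<Rightarrow> 'f::field" and z y a b c d Z V a' b' c' d'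
begin

abbreviation "X \<equiv> P'.x"
abbreviation "v' \<equiv> P'.v"
abbreviation "w' \<equiv> P'.w"

lemma conic': "\<iota> a' * v'^2 = X^2 + \<iota> d' * X + \<iota> c'"
  unfolding P'.conic[symmetric] by (simp add: P'.q_def algebra_simps power2_eq_square)

lemma X_in_Kx: "X \<in> Kx x" and Z_in_F1: "Z \<in> F\<^sub>1" and v'_in_F2: "v' \<in> F\<^sub>2"
proof -
  have *: "Z^2 + \<iota> b' \<noteq> 0" using P'.T_nz unfolding P'.T_def .
  have "V^2 + Z = X * (Z^2 + \<iota> b')" unfolding P'.T_def[symmetric] P'.xT ..
  moreover have "X^2 + \<iota> d' * X + \<iota> c' = \<iota> a' * (Z^2 / (Z^2 + \<iota> b'))^2"
    unfolding P'.T_def[symmetric] P'.v_def[symmetric] conic' ..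
  ultimately show "X \<in> Kx x" "Z \<in> F\<^sub>1" "v' \<in> F\<^sub>2"
    using frobenius_images[OF * _ _ P'.d_nz] unfolding P'.v_def P'.T_def by blast+
qed

lemma w'_in_F1: "w' \<in> F\<^sub>1"
  unfolding P'.w_def by (intro F1_closed(1,5,6) Z_in_F1 F2_subset_F1[OF v'_in_F2])

text \<open>
  With \<open>X = n / l\<close>, expand \<open>v' l = A + B v\<close> and \<open>w' l = M + N w\<close>. Here \<open>B\<close> is a nonzero constant, and
  comparing the coefficients of \<open>v\<close> in the square of the second expansion gives \<open>N\<^sup>2 b = b' B l\<close>. So \<open>l\<close> is, up to
  a constant, a square in \<open>F\<^sub>2\<close>, and \<open>square_linear\<close> shows that it is a constant.
\<close>
lemma affine:
  obtains \<alpha> \<beta> where "X = \<iota> \<alpha> * x + \<iota> \<beta>" "\<alpha> \<noteq> 0"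
proof -
  interpret R: two_pairs_c \<iota> Z V a' b' c' d' z y a b c d ..
  obtain \<alpha> \<beta> \<gamma> \<delta> where m: "X = (\<iota> \<alpha> * x + \<iota> \<beta>) / (\<iota> \<gamma> * x + \<iota> \<delta>)"
      "\<alpha> * \<delta> - \<beta> * \<gamma> \<noteq> 0" "\<iota> \<gamma> * x + \<iota> \<delta> \<noteq> 0"
    using automorphism_is_moebius[OF x_trans X_in_Kx R.X_in_Kx] .
  define l where "l = \<iota> \<gamma> * x + \<iota> \<delta>"
  define n where "n = \<iota> \<alpha> * x + \<iota> \<beta>"
  have l: "l \<noteq> 0" "X * l = n" using m(1,3) by (simp_all add: l_def n_def)
  have l_mem: "l \<in> Kx x" unfolding l_def by (intro Kx_closed(5,6) const_in_Kx gen_in_Kx)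
  have "v' * l \<in> F\<^sub>2" by (intro F2_closed(6) v'_in_F2 Kx_subset_F2 l_mem)
  then obtain A B where AB: "v' * l = A + B * v" "A \<in> Kx x" "B \<in> Kx x" by (rule adjE)
  define i where "i = inverse a'"
  have v'2: "v'^2 = \<iota> i * (X^2 + \<iota> d' * X + \<iota> c')"
    unfolding conic'[symmetric] i_def hom_inverse using P'.a_nz by simp
  have "A^2 + B^2 * v^2 = (v' * l)^2" unfolding AB(1) by (simp add: power_mult_distrib sq_F)
  also have "\<dots> = \<iota> i * ((X * l)^2 + \<iota> d' * (X * l) * l + \<iota> c' * l^2)"
    by (simp add: power_mult_distrib v'2) (simp add: algebra_simps power2_eq_square)
  also have "\<dots> = \<iota> (i * (\<beta>^2 + d' * \<beta> * \<delta> + c' * \<delta>^2)) + \<iota> (i * (d' * (\<alpha> * \<delta> + \<beta> * \<gamma>))) * x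
      + \<iota> (i * (\<alpha>^2 + d' * \<alpha> * \<gamma> + c' * \<gamma>^2)) * x^2"
    unfolding l(2) by (simp add: n_def l_def sq_F power_mult_distrib hom_add hom_mult hom_power)
      (simp add: algebra_simps power2_eq_square)
  finally obtain t\<^sub>0 t\<^sub>1 \<kappa> where t: "A = \<iota> t\<^sub>0 + \<iota> t\<^sub>1 * x" "B = \<iota> \<kappa>"
      "\<kappa>^2 * d = a * (i * (d' * (\<alpha> * \<delta> + \<beta> * \<gamma>)))"
    by (rule square_combination[OF AB(2,3)])
  have \<kappa>: "\<kappa> \<noteq> 0"
    using t(3) a_nz P'.a_nz P'.d_nz m(2) by (auto simp: i_def char2_K)
  have "w' * l \<in> F\<^sub>1" by (intro F1_closed(6) w'_in_F1 F2_subset_F1 Kx_subset_F2 l_mem)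
  then obtain M N where MN: "w' * l = M + N * w" "M \<in> F\<^sub>2" "N \<in> F\<^sub>2" by (rule adjE)
  have "(M^2 + N^2 * \<iota> b * v^2) + (N^2 * \<iota> b) * v = (w' * l)^2"
    unfolding MN(1) by (simp add: power_mult_distrib sq_F w2 algebra_simps)
  also have "\<dots> = \<iota> b' * (v' * l)^2 + \<iota> b' * (v' * l) * l"
    by (simp add: power_mult_distrib P'.w2) (simp add: algebra_simps power2_eq_square)
  also have "\<dots> = (\<iota> b' * (A^2 + B^2 * v^2) + \<iota> b' * A * l) + (\<iota> b' * B * l) * v"
    unfolding AB(1) by (simp add: power_mult_distrib sq_F algebra_simps)
  finally have eq: "(M^2 + N^2 * \<iota> b * v^2) + (N^2 * \<iota> b) * v
      = (\<iota> b' * (A^2 + B^2 * v^2) + \<iota> b' * A * l) + (\<iota> b' * B * l) * v" .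
  have "M^2 + N^2 * \<iota> b * v^2 = \<iota> b' * (A^2 + B^2 * v^2) + \<iota> b' * A * l \<and> N^2 * \<iota> b = \<iota> b' * B * l"
    by (rule adj_eq_iff[OF is_subfield_Kx v_notin, THEN iffD1, rotated 4, OF eq])
      (intro Kx_closed(5-6) square_F2_in_Kx MN(2,3) v_in_F2 const_in_Kx AB(2,3) l_mem
        Kx_closed(9)[OF AB(2)] Kx_closed(9)[OF AB(3)])+
  then have "N^2 * \<iota> b = \<iota> b' * \<iota> \<kappa> * l" by (simp add: t(2))
  then have "N^2 = \<iota> (b' * \<kappa> * \<delta> / b) + \<iota> (b' * \<kappa> * \<gamma> / b) * x"
    using b_nz by (simp add: l_def hom_div hom_mult field_simps)
  with MN(3) have "b' * \<kappa> * \<gamma> / b = 0" by (rule square_linear)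
  then have "\<gamma> = 0" using P'.b_nz \<kappa> b_nz by simp
  moreover have "\<delta> \<noteq> 0" "\<alpha> \<noteq> 0" using m(2) \<open>\<gamma> = 0\<close> by auto
  ultimately show ?thesis
    using that[of "\<alpha> / \<delta>" "\<beta> / \<delta>"] m(1) by (simp add: hom_div add_divide_distrib)
qed

text \<open>
  Climbing the tower: \<open>v' = A + \<kappa> v\<close>, \<open>w' = M + \<upsilon> w\<close> and \<open>Y' = P + Q Y\<close>. In each step the squares are compared in
  the basis of the previous fields until \<open>square_linear\<close> or \<open>square_conic\<close> applies. The outcome is that
  \<open>A\<close> is a constant, \<open>Q = \<upsilon> L\<close> with \<open>L = \<mu>\<^sub>4 + \<mu>\<^sub>5 z\<close> and \<open>\<alpha> = \<mu>\<^sub>4\<^sup>2 + \<mu>\<^sub>5\<^sup>2 b\<close>, and \<open>v' + 1 = \<upsilon> L\<^sup>2 (v + 1)\<close>; the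
  assumptions of \<open>common_normal_form\<close> follow from these.
\<close>
lemma normal_form:
  obtains \<mu>\<^sub>2 \<mu>\<^sub>3 \<mu>\<^sub>4 \<mu>\<^sub>5 where "constants_c a b c d a' b' c' d' \<mu>\<^sub>2 \<mu>\<^sub>3 \<mu>\<^sub>4 \<mu>\<^sub>5"
    "(Z, V) = images_c \<iota> z y b \<mu>\<^sub>2 \<mu>\<^sub>3 \<mu>\<^sub>4 \<mu>\<^sub>5"
proof -
  obtain \<alpha> \<beta> where X: "X = \<iota> \<alpha> * x + \<iota> \<beta>" and \<alpha>: "\<alpha> \<noteq> 0" by (rule affine)
  define i where "i = inverse a'"
  have i: "a' * i = 1" using P'.a_nz by (simp add: i_def)

  \<comment> \<open>first step of the tower: \<open>v\<close>\<close>
  obtain A B where AB: "v' = A + B * v" "A \<in> Kx x" "B \<in> Kx x" using v'_in_F2 by (rule adjE)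
  have "\<iota> (a' * i) * v'^2 = \<iota> i * (X^2 + \<iota> d' * X + \<iota> c')"
    unfolding conic'[symmetric] by (simp add: hom_mult)
  then have "A^2 + B^2 * v^2 = \<iota> i * (X^2 + \<iota> d' * X + \<iota> c')"
    unfolding AB(1) i by (simp add: power_mult_distrib sq_F)
  also have "\<dots> = \<iota> (i * (\<beta>^2 + d' * \<beta> + c')) + \<iota> (i * (d' * \<alpha>)) * x + \<iota> (i * \<alpha>^2) * x^2"
    by (simp add: X sq_F power_mult_distrib hom_add hom_mult hom_power algebra_simps)
  finally obtain t\<^sub>0 t\<^sub>1 \<kappa> where t: "A = \<iota> t\<^sub>0 + \<iota> t\<^sub>1 * x" "B = \<iota> \<kappa>"
      "a * t\<^sub>1^2 + \<kappa>^2 = a * (i * \<alpha>^2)" "a * t\<^sub>0^2 + \<kappa>^2 * c = a * (i * (\<beta>^2 + d' * \<beta> + c'))"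
      "\<kappa>^2 * d = a * (i * (d' * \<alpha>))"
    by (rule square_combination[OF AB(2,3)])
  have \<kappa>: "\<kappa> \<noteq> 0" using t(5) a_nz i P'.d_nz \<alpha> by auto

  \<comment> \<open>second step of the tower: \<open>w\<close>\<close>
  obtain M N where MN: "w' = M + N * w" "M \<in> F\<^sub>2" "N \<in> F\<^sub>2" using w'_in_F1 by (rule adjE)
  have "(M^2 + N^2 * \<iota> b * v^2) + (N^2 * \<iota> b) * v = w'^2"
    unfolding MN(1) by (simp add: power_mult_distrib sq_F w2 algebra_simps)
  also have "\<dots> = (\<iota> b' * (A^2 + B^2 * v^2) + \<iota> b' * A) + (\<iota> b' * B) * v"
    unfolding P'.w2 AB(1) by (simp add: power_mult_distrib sq_F algebra_simps)
  finally have eq: "(M^2 + N^2 * \<iota> b * v^2) + (N^2 * \<iota> b) * v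
      = (\<iota> b' * (A^2 + B^2 * v^2) + \<iota> b' * A) + (\<iota> b' * B) * v" .
  have "M^2 + N^2 * \<iota> b * v^2 = \<iota> b' * (A^2 + B^2 * v^2) + \<iota> b' * A \<and> N^2 * \<iota> b = \<iota> b' * B"
    by (rule adj_eq_iff[OF is_subfield_Kx v_notin, THEN iffD1, rotated 4, OF eq])
      (intro Kx_closed(5-6) square_F2_in_Kx MN(2,3) v_in_F2 const_in_Kx AB(2,3)
        Kx_closed(9)[OF AB(2)] Kx_closed(9)[OF AB(3)])+
  note splitw = this[THEN conjunct1] this[THEN conjunct2]
  have "N^2 = \<iota> (b' * \<kappa> / b) + \<iota> 0 * x"
    using splitw(2) b_nz by (simp add: t(2) hom_div hom_mult field_simps)
  with MN(3) obtain \<upsilon> where \<upsilon>: "N = \<iota> \<upsilon>" "\<upsilon>^2 = b' * \<kappa> / b" by (rule square_linear)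
  have b\<upsilon>: "b * \<upsilon>^2 = b' * \<kappa>" using \<upsilon>(2) b_nz by simp
  have \<upsilon>_nz: "\<upsilon> \<noteq> 0" using b\<upsilon> P'.b_nz \<kappa> by auto

  \<comment> \<open>third step of the tower: \<open>Y\<close>\<close>
  obtain P Q where PQ: "P'.Y = P + Q * Y" "P \<in> F\<^sub>1" "Q \<in> F\<^sub>1"
    using F_eq by (metis UNIV_I adjE)
  obtain P\<^sub>0 P\<^sub>1 where P: "P = P\<^sub>0 + P\<^sub>1 * w" "P\<^sub>0 \<in> F\<^sub>2" "P\<^sub>1 \<in> F\<^sub>2" using PQ(2) by (rule adjE)
  obtain Q\<^sub>0 Q\<^sub>1 where Q: "Q = Q\<^sub>0 + Q\<^sub>1 * w" "Q\<^sub>0 \<in> F\<^sub>2" "Q\<^sub>1 \<in> F\<^sub>2" using PQ(3) by (rule adjE)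
  have "(v' + 1) * (M + \<iota> b' * X) + (\<iota> \<upsilon> * (v' + 1)) * w = P'.Y^2"
    unfolding P'.Y2 MN(1) \<upsilon>(1) by (simp add: algebra_simps)
  also have "\<dots> = (P\<^sub>0^2 + P\<^sub>1^2 * w^2 + (Q\<^sub>0^2 + Q\<^sub>1^2 * w^2) * (v + 1) * (\<iota> b * x))
      + ((Q\<^sub>0^2 + Q\<^sub>1^2 * w^2) * (v + 1)) * w"
    by (simp only: PQ(1) P(1) Q(1) sq_F power_mult_distrib Y2) (simp add: algebra_simps)
  finally have eq: "(v' + 1) * (M + \<iota> b' * X) + (\<iota> \<upsilon> * (v' + 1)) * w = \<dots>" .
  have const2: "\<iota> k \<in> F\<^sub>2" for k by (intro Kx_subset_F2 const_in_Kx)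
  have "(v' + 1) * (M + \<iota> b' * X) = P\<^sub>0^2 + P\<^sub>1^2 * w^2 + (Q\<^sub>0^2 + Q\<^sub>1^2 * w^2) * (v + 1) * (\<iota> b * x)
    \<and> \<iota> \<upsilon> * (v' + 1) = (Q\<^sub>0^2 + Q\<^sub>1^2 * w^2) * (v + 1)"
    by (rule adj_eq_iff[OF subfield_F2 w_notin, THEN iffD1, rotated 4, OF eq])
      (intro F2_closed(5-6) F2_closed(1) v'_in_F2 v_in_F2 MN(2) const2 w2_in
        F2_closed(9)[OF P(2)] F2_closed(9)[OF P(3)] F2_closed(9)[OF Q(2)] F2_closed(9)[OF Q(3)]
        Kx_subset_F2[OF X_in_Kx] Kx_subset_F2[OF gen_in_Kx])+
  then have splitY: "(v' + 1) * (M + \<iota> b' * X) = P\<^sub>0^2 + P\<^sub>1^2 * w^2 + \<iota> \<upsilon> * (v' + 1) * (\<iota> b * x)"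
      "\<iota> \<upsilon> * (v' + 1) = (Q\<^sub>0^2 + Q\<^sub>1^2 * w^2) * (v + 1)"
    by (metis, blast)
  have v': "v' + 1 = (A + 1) + \<iota> \<kappa> * v" by (simp add: AB(1) t(2) algebra_simps)
  have sq_mem: "P\<^sub>0^2 \<in> Kx x" "P\<^sub>1^2 \<in> Kx x" "Q\<^sub>0^2 \<in> Kx x" "Q\<^sub>1^2 \<in> Kx x"
    by (intro square_F2_in_Kx P Q)+
  \<comment> \<open>the coefficients of \<open>Q\<close>: the absence of \<open>x\<close> in \<open>Q\<^sub>0\<^sup>2\<close> makes \<open>A\<close> constant\<close>
  have eq: "\<iota> \<upsilon> * (A + 1) + (\<iota> \<upsilon> * \<iota> \<kappa>) * v
      = Q\<^sub>0^2 + (Q\<^sub>0^2 + Q\<^sub>1^2 * \<iota> b * (v^2 + 1)) * v"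
  proof -
    have "\<iota> \<upsilon> * (A + 1) + (\<iota> \<upsilon> * \<iota> \<kappa>) * v = (Q\<^sub>0^2 + Q\<^sub>1^2 * w^2) * (v + 1)"
      unfolding splitY(2)[symmetric] v' by (simp add: algebra_simps)
    also have "\<dots> = Q\<^sub>0^2 + (Q\<^sub>0^2 + Q\<^sub>1^2 * \<iota> b * (v^2 + 1)) * v"
      unfolding w2 by (simp add: algebra_simps char2_F power2_eq_square)
    finally show ?thesis .
  qed
  have "\<iota> \<upsilon> * (A + 1) = Q\<^sub>0^2 \<and> \<iota> \<upsilon> * \<iota> \<kappa> = Q\<^sub>0^2 + Q\<^sub>1^2 * \<iota> b * (v^2 + 1)"
    by (rule adj_eq_iff[OF is_subfield_Kx v_notin, THEN iffD1, rotated 4, OF eq])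
      (intro Kx_closed(5-6) Kx_closed(1) sq_mem const_in_Kx AB(2) v2_in)+
  note splitQ = this[THEN conjunct1] this[THEN conjunct2]
  have "Q\<^sub>0^2 = \<iota> (\<upsilon> * (t\<^sub>0 + 1)) + \<iota> (\<upsilon> * t\<^sub>1) * x"
    unfolding splitQ(1)[symmetric] t(1) by (simp add: hom_mult hom_add algebra_simps)
  with Q(2) obtain m where m: "Q\<^sub>0 = \<iota> m" "m^2 = \<upsilon> * (t\<^sub>0 + 1)" "\<upsilon> * t\<^sub>1 = 0" by (rule square_linear)
  have t1: "t\<^sub>1 = 0" using m(3) \<upsilon>_nz by simp
  have A: "A = \<iota> t\<^sub>0" using t(1) t1 by simp
  have "\<iota> b * (Q\<^sub>1 * (v + 1))^2 = \<iota> \<upsilon> * \<iota> \<kappa> + Q\<^sub>0^2"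
    unfolding splitQ(2) by (simp add: power_mult_distrib sq_F algebra_simps char2_F)
  then have "(Q\<^sub>1 * (v + 1))^2 = \<iota> (\<upsilon> * (\<kappa> + t\<^sub>0 + 1) / b) + \<iota> 0 * x"
    using b_nz unfolding splitQ(1)[symmetric] A
    by (simp add: hom_div hom_mult hom_add field_simps)
  moreover have "Q\<^sub>1 * (v + 1) \<in> F\<^sub>2" by (intro F2_closed(1,5,6) Q v_in_F2)
  ultimately obtain n where n: "Q\<^sub>1 * (v + 1) = \<iota> n" "n^2 = \<upsilon> * (\<kappa> + t\<^sub>0 + 1) / b"
    using square_linear by blast
  have bn: "b * n^2 = \<upsilon> * (\<kappa> + t\<^sub>0 + 1)" using n(2) b_nz by simp
  have "M^2 = \<iota> (b' * (t\<^sub>0^2 + t\<^sub>0)) + \<iota> (b' * \<kappa>^2 + \<upsilon>^2 * b) * v^2"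
    using splitw(1) unfolding char2_add_eq_iff[OF CHAR_F] A t(2) \<upsilon>(1)
    by (simp add: hom_add hom_mult hom_power algebra_simps)
  with MN(2) obtain M\<^sub>0 M\<^sub>1 where M: "M = \<iota> M\<^sub>0 + \<iota> M\<^sub>1 * v" by (rule square_conic)

  \<comment> \<open>the coefficients of \<open>P\<close>: the absence of \<open>x\<close> in \<open>P\<^sub>1\<^sup>2\<close> gives \<open>\<eta> = 0\<close>\<close>
  define \<eta> where "\<eta> = b' * \<alpha> + \<upsilon> * b"
  have P_eq: "P\<^sub>0^2 + P\<^sub>1^2 * w^2 = (\<iota> (t\<^sub>0 + 1) + \<iota> \<kappa> * v) * (\<iota> (M\<^sub>0 + b' * \<beta>) + \<iota> \<eta> * x + \<iota> M\<^sub>1 * v)"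
  proof -
    have "P\<^sub>0^2 + P\<^sub>1^2 * w^2 = (v' + 1) * (M + \<iota> b' * X) + \<iota> \<upsilon> * (v' + 1) * (\<iota> b * x)"
      unfolding splitY(1) by (simp add: add.assoc char2_F)
    also have "\<dots> = (v' + 1) * (\<iota> (M\<^sub>0 + b' * \<beta>) + \<iota> \<eta> * x + \<iota> M\<^sub>1 * v)"
      by (simp add: M X \<eta>_def hom_add hom_mult algebra_simps)
    finally show ?thesis by (simp add: v' A hom_add)
  qed
  have eq: "(P\<^sub>0^2 + P\<^sub>1^2 * \<iota> b * v^2) + (P\<^sub>1^2 * \<iota> b) * v
      = (\<iota> (t\<^sub>0 + 1) * (\<iota> (M\<^sub>0 + b' * \<beta>) + \<iota> \<eta> * x) + \<iota> (\<kappa> * M\<^sub>1) * v^2)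
        + (\<iota> \<kappa> * (\<iota> (M\<^sub>0 + b' * \<beta>) + \<iota> \<eta> * x) + \<iota> (M\<^sub>1 * (t\<^sub>0 + 1))) * v"
    using P_eq unfolding w2 by (simp only: hom_mult) (simp add: algebra_simps power2_eq_square)
  have "P\<^sub>0^2 + P\<^sub>1^2 * \<iota> b * v^2 = \<iota> (t\<^sub>0 + 1) * (\<iota> (M\<^sub>0 + b' * \<beta>) + \<iota> \<eta> * x) + \<iota> (\<kappa> * M\<^sub>1) * v^2
    \<and> P\<^sub>1^2 * \<iota> b = \<iota> \<kappa> * (\<iota> (M\<^sub>0 + b' * \<beta>) + \<iota> \<eta> * x) + \<iota> (M\<^sub>1 * (t\<^sub>0 + 1))"
    by (rule adj_eq_iff[OF is_subfield_Kx v_notin, THEN iffD1, rotated 4, OF eq])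
      (intro Kx_closed(5-6) sq_mem const_in_Kx gen_in_Kx v2_in)+
  note splitP = this[THEN conjunct1] this[THEN conjunct2]
  have "P\<^sub>1^2 = \<iota> ((\<kappa> * (M\<^sub>0 + b' * \<beta>) + M\<^sub>1 * (t\<^sub>0 + 1)) / b) + \<iota> (\<kappa> * \<eta> / b) * x"
    using splitP(2) b_nz by (simp add: hom_div hom_mult hom_add field_simps)
  with P(3) obtain \<rho> where \<rho>: "P\<^sub>1 = \<iota> \<rho>" "\<kappa> * \<eta> / b = 0" by (rule square_linear)
  have \<eta>: "\<eta> = 0" using \<rho>(2) \<kappa> b_nz by simp
  have "P\<^sub>0^2 = \<iota> ((t\<^sub>0 + 1) * (M\<^sub>0 + b' * \<beta>)) + \<iota> (\<kappa> * M\<^sub>1 + \<rho>^2 * b) * v^2"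
    using splitP(1) unfolding char2_add_eq_iff[OF CHAR_F] \<rho>(1) \<eta>
    by (simp add: hom_mult hom_add hom_power algebra_simps)
  with P(2) obtain p\<^sub>0 p\<^sub>1 where P\<^sub>0: "P\<^sub>0 = \<iota> p\<^sub>0 + \<iota> p\<^sub>1 * v" by (rule square_conic)

  have b'\<alpha>: "b' * \<alpha> = \<upsilon> * b" using \<eta> unfolding \<eta>_def by (simp add: add_eq_0_iff char2_K)
  have "b' * \<kappa> = \<upsilon> * (\<upsilon> * b)" unfolding b\<upsilon>[symmetric] by (simp add: power2_eq_square)
  also have "\<dots> = b' * (\<upsilon> * \<alpha>)" unfolding b'\<alpha>[symmetric] by (simp only: ac_simps)
  finally have \<kappa>_eq: "\<kappa> = \<upsilon> * \<alpha>" using P'.b_nz by simp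
  have mn: "m^2 + b * n^2 = \<upsilon>^2 * \<alpha>"
    unfolding m(2) bn by (simp add: \<kappa>_eq algebra_simps power2_eq_square char2_K)
  define \<mu>\<^sub>4 where "\<mu>\<^sub>4 = m / \<upsilon>"
  define \<mu>\<^sub>5 where "\<mu>\<^sub>5 = n / \<upsilon>"
  have mn': "m = \<upsilon> * \<mu>\<^sub>4" "n = \<upsilon> * \<mu>\<^sub>5" using \<upsilon>_nz by (simp_all add: \<mu>\<^sub>4_def \<mu>\<^sub>5_def)
  have "\<upsilon>^2 * \<alpha> = \<upsilon>^2 * (\<mu>\<^sub>4^2 + \<mu>\<^sub>5^2 * b)"
    unfolding mn[symmetric] mn' by (simp add: power_mult_distrib algebra_simps)
  then have \<alpha>_eq: "\<alpha> = \<mu>\<^sub>4^2 + \<mu>\<^sub>5^2 * b" using \<upsilon>_nz by simp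
  define L where "L = \<iota> \<mu>\<^sub>4 + \<iota> \<mu>\<^sub>5 * z"
  have "\<mu>\<^sub>4 \<noteq> 0 \<or> \<mu>\<^sub>5 \<noteq> 0" using \<alpha> \<alpha>_eq by auto
  then have L_nz: "L \<noteq> 0" unfolding L_def by (rule linear_nonzero[OF z_trans])
  have Q1w: "Q\<^sub>1 * w = \<iota> n * z" unfolding n(1)[symmetric] by (simp add: w_def ac_simps)
  have QL: "Q = \<iota> \<upsilon> * L" unfolding Q(1) Q1w m(1) by (simp add: L_def mn' hom_mult algebra_simps)
  have "\<iota> \<upsilon> * (v' + 1) = Q^2 * (v + 1)"
    unfolding splitY(2) Q(1) by (simp add: sq_F power_mult_distrib)
  also have "\<dots> = \<iota> \<upsilon> * (\<iota> \<upsilon> * L^2 * (v + 1))" unfolding QL by (simp add: power_mult_distrib power2_eq_square)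
  finally have v'1: "v' + 1 = \<iota> \<upsilon> * L^2 * (v + 1)" using \<upsilon>_nz by simp

  have Kz: "v \<in> Kx z" "v + 1 \<in> Kx z" "L \<in> Kx z"
    unfolding v_def T_def L_def by (intro Kx_closed const_in_Kx gen_in_Kx)+
  have cancel: "u = p / (v + 1) + r" if "u * (v + 1) = p + r * (v + 1)" for u p r
  proof -
    have "(u - r) * (v + 1) = p" using that by (simp only: left_diff_distrib) simp
    then have "p / (v + 1) = u - r" using v1_nz by (metis nonzero_mult_div_cancel_right)
    then show ?thesis by simp
  qed
  have \<upsilon>L: "\<iota> \<upsilon> * L^2 \<noteq> 0" using \<upsilon>_nz L_nz by simp
  have "Z * (\<iota> \<upsilon> * L^2) * (v + 1) = M + \<iota> \<upsilon> * z * (v + 1)"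
    using MN(1) unfolding P'.w_def v'1 \<upsilon>(1) w_def by (simp add: ac_simps)
  then have "Z * (\<iota> \<upsilon> * L^2) = M / (v + 1) + \<iota> \<upsilon> * z"
    by (rule cancel)
  then have "Z = (M / (v + 1) + \<iota> \<upsilon> * z) / (\<iota> \<upsilon> * L^2)"
    by (rule nonzero_eq_divide_eq[OF \<upsilon>L, THEN iffD2])
  moreover have "\<dots> \<in> Kx z" unfolding M by (intro Kx_closed Kz const_in_Kx gen_in_Kx)
  ultimately have Z_mem: "Z \<in> Kx z" by simp
  have "V * (\<iota> \<upsilon> * L^2) * (v + 1) = P\<^sub>0 + (\<iota> \<rho> * z + \<iota> \<upsilon> * L * y) * (v + 1)"
    using PQ(1) unfolding P'.Y_def v'1 QL P(1) \<rho>(1) w_def Y_def by (simp add: algebra_simps)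
  then have "V * (\<iota> \<upsilon> * L^2) = P\<^sub>0 / (v + 1) + (\<iota> \<rho> * z + \<iota> \<upsilon> * L * y)"
    by (rule cancel)
  then have "V * (\<iota> \<upsilon> * L^2) = P\<^sub>0 / (v + 1) + \<iota> \<rho> * z + \<iota> \<upsilon> * L * y"
    by (simp only: add.assoc)
  then have "V = (P\<^sub>0 / (v + 1) + \<iota> \<rho> * z + \<iota> \<upsilon> * L * y) / (\<iota> \<upsilon> * L^2)"
    by (rule nonzero_eq_divide_eq[OF \<upsilon>L, THEN iffD2])
  then have "V + y / L = (P\<^sub>0 / (v + 1) + \<iota> \<rho> * z) / (\<iota> \<upsilon> * L^2)"
    using \<upsilon>_nz L_nz by (simp add: add_divide_distrib power2_eq_square add.assoc char2_F)
  moreover have "\<dots> \<in> Kx z" unfolding P\<^sub>0 by (intro Kx_closed Kz const_in_Kx gen_in_Kx)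
  ultimately have V_mem: "V + y / L \<in> Kx z" by simp
  have ZT: "Z^2 + \<iota> b' = T / (\<iota> \<alpha> * L^2)"
  proof -
    have "P'.T * (\<iota> \<upsilon> * L^2 * (v + 1)) = \<iota> b'" using P'.T_nz by (simp add: v'1[symmetric] P'.v1)
    then have "P'.T * (\<iota> \<upsilon> * L^2 * (\<iota> b / T)) = \<iota> b'" by (simp only: v1)
    then have "P'.T * L^2 * \<iota> (\<upsilon> * b) = \<iota> b' * T"
      using T_nz by (simp add: hom_mult field_simps)
    then have "\<iota> b' * (P'.T * L^2 * \<iota> \<alpha>) = \<iota> b' * T" unfolding b'\<alpha>[symmetric] by (simp add: hom_mult ac_simps)
    then have "P'.T * (\<iota> \<alpha> * L^2) = T" using P'.b_nz by (simp add: ac_simps)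
    then show ?thesis using \<alpha> L_nz by (simp add: nonzero_eq_divide_eq flip: P'.T_def)
  qed
  have VZ: "V^2 + Z = (y^2 + z + \<iota> (\<beta> / \<alpha>) * T) / L^2"
  proof -
    have "V^2 + Z = (\<iota> \<alpha> * x + \<iota> \<beta>) * (T / (\<iota> \<alpha> * L^2))"
      unfolding P'.xT[symmetric] ZT[folded P'.T_def] X ..
    also have "\<dots> = (x * T + \<iota> (\<beta> / \<alpha>) * T) / L^2"
      using \<alpha> L_nz by (simp add: hom_div field_simps)
    finally show ?thesis unfolding xT .
  qed
  obtain \<mu>\<^sub>2 \<mu>\<^sub>3 where nf:
    "Z = (\<iota> ((\<mu>\<^sub>2^2 + \<mu>\<^sub>3^2 * b) / \<alpha>) + (\<iota> \<mu>\<^sub>5 * \<iota> b + \<iota> \<mu>\<^sub>4 * z) / L) / \<iota> \<alpha>"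
    "V = (\<iota> \<mu>\<^sub>2 + (\<iota> \<mu>\<^sub>3 * (\<iota> \<mu>\<^sub>5 * \<iota> b + \<iota> \<mu>\<^sub>4 * z) + \<iota> \<alpha> * y) / L) / \<iota> \<alpha>"
    "\<alpha>^2 * b' = b + ((\<mu>\<^sub>2^2 + \<mu>\<^sub>3^2 * b) / \<alpha>)^2" "\<beta> = \<mu>\<^sub>3^2 + \<mu>\<^sub>4 * \<mu>\<^sub>5"
    using common_normal_form[OF z_trans \<alpha>_eq \<alpha> L_def T_def ZT VZ Z_mem V_mem] .

  have eps: "eps b \<mu>\<^sub>4 \<mu>\<^sub>5 = \<alpha>" by (simp add: eps_def \<alpha>_eq)
  have gam: "gam b \<mu>\<^sub>2 \<mu>\<^sub>3 \<mu>\<^sub>4 \<mu>\<^sub>5 = (\<mu>\<^sub>2^2 + \<mu>\<^sub>3^2 * b) / \<alpha>"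
    by (simp add: gam_def eps divide_inverse mult.commute)
  have "a' * \<upsilon>^2 = a"
  proof -
    have "\<alpha>^2 * (a' * \<upsilon>^2) = a' * (a * (i * \<alpha>^2))"
      using t(3) by (simp add: t1 \<kappa>_eq power_mult_distrib ac_simps)
    also have "\<dots> = (a' * i) * (\<alpha>^2 * a)" by (simp only: ac_simps)
    finally show ?thesis using \<alpha> by (simp add: i)
  qed
  then have a: "a = a' * \<upsilon>^2" by simp
  have d': "d' = \<alpha> * d"
  proof -
    have "a' * \<upsilon>^2 * \<alpha> * (\<alpha> * d) = a' * (\<kappa>^2 * d)" by (simp add: \<kappa>_eq power2_eq_square ac_simps)
    also have "\<dots> = a' * (a * (i * (d' * \<alpha>)))" by (simp only: t(5))
    also have "\<dots> = (a' * i) * (a * \<alpha> * d')" by (simp only: ac_simps)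
    also have "\<dots> = a' * \<upsilon>^2 * \<alpha> * d'" by (simp add: i a)
    finally show ?thesis using P'.a_nz \<upsilon>_nz \<alpha> by simp
  qed
  have c': "c' = a * \<mu>\<^sub>4^4 + a' + \<alpha>^2 * c + \<beta>^2 + \<alpha> * d * \<beta>"
  proof -
    have "\<upsilon> * t\<^sub>0 = \<upsilon> * (\<upsilon> * \<mu>\<^sub>4^2 + 1)"
      using m(2) unfolding mn' by (simp add: power2_eq_square algebra_simps char2_add_eq_iff[OF CHAR_K] char2_K)
    then have t0: "t\<^sub>0 = \<upsilon> * \<mu>\<^sub>4^2 + 1" using \<upsilon>_nz by simp
    have "\<upsilon>^2 * (\<beta>^2 + d' * \<beta> + c') = i * a * (\<beta>^2 + d' * \<beta> + c')"
      using i by (simp add: a mult.assoc[symmetric] mult.commute[of i])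
    also have "\<dots> = a * t\<^sub>0^2 + \<kappa>^2 * c" unfolding t(4) by (simp only: ac_simps)
    also have "\<dots> = \<upsilon>^2 * (a * \<mu>\<^sub>4^4 + a' + \<alpha>^2 * c)"
      by (simp add: t0 \<kappa>_eq sq_K power_mult_distrib a algebra_simps flip: power_mult)
    finally have "\<beta>^2 + d' * \<beta> + c' = a * \<mu>\<^sub>4^4 + a' + \<alpha>^2 * c" using \<upsilon>_nz by simp
    then have "c' = (a * \<mu>\<^sub>4^4 + a' + \<alpha>^2 * c) + \<beta>^2 + d' * \<beta>"
      by (metis char2_K(2) add.assoc add.commute)
    then show ?thesis by (simp add: d')
  qed
  show ?thesis
  proof (rule that[of \<mu>\<^sub>2 \<mu>\<^sub>3 \<mu>\<^sub>4 \<mu>\<^sub>5])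
    have bg: "b + (gam b \<mu>\<^sub>2 \<mu>\<^sub>3 \<mu>\<^sub>4 \<mu>\<^sub>5)^2 = \<alpha>^2 * b'" using nf(3) unfolding gam by (rule sym)
    have a': "a' = \<alpha>^2 * (a * b^2 / (\<alpha>^2 * b')^2)"
    proof -
      have "(\<alpha>^2 * b')^2 = \<alpha>^2 * (\<upsilon>^2 * b^2)"
      proof -
        have "(\<alpha>^2 * b')^2 = \<alpha>^2 * (b' * \<alpha>)^2" by (simp add: power2_eq_square)
        then show ?thesis unfolding b'\<alpha> power_mult_distrib .
      qed
      then show ?thesis using \<alpha> \<upsilon>_nz b_nz by (simp add: a)
    qed
    moreover have "c' = \<alpha>^2 * (c + a) + (\<mu>\<^sub>3^2 + \<mu>\<^sub>4 * \<mu>\<^sub>5)^2 + \<alpha> * d * (\<mu>\<^sub>3^2 + \<mu>\<^sub>4 * \<mu>\<^sub>5)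
        + a * b^2 * (\<mu>\<^sub>5^4 + \<alpha>^2 / (\<alpha>^2 * b')^2)"
    proof -
      have "\<alpha>^2 * a = a * \<mu>\<^sub>4^4 + a * b^2 * \<mu>\<^sub>5^4"
        by (simp add: \<alpha>_eq sq_K power_mult_distrib algebra_simps flip: power_mult)
      then have E1: "\<alpha>^2 * a + a * b^2 * \<mu>\<^sub>5^4 = a * \<mu>\<^sub>4^4" by (simp add: add.assoc char2_K)
      define R where "R = \<alpha>^2 / (\<alpha>^2 * b')^2"
      have E2: "a * b^2 * R = a'" using a' by (simp add: R_def)
      have "\<alpha>^2 * (c + a) + \<beta>^2 + \<alpha> * d * \<beta> + a * b^2 * (\<mu>\<^sub>5^4 + R)
          = (\<alpha>^2 * a + a * b^2 * \<mu>\<^sub>5^4) + a * b^2 * R + \<alpha>^2 * c + \<beta>^2 + \<alpha> * d * \<beta>"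
        by (simp add: algebra_simps)
      also have "\<dots> = c'" unfolding E1 E2 c' ..
      finally show ?thesis unfolding nf(4)[symmetric] R_def by (rule sym)
    qed
    ultimately show "constants_c a b c d a' b' c' d' \<mu>\<^sub>2 \<mu>\<^sub>3 \<mu>\<^sub>4 \<mu>\<^sub>5"
      unfolding constants_c_def eps Let_def bg
      using d' \<open>\<mu>\<^sub>4 \<noteq> 0 \<or> \<mu>\<^sub>5 \<noteq> 0\<close> by simp
    show "(Z, V) = images_c \<iota> z y b \<mu>\<^sub>2 \<mu>\<^sub>3 \<mu>\<^sub>4 \<mu>\<^sub>5"
      unfolding images_c_def eps gam Let_def L_def[symmetric] using nf(1,2) by simp
  qed
qed

end

section \<open>The substitution solves the second equation\<close>

context char2_ext
begin

text \<open>
  The determinant of \<open>(L, N)\<close> as linear polynomials in \<open>z\<close> is \<open>m\<^sup>2 + n\<^sup>2 e \<noteq> 0\<close>, so the fraction \<open>N / L\<close> can be solved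
  for \<open>z\<close>, after which \<open>V\<close> can be solved for \<open>y\<close>. For the transcendence, \<open>N / L\<close> is a linear polynomial in \<open>z\<close> or
  in \<open>1 / L\<close>.
\<close>
lemma linear_substitution_generates:
  assumes z: "transcendental_over \<iota> z" and span: "field_span (range \<iota> \<union> {z, y}) = UNIV"
    and L: "L = \<iota> m + \<iota> n * z" and N: "N = \<iota> n * \<iota> e + \<iota> m * z"
    and \<epsilon>: "m^2 + n^2 * e \<noteq> 0"
    and Z: "\<iota> \<rho> * Z = \<iota> \<gamma> + N / L" and \<rho>: "\<rho> \<noteq> 0"
    and V: "\<iota> \<rho>' * V = \<iota> k + (\<iota> k' * N + \<iota> \<kappa> * y) / L" and \<kappa>: "\<kappa> \<noteq> 0"
  shows "transcendental_over \<iota> Z" "field_span (range \<iota> \<union> {Z, V}) = UNIV"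
proof -
  have mn: "m \<noteq> 0 \<or> n \<noteq> 0" using \<epsilon> by auto
  then have L_nz: "L \<noteq> 0" unfolding L by (rule linear_nonzero[OF z])
  define \<epsilon> where "\<epsilon> = m^2 + n^2 * e"
  have \<epsilon>_nz: "\<epsilon> \<noteq> 0" using \<epsilon> by (simp add: \<epsilon>_def)
  have det: "\<iota> m * L + \<iota> n * N = \<iota> \<epsilon>"
    by (simp add: L N \<epsilon>_def hom_add hom_mult hom_power normF)
  have Z': "Z = \<iota> (inverse \<rho>) * (\<iota> \<gamma> + N / L)"
  proof -
    have "\<iota> (inverse \<rho>) * (\<iota> \<rho> * Z) = \<iota> (inverse \<rho> * \<rho>) * Z" by (simp add: hom_mult)
    then show ?thesis using \<rho> by (simp add: Z)
  qed
  show "transcendental_over \<iota> Z"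
  proof (cases "n = 0")
    case True
    then have m: "m \<noteq> 0" using mn by simp
    have "Z = ev z [:inverse \<rho> * \<gamma>, inverse \<rho>:]"
      unfolding Z' using True m by (simp add: L N hom_mult algebra_simps)
    then show ?thesis using \<rho> by (simp only:) (intro transcendental_polynomial z, simp)
  next
    case False
    have "N = (\<iota> m * L + \<iota> \<epsilon>) / \<iota> n"
      using False by (simp add: det[symmetric] char2_F)
    then have *: "N / L = \<iota> (m / n) + \<iota> (\<epsilon> / n) * inverse L"
      using L_nz False by (simp add: hom_div field_simps)
    have "Z = ev (inverse (ev z [:m, n:])) [:inverse \<rho> * (\<gamma> + m / n), inverse \<rho> * (\<epsilon> / n):]"
    proof -
      define p q r where "p = m / n" and "q = \<epsilon> / n" and "r = inverse \<rho>"
      show ?thesis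
        unfolding Z' * p_def[symmetric] q_def[symmetric] r_def[symmetric]
        by (simp add: L hom_mult hom_add algebra_simps)
    qed
    then show ?thesis using \<rho> False \<epsilon>_nz
      by (simp only:) (intro transcendental_polynomial transcendental_inverse z, simp_all)
  qed
  define S where "S = field_span (range \<iota> \<union> {Z, V})"
  have S: "is_subfield S" unfolding S_def by (rule is_subfield_field_span)
  note D = is_subfieldD[OF S]
  have const: "\<iota> k \<in> S" for k unfolding S_def by (rule field_span.incl) simp
  have ZV: "Z \<in> S" "V \<in> S" unfolding S_def by (simp_all add: field_span.incl)
  define U where "U = \<iota> \<rho> * Z - \<iota> \<gamma>"
  have U: "U = N / L" by (simp add: U_def Z)
  have U_S: "U \<in> S" unfolding U_def by (intro D const ZV)
  have "(\<iota> m + U * \<iota> n) * L = \<iota> \<epsilon>" unfolding U using L_nz by (simp add: det[symmetric] algebra_simps)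
  then have nz: "\<iota> m + U * \<iota> n \<noteq> 0" using \<epsilon>_nz by auto
  have "U * L = N" unfolding U using L_nz by simp
  then have "z * (\<iota> m + U * \<iota> n) = \<iota> n * \<iota> e + U * \<iota> m"
  proof -
    have "z * (\<iota> m + U * \<iota> n) = U * L + \<iota> m * z + U * \<iota> m"
      by (simp add: L algebra_simps char2_F)
    then show ?thesis unfolding \<open>U * L = N\<close> by (simp add: N algebra_simps char2_F)
  qed
  then have "z = (\<iota> n * \<iota> e + U * \<iota> m) / (\<iota> m + U * \<iota> n)"
    by (rule nonzero_eq_divide_eq[OF nz, THEN iffD2])
  moreover have "\<dots> \<in> S" by (intro D const U_S)
  ultimately have zS: "z \<in> S" by simp
  have LN: "L \<in> S" "N \<in> S" unfolding L N by (intro D const zS)+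
  have "(\<iota> \<rho>' * V - \<iota> k) * L - \<iota> k' * N = \<iota> \<kappa> * y" using L_nz by (simp add: V)
  then have "((\<iota> \<rho>' * V - \<iota> k) * L - \<iota> k' * N) / \<iota> \<kappa> = y" using \<kappa> by simp
  moreover have "((\<iota> \<rho>' * V - \<iota> k) * L - \<iota> k' * N) / \<iota> \<kappa> \<in> S" by (intro D const LN ZV)
  ultimately have yS: "y \<in> S" by simp
  have "range \<iota> \<union> {z, y} \<subseteq> S" using const zS yS by auto
  then show "field_span (range \<iota> \<union> {Z, V}) = UNIV"
    using field_span_subset[OF S, of "range \<iota> \<union> {z, y}"] span unfolding S_def by auto
qed

text \<open>
  \<open>N\<^sup>2 + e L\<^sup>2\<close> is the multiplicativity of the norm form of a square root of \<open>e\<close>. The last two equations say what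
  the substitution does to \<open>z\<^sup>2 + e\<close> and \<open>y\<^sup>2 + z\<close>, up to powers of \<open>E\<close>: the terms in \<open>\<gamma>\<close> are the correction
  by which the constants \<open>a'\<close> in type (a) and \<open>b'\<close> in type (c) differ from \<open>e\<close>.
\<close>
lemma substitution_squares:
  assumes L: "L = \<iota> m + \<iota> n * z" and N: "N = \<iota> n * \<iota> e + \<iota> m * z" and L_nz: "L \<noteq> 0"
    and E: "E = \<iota> (m^2 + n^2 * e)" and T: "T = z^2 + \<iota> e"
    and \<gamma>: "E * \<iota> \<gamma> = \<iota> (k^2 + k'^2 * e)"
  shows "N^2 + \<iota> e * L^2 = E * T" "N * L = \<iota> (m * n) * T + E * z"
    "L^2 = \<iota> n^2 * T + E"
    "L^2 * ((\<iota> \<gamma> + N / L)^2 + \<iota> e + \<iota> \<gamma>^2) = E * T"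
    "L^2 * ((\<iota> k + (\<iota> k' * N + E * y) / L)^2 + E * (\<iota> \<gamma> + N / L))
      = E * (E * (y^2 + z) + \<iota> (m * n + k'^2) * T)"
proof -
  show 1: "N^2 + \<iota> e * L^2 = E * T" and 2: "N * L = \<iota> (m * n) * T + E * z"
    and "L^2 = \<iota> n^2 * T + E"
    by (simp_all add: L N E T hom_add hom_mult hom_power normF)
  have "L^2 * ((\<iota> \<gamma> + N / L)^2 + \<iota> e + \<iota> \<gamma>^2) = N^2 + \<iota> e * L^2"
    using L_nz by (simp add: sq_F power_divide algebra_simps char2_F)
  then show "L^2 * ((\<iota> \<gamma> + N / L)^2 + \<iota> e + \<iota> \<gamma>^2) = E * T" by (simp only: 1)
  have "L^2 * ((\<iota> k + (\<iota> k' * N + E * y) / L)^2 + E * (\<iota> \<gamma> + N / L))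
      = \<iota> k^2 * L^2 + (\<iota> k' * N + E * y)^2 + (E * \<iota> \<gamma>) * L^2 + E * (N * L)"
  proof -
    define M where "M = \<iota> k' * N + E * y"
    show ?thesis unfolding M_def[symmetric] using L_nz
      by (simp add: sq_F power_divide distrib_left) (simp add: algebra_simps power2_eq_square)
  qed
  also have "\<dots> = \<iota> k'^2 * (N^2 + \<iota> e * L^2) + E^2 * y^2 + E * (N * L)"
    unfolding \<gamma> by (simp add: sq_F power_mult_distrib hom_add hom_mult hom_power algebra_simps char2_F)
  also have "\<dots> = E * (E * (y^2 + z) + \<iota> (m * n + k'^2) * T)"
    unfolding 1 2 by (simp only: hom_add hom_power) (simp add: algebra_simps power2_eq_square)
  finally show "L^2 * ((\<iota> k + (\<iota> k' * N + E * y) / L)^2 + E * (\<iota> \<gamma> + N / L))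
      = E * (E * (y^2 + z) + \<iota> (m * n + k'^2) * T)" .
qed

end

text \<open>
  \<open>A\<close> and \<open>B\<close> are the multiples of \<open>Z\<^sup>2 + a'\<close> and \<open>V\<^sup>2 + Z\<close> by the denominators, so that \<open>A = T\<close> and
  \<open>B = E t + \<eta> T\<close>. The new quartic is a quadratic form in these, up to the term with \<open>b'\<^sup>2 c'\<^sup>3\<close>, and becomes a
  multiple of the old one.
\<close>
lemma (in pair_a) converse:
  assumes const: "constants_a a b c d a' b' c' d' \<mu>\<^sub>2 \<mu>\<^sub>3 \<mu>\<^sub>4 \<mu>\<^sub>5"
    and im: "(Z, V) = images_a \<iota> z y a \<mu>\<^sub>2 \<mu>\<^sub>3 \<mu>\<^sub>4 \<mu>\<^sub>5"
  shows "transcendental_over \<iota> Z" "field_span (range \<iota> \<union> {Z, V}) = UNIV"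
    "quartic_a (\<iota> a') (\<iota> b') (\<iota> c') (\<iota> d') Z V = 0"
proof -
  define \<epsilon> where "\<epsilon> = eps a \<mu>\<^sub>4 \<mu>\<^sub>5"
  define \<gamma> where "\<gamma> = gam a \<mu>\<^sub>2 \<mu>\<^sub>3 \<mu>\<^sub>4 \<mu>\<^sub>5"
  have \<epsilon>: "\<epsilon> = \<mu>\<^sub>4^2 + \<mu>\<^sub>5^2 * a" by (simp add: \<epsilon>_def eps_def)
  have nz: "(\<mu>\<^sub>4, \<mu>\<^sub>5) \<noteq> (0, 0)" and a': "\<epsilon>^6 * a' = a + \<gamma>^2" and b': "\<epsilon>^3 * b' = b" and c': "c' = \<epsilon> * c"
    and d': "d' = \<epsilon> * (\<mu>\<^sub>4 * \<mu>\<^sub>5 + \<mu>\<^sub>3^2)^2 * b + \<epsilon>^2 * (\<mu>\<^sub>4 * \<mu>\<^sub>5 + \<mu>\<^sub>3^2)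
              + \<epsilon>^2 * (\<mu>\<^sub>5^2 * b^2 * c^3 + \<epsilon> * d)"
    using const unfolding constants_a_def Let_def \<epsilon>_def[symmetric] \<gamma>_def[symmetric] by blast+
  have \<epsilon>_nz: "\<epsilon> \<noteq> 0" using not_square_ratio[OF a_not_square, of \<mu>\<^sub>4 \<mu>\<^sub>5] nz \<epsilon> by auto
  have \<epsilon>\<gamma>: "\<epsilon> * \<gamma> = \<mu>\<^sub>2^2 + \<mu>\<^sub>3^2 * a" using \<epsilon>_nz by (simp add: \<gamma>_def gam_def \<epsilon>_def[symmetric])
  define E where "E = \<iota> \<epsilon>"
  have E_eq: "E = \<iota> (\<mu>\<^sub>4^2 + \<mu>\<^sub>5^2 * a)" by (simp only: E_def \<epsilon>)
  have E_nz: "E \<noteq> 0" using \<epsilon>_nz by (simp add: E_def)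
  define L where "L = \<iota> \<mu>\<^sub>4 + \<iota> \<mu>\<^sub>5 * z"
  define N where "N = \<iota> \<mu>\<^sub>5 * \<iota> a + \<iota> \<mu>\<^sub>4 * z"
  have L_nz: "L \<noteq> 0" unfolding L_def using nz by (intro linear_nonzero[OF z_trans]) auto
  have Z0: "E^3 * Z = \<iota> \<gamma> + N / L" and V0: "E^2 * V = \<iota> \<mu>\<^sub>2 + (\<iota> \<mu>\<^sub>3 * N + E * y) / L"
    using im E_nz
    by (simp_all add: images_a_def Let_def \<epsilon>_def[symmetric] \<gamma>_def[symmetric] E_def[symmetric] L_def N_def)
  show "transcendental_over \<iota> Z" "field_span (range \<iota> \<union> {Z, V}) = UNIV"
    using linear_substitution_generates[OF z_trans span L_def N_def, of "\<epsilon>^3" Z \<gamma> "\<epsilon>^2" V \<mu>\<^sub>2 \<mu>\<^sub>3 \<epsilon>]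
      Z0 V0 \<epsilon>_nz by (simp_all add: hom_power E_def \<epsilon>)
  define t where "t = y^2 + z"
  define \<eta> where "\<eta> = \<iota> (\<mu>\<^sub>4 * \<mu>\<^sub>5 + \<mu>\<^sub>3^2)"
  have "E * \<iota> \<gamma> = \<iota> (\<mu>\<^sub>2^2 + \<mu>\<^sub>3^2 * a)" unfolding E_def \<epsilon>\<gamma>[symmetric] by (simp add: hom_mult)
  note sq = substitution_squares(1-4)[OF L_def N_def L_nz E_eq T_def this,
      folded Z0 V0 t_def \<eta>_def]
    substitution_squares(5)[OF L_def N_def L_nz E_eq T_def this, where y = y,
      folded Z0 V0 t_def \<eta>_def]
  define A where "A = E^5 * L^2 * (Z^2 + \<iota> a')"
  define B where "B = E^3 * L^2 * (V^2 + Z)"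
  have Ea': "E^6 * \<iota> a' = \<iota> a + \<iota> \<gamma>^2" unfolding E_def using arg_cong[OF a', of \<iota>] by (simp add: hom_mult hom_add hom_power)
  have "E * A = L^2 * ((E^3 * Z)^2 + E^6 * \<iota> a')"
    by (simp add: A_def power_mult_distrib algebra_simps numeral_eq_Suc)
  also have "\<dots> = E * T" unfolding Ea' using sq(4) by (simp only: add.assoc)
  finally have A: "A = T" using E_nz by simp
  have "E * B = L^2 * ((E^2 * V)^2 + E * (E^3 * Z))"
    by (simp add: B_def power_mult_distrib algebra_simps numeral_eq_Suc)
  also have "\<dots> = E * (E * t + \<eta> * T)" by (rule sq(5))
  finally have B: "B = E * t + \<eta> * T" using E_nz by simp
  have Eb': "E^3 * \<iota> b' = \<iota> b" unfolding E_def using arg_cong[OF b', of \<iota>] by (simp add: hom_mult hom_power)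
  have Ee': "E^3 * (\<iota> b'^2 * \<iota> c'^3) = \<iota> e"
  proof -
    have "E^3 * (\<iota> b'^2 * \<iota> c'^3) = (E^3 * \<iota> b')^2 * \<iota> c^3"
      by (simp add: c' E_def hom_mult power_mult_distrib numeral_eq_Suc ac_simps)
    then show ?thesis by (simp add: Eb' e_def hom_mult hom_power)
  qed
  have Ed': "\<iota> d' = E * \<eta>^2 * \<iota> b + E^2 * \<eta> + E^2 * \<iota> \<mu>\<^sub>5^2 * \<iota> e + E^3 * \<iota> d"
    unfolding d' E_def \<eta>_def e_def
    by (simp only: hom_mult hom_add hom_power) (simp add: algebra_simps numeral_eq_Suc)
  have tq: "\<iota> b * t^2 + T * t + T * (\<iota> d * T + \<iota> e) = 0"
    using quartic unfolding quartic_a_char2[OF CHAR_F] t_def[symmetric] T_def[symmetric]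
    by (simp add: e_def hom_mult hom_power)
  have "E^10 * L^4 * quartic_a (\<iota> a') (\<iota> b') (\<iota> c') (\<iota> d') Z V
      = E * (E^3 * \<iota> b') * B^2 + E^2 * A * B + A * (\<iota> d' * A + E^2 * (E^3 * (\<iota> b'^2 * \<iota> c'^3)) * L^2)"
  proof -
    define S\<^sub>1 S\<^sub>2 where "S\<^sub>1 = Z^2 + \<iota> a'" and "S\<^sub>2 = V^2 + Z"
    show ?thesis unfolding quartic_a_char2[OF CHAR_F] A_def B_def S\<^sub>1_def[symmetric] S\<^sub>2_def[symmetric]
      by (simp add: algebra_simps numeral_eq_Suc)
  qed
  also have "\<dots> = E^3 * (\<iota> b * t^2 + T * t + T * (\<iota> d * T + \<iota> e))"
    unfolding A B Eb' Ee' Ed' sq(3) by (simp add: normF)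
  also have "\<dots> = 0" by (simp add: tq)
  finally show "quartic_a (\<iota> a') (\<iota> b') (\<iota> c') (\<iota> d') Z V = 0" using E_nz L_nz by simp
qed

text \<open>
  As in type (a), with \<open>A = T\<close> and \<open>B = E t + \<eta> T\<close>. The quartic now contains also \<open>a' Z\<^sup>4\<close>, and
  \<open>E L\<^sup>2 Z\<^sup>2 = T + E L\<^sup>2 b'\<close> takes it to a combination of \<open>T\<^sup>2\<close> and \<open>L\<^sup>4\<close>.
\<close>
lemma (in pair_c) converse:
  assumes const: "constants_c a b c d a' b' c' d' \<mu>\<^sub>2 \<mu>\<^sub>3 \<mu>\<^sub>4 \<mu>\<^sub>5"
    and im: "(Z, V) = images_c \<iota> z y b \<mu>\<^sub>2 \<mu>\<^sub>3 \<mu>\<^sub>4 \<mu>\<^sub>5" and b'_nz: "b' \<noteq> 0"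
  shows "transcendental_over \<iota> Z" "field_span (range \<iota> \<union> {Z, V}) = UNIV"
    "quartic_c (\<iota> a') (\<iota> b') (\<iota> c') (\<iota> d') Z V = 0"
proof -
  define \<epsilon> where "\<epsilon> = eps b \<mu>\<^sub>4 \<mu>\<^sub>5"
  define \<gamma> where "\<gamma> = gam b \<mu>\<^sub>2 \<mu>\<^sub>3 \<mu>\<^sub>4 \<mu>\<^sub>5"
  define \<eta>\<^sub>0 where "\<eta>\<^sub>0 = \<mu>\<^sub>4 * \<mu>\<^sub>5 + \<mu>\<^sub>3^2"
  have \<epsilon>: "\<epsilon> = \<mu>\<^sub>4^2 + \<mu>\<^sub>5^2 * b" by (simp add: \<epsilon>_def eps_def)
  have nz: "(\<mu>\<^sub>4, \<mu>\<^sub>5) \<noteq> (0, 0)" and a': "a' = \<epsilon>^2 * (a * b^2 / (b + \<gamma>^2)^2)"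
    and b': "\<epsilon>^2 * b' = b + \<gamma>^2" and d': "d' = \<epsilon> * d"
    and c': "c' = \<epsilon>^2 * (c + a) + \<eta>\<^sub>0^2 + \<epsilon> * d * \<eta>\<^sub>0 + a * b^2 * (\<mu>\<^sub>5^4 + \<epsilon>^2 / (b + \<gamma>^2)^2)"
    using const unfolding constants_c_def Let_def \<epsilon>_def[symmetric] \<gamma>_def[symmetric]
    by (auto simp: \<eta>\<^sub>0_def add.commute)
  have \<epsilon>_nz: "\<epsilon> \<noteq> 0" using not_square_ratio[OF b_not_square, of \<mu>\<^sub>4 \<mu>\<^sub>5] nz \<epsilon> by auto
  have \<epsilon>\<gamma>: "\<epsilon> * \<gamma> = \<mu>\<^sub>2^2 + \<mu>\<^sub>3^2 * b" using \<epsilon>_nz by (simp add: \<gamma>_def gam_def \<epsilon>_def[symmetric])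
  have a'b': "\<epsilon>^2 * a' * b'^2 = a * b^2"
    unfolding a' b'[symmetric] using \<epsilon>_nz b'_nz by (simp add: field_simps power2_eq_square)
  have c'': "c' = \<epsilon>^2 * (c + a) + \<eta>\<^sub>0^2 + \<epsilon> * d * \<eta>\<^sub>0 + a * b^2 * \<mu>\<^sub>5^4 + a'"
    unfolding c' a' by (simp add: distrib_left)
  define E where "E = \<iota> \<epsilon>"
  have E_eq: "E = \<iota> (\<mu>\<^sub>4^2 + \<mu>\<^sub>5^2 * b)" by (simp only: E_def \<epsilon>)
  have E_nz: "E \<noteq> 0" using \<epsilon>_nz by (simp add: E_def)
  define L where "L = \<iota> \<mu>\<^sub>4 + \<iota> \<mu>\<^sub>5 * z"
  define N where "N = \<iota> \<mu>\<^sub>5 * \<iota> b + \<iota> \<mu>\<^sub>4 * z"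
  have L_nz: "L \<noteq> 0" unfolding L_def using nz by (intro linear_nonzero[OF z_trans]) auto
  have Z0: "E * Z = \<iota> \<gamma> + N / L" and V0: "E * V = \<iota> \<mu>\<^sub>2 + (\<iota> \<mu>\<^sub>3 * N + E * y) / L"
    using im E_nz
    by (simp_all add: images_c_def Let_def \<epsilon>_def[symmetric] \<gamma>_def[symmetric] E_def[symmetric] L_def N_def)
  show "transcendental_over \<iota> Z" "field_span (range \<iota> \<union> {Z, V}) = UNIV"
    using linear_substitution_generates[OF z_trans span L_def N_def, of "\<epsilon>" Z \<gamma> "\<epsilon>" V \<mu>\<^sub>2 \<mu>\<^sub>3 \<epsilon>]
      Z0 V0 \<epsilon>_nz by (simp_all add: E_def \<epsilon>)
  define t where "t = y^2 + z"
  define \<eta> where "\<eta> = \<iota> \<eta>\<^sub>0"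
  have "E * \<iota> \<gamma> = \<iota> (\<mu>\<^sub>2^2 + \<mu>\<^sub>3^2 * b)" unfolding E_def \<epsilon>\<gamma>[symmetric] by (simp add: hom_mult)
  note sq = substitution_squares(1-4)[OF L_def N_def L_nz E_eq T_def this,
      folded Z0 V0 t_def \<eta>\<^sub>0_def \<eta>_def]
    substitution_squares(5)[OF L_def N_def L_nz E_eq T_def this, where y = y,
      folded Z0 V0 t_def \<eta>\<^sub>0_def \<eta>_def]
  define A where "A = E * L^2 * (Z^2 + \<iota> b')"
  define B where "B = E * L^2 * (V^2 + Z)"
  have Eb': "E^2 * \<iota> b' = \<iota> b + \<iota> \<gamma>^2" unfolding E_def using arg_cong[OF b', of \<iota>] by (simp add: hom_mult hom_add hom_power)
  have "E * A = L^2 * ((E * Z)^2 + E^2 * \<iota> b')"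
    by (simp add: A_def power_mult_distrib algebra_simps numeral_eq_Suc)
  also have "\<dots> = E * T" unfolding Eb' using sq(4) by (simp only: add.assoc)
  finally have A: "A = T" using E_nz by simp
  have "E * B = L^2 * ((E * V)^2 + E * (E * Z))"
    by (simp add: B_def power_mult_distrib algebra_simps numeral_eq_Suc)
  also have "\<dots> = E * (E * t + \<eta> * T)" by (rule sq(5))
  finally have B: "B = E * t + \<eta> * T" using E_nz by simp
  have Z2: "E * L^2 * Z^2 = T + E * L^2 * \<iota> b'"
    using A unfolding A_def distrib_left char2_add_eq_iff[OF CHAR_F] .
  have Ea': "E^2 * \<iota> a' * \<iota> b'^2 = \<iota> a * \<iota> b^2"
    unfolding E_def using arg_cong[OF a'b', of \<iota>] by (simp add: hom_mult hom_power)
  have Ec': "\<iota> c' = E^2 * (\<iota> c + \<iota> a) + \<eta>^2 + E * \<iota> d * \<eta> + \<iota> a * \<iota> b^2 * \<iota> \<mu>\<^sub>5^4 + \<iota> a'"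
    unfolding c'' by (simp add: E_def \<eta>_def hom_mult hom_add hom_power)
  have Ed': "\<iota> d' = E * \<iota> d" by (simp add: d' E_def hom_mult)
  have tq: "t^2 + \<iota> d * T * t + \<iota> c * T^2 + \<iota> a * (z^2)^2 = 0"
    using quartic unfolding quartic_c_char2[OF CHAR_F] t_def[symmetric] T_def[symmetric] .
  have z2: "z^2 = T + \<iota> b" by (simp add: T_def char2_F)
  have "E^2 * L^4 * quartic_c (\<iota> a') (\<iota> b') (\<iota> c') (\<iota> d') Z V
      = B^2 + \<iota> d' * A * B + \<iota> c' * A^2 + \<iota> a' * (E * L^2 * Z^2)^2"
  proof -
    define S\<^sub>1 S\<^sub>2 where "S\<^sub>1 = Z^2 + \<iota> b'" and "S\<^sub>2 = V^2 + Z"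
    show ?thesis unfolding quartic_c_char2[OF CHAR_F] A_def B_def S\<^sub>1_def[symmetric] S\<^sub>2_def[symmetric]
      by (simp add: algebra_simps numeral_eq_Suc)
  qed
  also have "\<iota> a' * (E * L^2 * Z^2)^2 = \<iota> a' * T^2 + (E^2 * \<iota> a' * \<iota> b'^2) * (L^2)^2"
    unfolding Z2 by (simp add: sq_F power_mult_distrib algebra_simps)
  also have "B^2 + \<iota> d' * A * B + \<iota> c' * A^2 + (\<iota> a' * T^2 + (E^2 * \<iota> a' * \<iota> b'^2) * (L^2)^2)
      = E^2 * (t^2 + \<iota> d * T * t + \<iota> c * T^2 + \<iota> a * (T + \<iota> b)^2)"
    unfolding A B Ea' Ec' Ed' sq(3) by (simp add: normF)
  also have "\<dots> = 0" using tq by (simp add: z2)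
  finally show "quartic_c (\<iota> a') (\<iota> b') (\<iota> c') (\<iota> d') Z V = 0" using E_nz L_nz by simp
qed

text \<open>
  Fourth powers are additive, so \<open>(E\<^sup>2 V L)\<^sup>4\<close> splits, and the equation of \<open>(z, y)\<close> replaces \<open>y\<^sup>4\<close>. What remains are
  three groups of terms, according to the factors \<open>\<mu>\<^sub>4 \<mu>\<^sub>5\<close>, \<open>c\<close> and \<open>a\<close>; each vanishes by a
  fourth-power identity between \<open>L\<close>, \<open>N\<close> and \<open>z\<close>.
\<close>
lemma (in pair_b) converse:
  assumes const: "constants_b a b c a' b' c' \<mu>\<^sub>1 \<mu>\<^sub>2 \<mu>\<^sub>4 \<mu>\<^sub>5"
    and im: "(Z, V) = images_b \<iota> z y b \<mu>\<^sub>1 \<mu>\<^sub>2 \<mu>\<^sub>4 \<mu>\<^sub>5"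
  shows "transcendental_over \<iota> Z" "field_span (range \<iota> \<union> {Z, V}) = UNIV"
    "quartic_b (\<iota> a') (\<iota> b') (\<iota> c') Z V = 0"
proof -
  define \<epsilon> where "\<epsilon> = eps b \<mu>\<^sub>4 \<mu>\<^sub>5"
  define \<gamma> where "\<gamma> = gam b \<mu>\<^sub>1 \<mu>\<^sub>2 \<mu>\<^sub>4 \<mu>\<^sub>5"
  have \<epsilon>: "\<epsilon> = \<mu>\<^sub>4^2 + \<mu>\<^sub>5^2 * b" by (simp add: \<epsilon>_def eps_def)
  have nz: "(\<mu>\<^sub>4, \<mu>\<^sub>5) \<noteq> (0, 0)"
    and a': "a' = \<epsilon>^2 * a + \<epsilon> * \<mu>\<^sub>4 * \<mu>\<^sub>5 + \<mu>\<^sub>2^4 + \<mu>\<^sub>5^4 * (c + a * b^2)"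
    and b': "\<epsilon>^4 * b' = b"
    and c': "\<epsilon>^6 * c' = c + \<gamma>^2 + (\<epsilon> * \<mu>\<^sub>4 * \<mu>\<^sub>5 + \<mu>\<^sub>2^4) * inverse (\<epsilon>^2) * b^2
                    + inverse (\<epsilon>^2) * \<mu>\<^sub>5^4 * (c + a * b^2) * b^2"
    using const unfolding constants_b_def Let_def \<epsilon>_def[symmetric] \<gamma>_def[symmetric] by blast+
  have \<epsilon>_nz: "\<epsilon> \<noteq> 0" using not_square_ratio[OF b_not_square, of \<mu>\<^sub>4 \<mu>\<^sub>5] nz \<epsilon> by auto
  have \<epsilon>\<gamma>: "\<epsilon> * \<gamma> = \<mu>\<^sub>1^2 + \<mu>\<^sub>2^2 * b" using \<epsilon>_nz by (simp add: \<gamma>_def gam_def \<epsilon>_def[symmetric])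
  have e2: "\<epsilon>^2 = \<mu>\<^sub>4^4 + \<mu>\<^sub>5^4 * b^2" by (simp add: \<epsilon> sq_K power_mult_distrib flip: power_mult)
  have c'': "\<epsilon>^8 * c' = \<mu>\<^sub>1^4 + \<epsilon> * \<mu>\<^sub>4 * \<mu>\<^sub>5 * b^2 + c * \<mu>\<^sub>4^4 + a * b^4 * \<mu>\<^sub>5^4"
  proof -
    define i where "i = inverse (\<epsilon>^2)"
    have i: "\<epsilon>^2 * i = 1" using \<epsilon>_nz by (simp add: i_def)
    have g: "(\<epsilon> * \<gamma>)^2 = \<mu>\<^sub>1^4 + \<mu>\<^sub>2^4 * b^2"
      unfolding \<epsilon>\<gamma> by (simp add: sq_K power_mult_distrib flip: power_mult)
    have "\<epsilon>^8 * c' = \<epsilon>^2 * (\<epsilon>^6 * c')" by (simp add: mult.assoc[symmetric] flip: power_add)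
    also have "\<dots> = \<epsilon>^2 * c + (\<epsilon> * \<gamma>)^2 + (\<epsilon>^2 * i) * ((\<epsilon> * \<mu>\<^sub>4 * \<mu>\<^sub>5 + \<mu>\<^sub>2^4) * b^2
        + \<mu>\<^sub>5^4 * (c + a * b^2) * b^2)"
      unfolding c' i_def[symmetric] by (simp only: power_mult_distrib) (simp only: algebra_simps)
    also have "\<dots> = \<mu>\<^sub>1^4 + \<epsilon> * \<mu>\<^sub>4 * \<mu>\<^sub>5 * b^2 + c * \<mu>\<^sub>4^4 + a * b^4 * \<mu>\<^sub>5^4"
      by (simp only: i mult_1_left g) (simp add: e2 algebra_simps char2_K flip: power_add)
    finally show ?thesis .
  qed
  define E where "E = \<iota> \<epsilon>"
  have E_eq: "E = \<iota> (\<mu>\<^sub>4^2 + \<mu>\<^sub>5^2 * b)" by (simp only: E_def \<epsilon>)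
  have E_nz: "E \<noteq> 0" using \<epsilon>_nz by (simp add: E_def)
  define L where "L = \<iota> \<mu>\<^sub>4 + \<iota> \<mu>\<^sub>5 * z"
  define N where "N = \<iota> \<mu>\<^sub>5 * \<iota> b + \<iota> \<mu>\<^sub>4 * z"
  have L_nz: "L \<noteq> 0" unfolding L_def using nz by (intro linear_nonzero[OF z_trans]) auto
  have Z0: "E^2 * Z = N / L" and V0: "E^2 * V = \<iota> \<mu>\<^sub>1 + (\<iota> \<mu>\<^sub>2 * N + E * y) / L"
    using im E_nz
    by (simp_all add: images_b_def Let_def \<epsilon>_def[symmetric] E_def[symmetric] L_def N_def)
  show "transcendental_over \<iota> Z" "field_span (range \<iota> \<union> {Z, V}) = UNIV"
    using linear_substitution_generates[OF z_trans span L_def N_def, of "\<epsilon>^2" Z 0 "\<epsilon>^2" V \<mu>\<^sub>1 \<mu>\<^sub>2 \<epsilon>]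
      Z0 V0 \<epsilon>_nz by (simp_all add: E_def \<epsilon> hom_power)
  define T where "T = z^2 + \<iota> b"
  have "E * \<iota> \<gamma> = \<iota> (\<mu>\<^sub>1^2 + \<mu>\<^sub>2^2 * b)" unfolding E_def \<epsilon>\<gamma>[symmetric] by (simp add: hom_mult)
  note sq = substitution_squares(1-4)[OF L_def N_def L_nz E_eq T_def this]
    substitution_squares(5)[OF L_def N_def L_nz E_eq T_def this, where y = y]
  have pow4: "(u + v)^4 = u^4 + v^4" for u v :: 'f
  proof -
    have "(u + v)^4 = ((u + v)^2)^2" by (simp flip: power_mult)
    then show ?thesis by (simp add: sq_F flip: power_mult)
  qed
  have ZL: "E^2 * Z * L = N" and VL: "E^2 * V * L = \<iota> \<mu>\<^sub>1 * L + \<iota> \<mu>\<^sub>2 * N + E * y"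
    unfolding Z0 V0 using L_nz by (simp_all only: distrib_right) simp_all
  have Eb': "E^4 * \<iota> b' = \<iota> b" unfolding E_def using arg_cong[OF b', of \<iota>] by (simp add: hom_mult hom_power)
  have Ea': "\<iota> a' = E^2 * \<iota> a + E * \<iota> (\<mu>\<^sub>4 * \<mu>\<^sub>5) + \<iota> \<mu>\<^sub>2^4 + \<iota> \<mu>\<^sub>5^4 * (\<iota> c + \<iota> a * \<iota> b^2)"
    unfolding a' by (simp add: E_def hom_mult hom_add hom_power algebra_simps)
  have Ec': "E^8 * \<iota> c' = \<iota> \<mu>\<^sub>1^4 + E * \<iota> (\<mu>\<^sub>4 * \<mu>\<^sub>5) * \<iota> b^2 + \<iota> c * \<iota> \<mu>\<^sub>4^4 + \<iota> a * \<iota> b^4 * \<iota> \<mu>\<^sub>5^4"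
    unfolding E_def using arg_cong[OF c'', of \<iota>] by (simp add: hom_mult hom_add hom_power algebra_simps)
  have y4: "y^4 = \<iota> a * z^4 + z * T + \<iota> c"
  proof -
    have "y^4 + (\<iota> a * z^4 + z * T + \<iota> c) = quartic_b (\<iota> a) (\<iota> b) (\<iota> c) z y"
      by (simp add: quartic_b_def T_def algebra_simps power2_eq_square power3_eq_cube)
    then show ?thesis using quartic by (simp add: add_eq_0_iff char2_F)
  qed
  have E2: "E^2 = \<iota> \<mu>\<^sub>4^4 + \<iota> \<mu>\<^sub>5^4 * \<iota> b^2"
    unfolding E_def hom_power[symmetric] e2 by (simp add: hom_mult hom_add hom_power)
  have c_part: "(\<iota> \<mu>\<^sub>5 * N)^4 + (\<iota> \<mu>\<^sub>4 * L)^4 = E^4"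
  proof -
    have "\<iota> \<mu>\<^sub>5 * N + \<iota> \<mu>\<^sub>4 * L = E" by (simp add: L_def N_def E_def \<epsilon> hom_add hom_mult hom_power normF)
    then show ?thesis by (simp flip: pow4)
  qed
  have a_part: "(\<iota> \<mu>\<^sub>4 * N)^4 + (\<iota> b * \<iota> \<mu>\<^sub>5 * L)^4 = (E * z)^4"
  proof -
    have "\<iota> \<mu>\<^sub>4 * N + \<iota> b * \<iota> \<mu>\<^sub>5 * L = E * z" by (simp add: L_def N_def E_def \<epsilon> hom_add hom_mult hom_power normF)
    then show ?thesis by (simp flip: pow4)
  qed
  have mixed: "N^4 + \<iota> b^2 * L^4 = E^2 * T^2"
  proof -
    have "(N^2 + \<iota> b * L^2)^2 = (E * T)^2" by (simp only: sq(1))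
    then show ?thesis by (simp add: sq_F power_mult_distrib flip: power_mult)
  qed
  have "E^8 * L^4 * quartic_b (\<iota> a') (\<iota> b') (\<iota> c') Z V
      = (E^2 * V * L)^4 + \<iota> a' * (E^2 * Z * L)^4 + E^2 * (E^2 * Z * L)^3 * L
        + E^2 * (E^4 * \<iota> b') * (E^2 * Z * L) * L^3 + (E^8 * \<iota> c') * L^4"
    unfolding quartic_b_def
    by (simp only: distrib_left power_mult_distrib) (simp add: numeral_eq_Suc ac_simps)
  also have "\<dots> = (\<iota> \<mu>\<^sub>1^4 * L^4 + \<iota> \<mu>\<^sub>2^4 * N^4 + E^4 * y^4) + \<iota> a' * N^4
      + E^2 * (N * L) * (N^2 + \<iota> b * L^2) + (E^8 * \<iota> c') * L^4"
    unfolding ZL VL Eb' pow4 power_mult_distrib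
    by (simp add: algebra_simps power2_eq_square power3_eq_cube)
  also have "\<dots> = E * \<iota> (\<mu>\<^sub>4 * \<mu>\<^sub>5) * (N^4 + \<iota> b^2 * L^4) + E^3 * \<iota> (\<mu>\<^sub>4 * \<mu>\<^sub>5) * T^2
      + \<iota> c * ((\<iota> \<mu>\<^sub>5 * N)^4 + (\<iota> \<mu>\<^sub>4 * L)^4 + E^4)
      + \<iota> a * ((\<iota> \<mu>\<^sub>4 * N)^4 + (\<iota> b * \<iota> \<mu>\<^sub>5 * L)^4 + (E * z)^4)"
  proof -
    define P where "P = \<iota> (\<mu>\<^sub>4 * \<mu>\<^sub>5)"
    have "\<iota> a' * N^4 = (\<iota> a * (\<iota> \<mu>\<^sub>4^4 + \<iota> \<mu>\<^sub>5^4 * \<iota> b^2) + E * P + \<iota> \<mu>\<^sub>2^4 + \<iota> \<mu>\<^sub>5^4 * (\<iota> c + \<iota> a * \<iota> b^2)) * N^4"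
      unfolding Ea' P_def E2 by (simp add: mult.commute)
    also have "\<dots> = (\<iota> a * \<iota> \<mu>\<^sub>4^4 + E * P + \<iota> \<mu>\<^sub>2^4 + \<iota> \<mu>\<^sub>5^4 * \<iota> c) * N^4"
      by (simp add: algebra_simps char2_F)
    finally have 1: "\<iota> a' * N^4 = \<dots>" .
    have 2: "E^2 * (N * L) * (N^2 + \<iota> b * L^2) = E^3 * P * T^2 + E^4 * (z * T)"
      unfolding sq(1,2) P_def by (simp add: algebra_simps numeral_eq_Suc)
    show ?thesis unfolding 1 2 Ec' y4 P_def[symmetric] power_mult_distrib
      by (simp add: algebra_simps char2_F)
  qed
  also have "\<dots> = 0"
    unfolding mixed c_part a_part by (simp add: algebra_simps numeral_eq_Suc char2_F)
  finally show "quartic_b (\<iota> a') (\<iota> b') (\<iota> c') Z V = 0" using E_nz L_nz by simp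
qed

section \<open>Classification\<close>

text \<open>
  An isomorphism carries the span of \<open>(z', y')\<close> onto that of the images, and polynomial values onto
  polynomial values.
\<close>
lemma transport_generators:
  assumes \<sigma>: "K_isomorphism \<iota>' \<iota> \<sigma>"
    and span: "field_span (range \<iota>' \<union> {z', y'}) = UNIV" and tr: "transcendental_over \<iota>' z'"
  shows "field_span (range \<iota> \<union> {\<sigma> z', \<sigma> y'}) = UNIV" "transcendental_over \<iota> (\<sigma> z')"
proof -
  interpret \<sigma>: field_isom \<sigma> using \<sigma> by (simp add: K_isomorphism_def)
  have \<iota>: "\<iota> k = \<sigma> (\<iota>' k)" for k using \<sigma> by (simp add: K_isomorphism_def)
  let ?S = "field_span (range \<iota> \<union> {\<sigma> z', \<sigma> y'})"
  have "\<sigma> u \<in> ?S" if "u \<in> field_span (range \<iota>' \<union> {z', y'})" for u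
    using that
  proof induction
    case (incl u)
    then show ?case by (auto simp flip: \<iota> intro!: field_span.incl)
  qed (auto simp: \<sigma>.hom_uminus \<sigma>.hom_add \<sigma>.hom_mult \<sigma>.hom_inverse intro: field_span.intros)
  then have "\<sigma> u \<in> ?S" for u unfolding span by blast
  then show "?S = UNIV" using \<sigma>.surj by (metis UNIV_eq_I surjD)
  have "poly (map_poly \<iota> p) (\<sigma> z') = \<sigma> (poly (map_poly \<iota>' p) z')" for p
  proof -
    have "map_poly \<iota> p = map_poly \<sigma> (map_poly \<iota>' p)"
      unfolding \<iota>[abs_def] by (simp add: map_poly_map_poly o_def)
    then show ?thesis by simp
  qed
  then show "transcendental_over \<iota> (\<sigma> z')" using tr by (simp add: transcendental_over_def)
qed

lemma type_a_transport:
  assumes \<sigma>: "K_isomorphism \<iota>' \<iota> \<sigma>" and t: "type_a \<iota>' z' y' a b c d" and \<iota>: "field_hom \<iota>"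
  shows "type_a \<iota> (\<sigma> z') (\<sigma> y') a b c d"
proof -
  interpret \<sigma>: field_isom \<sigma> using \<sigma> by (simp add: K_isomorphism_def)
  have "quartic_a (\<iota> a) (\<iota> b) (\<iota> c) (\<iota> d) (\<sigma> z') (\<sigma> y')
      = \<sigma> (quartic_a (\<iota>' a) (\<iota>' b) (\<iota>' c) (\<iota>' d) z' y')"
    using \<sigma> by (simp add: quartic_a_def K_isomorphism_def \<sigma>.hom_add \<sigma>.hom_mult \<sigma>.hom_power)
  then show ?thesis
    using t transport_generators[OF \<sigma>, of z' y'] \<iota> unfolding type_a_def by simp
qed

lemma type_b_transport:
  assumes \<sigma>: "K_isomorphism \<iota>' \<iota> \<sigma>" and t: "type_b \<iota>' z' y' a b c" and \<iota>: "field_hom \<iota>"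
  shows "type_b \<iota> (\<sigma> z') (\<sigma> y') a b c"
proof -
  interpret \<sigma>: field_isom \<sigma> using \<sigma> by (simp add: K_isomorphism_def)
  have "quartic_b (\<iota> a) (\<iota> b) (\<iota> c) (\<sigma> z') (\<sigma> y')
      = \<sigma> (quartic_b (\<iota>' a) (\<iota>' b) (\<iota>' c) z' y')"
    using \<sigma> by (simp add: quartic_b_def K_isomorphism_def \<sigma>.hom_add \<sigma>.hom_mult \<sigma>.hom_power)
  then show ?thesis
    using t transport_generators[OF \<sigma>, of z' y'] \<iota> unfolding type_b_def by simp
qed

lemma type_c_transport:
  assumes \<sigma>: "K_isomorphism \<iota>' \<iota> \<sigma>" and t: "type_c \<iota>' z' y' a b c d" and \<iota>: "field_hom \<iota>"
  shows "type_c \<iota> (\<sigma> z') (\<sigma> y') a b c d"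
proof -
  interpret \<sigma>: field_isom \<sigma> using \<sigma> by (simp add: K_isomorphism_def)
  have "quartic_c (\<iota> a) (\<iota> b) (\<iota> c) (\<iota> d) (\<sigma> z') (\<sigma> y')
      = \<sigma> (quartic_c (\<iota>' a) (\<iota>' b) (\<iota>' c) (\<iota>' d) z' y')"
    using \<sigma> by (simp add: quartic_c_def K_isomorphism_def \<sigma>.hom_add \<sigma>.hom_mult \<sigma>.hom_power)
  then show ?thesis
    using t transport_generators[OF \<sigma>, of z' y'] \<iota> unfolding type_c_def by simp
qed

lemma
  fixes \<iota> :: "'k::field \<Rightarrow> 'f::field"
  assumes "CHAR('k) = 2"
  shows pair_a_if_type_a: "type_a \<iota> z y a b c d \<Longrightarrow> pair_a \<iota> z y a b c d"
    and pair_b_if_type_b: "type_b \<iota> z y a b c \<Longrightarrow> pair_b \<iota> z y a b c"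
    and pair_c_if_type_c: "type_c \<iota> z y a b c d \<Longrightarrow> pair_c \<iota> z y a b c d"
  using assms by (simp_all add: pair_a_def pair_a_axioms_def type_a_def pair_b_def pair_b_axioms_def type_b_def
      pair_c_def pair_c_axioms_def type_c_def char2_ext_def char2_ext_axioms_def)

lemma ev2_quartic_a:
  assumes "field_hom \<iota>"
  shows "ev2 \<iota> Z V (quartic_a [:[:a:]:] [:[:b:]:] [:[:c:]:] [:[:d:]:] [:[:0, 1:]:] [:0, 1:]) = quartic_a (\<iota> a) (\<iota> b) (\<iota> c) (\<iota> d) Z V"
  by (simp only: quartic_a_def ev2_simps(1-6,8-11)[OF assms])

lemma classification_a:
  fixes \<iota> :: "'k::field \<Rightarrow> 'f::field" and \<iota>' :: "'k \<Rightarrow> 'g::field"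
  assumes char: "CHAR('k) = 2" and t: "type_a \<iota> z y a b c d" and t': "type_a \<iota>' z' y' a' b' c' d'"
  shows "K_isomorphic \<iota>' \<iota> \<longleftrightarrow> (\<exists>\<mu>\<^sub>2 \<mu>\<^sub>3 \<mu>\<^sub>4 \<mu>\<^sub>5. constants_a a b c d a' b' c' d' \<mu>\<^sub>2 \<mu>\<^sub>3 \<mu>\<^sub>4 \<mu>\<^sub>5)"
    and "K_isomorphism \<iota>' \<iota> \<sigma> \<Longrightarrow> \<exists>\<mu>\<^sub>2 \<mu>\<^sub>3 \<mu>\<^sub>4 \<mu>\<^sub>5. constants_a a b c d a' b' c' d' \<mu>\<^sub>2 \<mu>\<^sub>3 \<mu>\<^sub>4 \<mu>\<^sub>5
      \<and> (\<sigma> z', \<sigma> y') = images_a \<iota> z y a \<mu>\<^sub>2 \<mu>\<^sub>3 \<mu>\<^sub>4 \<mu>\<^sub>5"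
    and "constants_a a b c d a' b' c' d' \<mu>\<^sub>2 \<mu>\<^sub>3 \<mu>\<^sub>4 \<mu>\<^sub>5 \<Longrightarrow>
      \<exists>!\<sigma>. K_isomorphism \<iota>' \<iota> \<sigma> \<and> (\<sigma> z', \<sigma> y') = images_a \<iota> z y a \<mu>\<^sub>2 \<mu>\<^sub>3 \<mu>\<^sub>4 \<mu>\<^sub>5"
    and "(\<mu>\<^sub>4, \<mu>\<^sub>5) \<noteq> (0, 0) \<Longrightarrow> eps a \<mu>\<^sub>4 \<mu>\<^sub>5 \<noteq> 0"
proof -
  interpret pair_a \<iota> z y a b c d by (rule pair_a_if_type_a[OF char t])
  have hom': "field_hom \<iota>'" using t' by (simp add: type_a_def)
  show forward: "\<exists>\<mu>\<^sub>2 \<mu>\<^sub>3 \<mu>\<^sub>4 \<mu>\<^sub>5. constants_a a b c d a' b' c' d' \<mu>\<^sub>2 \<mu>\<^sub>3 \<mu>\<^sub>4 \<mu>\<^sub>5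
      \<and> (\<sigma> z', \<sigma> y') = images_a \<iota> z y a \<mu>\<^sub>2 \<mu>\<^sub>3 \<mu>\<^sub>4 \<mu>\<^sub>5" if "K_isomorphism \<iota>' \<iota> \<sigma>" for \<sigma>
  proof -
    interpret two_pairs_a \<iota> z y a b c d "\<sigma> z'" "\<sigma> y'" a' b' c' d'
      by (intro two_pairs_a.intro pair_a_axioms pair_a_if_type_a[OF char] type_a_transport[OF that t'] field_hom_axioms)
    show ?thesis by (rule normal_form) blast
  qed
  show backward: "\<exists>!\<sigma>. K_isomorphism \<iota>' \<iota> \<sigma> \<and> (\<sigma> z', \<sigma> y') = images_a \<iota> z y a \<mu>\<^sub>2 \<mu>\<^sub>3 \<mu>\<^sub>4 \<mu>\<^sub>5"
    if const: "constants_a a b c d a' b' c' d' \<mu>\<^sub>2 \<mu>\<^sub>3 \<mu>\<^sub>4 \<mu>\<^sub>5"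
    for \<mu>\<^sub>2 \<mu>\<^sub>3 \<mu>\<^sub>4 \<mu>\<^sub>5
  proof -
    obtain Z V where ZV: "images_a \<iota> z y a \<mu>\<^sub>2 \<mu>\<^sub>3 \<mu>\<^sub>4 \<mu>\<^sub>5 = (Z, V)" by fastforce
    note C = converse[OF const ZV[symmetric]]
    show ?thesis unfolding ZV
      by (rule ex1_K_isomorphism[OF field_hom_axioms hom' C(2) _ C(1), where Q = "quartic_a [:[:a':]:] [:[:b':]:]
            [:[:c':]:] [:[:d':]:] [:[:0, 1:]:] [:0, 1:]"])
        (use t' C(3) in \<open>simp_all only: type_a_def ev2_quartic_a[OF field_hom_axioms] ev2_quartic_a[OF hom']\<close>)
  qed
  show "K_isomorphic \<iota>' \<iota> \<longleftrightarrow> (\<exists>\<mu>\<^sub>2 \<mu>\<^sub>3 \<mu>\<^sub>4 \<mu>\<^sub>5. constants_a a b c d a' b' c' d' \<mu>\<^sub>2 \<mu>\<^sub>3 \<mu>\<^sub>4 \<mu>\<^sub>5)"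
  proof
    assume "K_isomorphic \<iota>' \<iota>"
    then obtain \<sigma> where "K_isomorphism \<iota>' \<iota> \<sigma>" unfolding K_isomorphic_def ..
    from forward[OF this] show "\<exists>\<mu>\<^sub>2 \<mu>\<^sub>3 \<mu>\<^sub>4 \<mu>\<^sub>5. constants_a a b c d a' b' c' d' \<mu>\<^sub>2 \<mu>\<^sub>3 \<mu>\<^sub>4 \<mu>\<^sub>5" by blast
  next
    assume "\<exists>\<mu>\<^sub>2 \<mu>\<^sub>3 \<mu>\<^sub>4 \<mu>\<^sub>5. constants_a a b c d a' b' c' d' \<mu>\<^sub>2 \<mu>\<^sub>3 \<mu>\<^sub>4 \<mu>\<^sub>5"
    then obtain \<mu>\<^sub>2 \<mu>\<^sub>3 \<mu>\<^sub>4 \<mu>\<^sub>5 where "constants_a a b c d a' b' c' d' \<mu>\<^sub>2 \<mu>\<^sub>3 \<mu>\<^sub>4 \<mu>\<^sub>5" by blast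
    from ex1_implies_ex[OF backward[OF this]] show "K_isomorphic \<iota>' \<iota>"
      unfolding K_isomorphic_def by blast
  qed
  show "eps a \<mu>\<^sub>4 \<mu>\<^sub>5 \<noteq> 0" if "(\<mu>\<^sub>4, \<mu>\<^sub>5) \<noteq> (0, 0)"
    using not_square_ratio[OF a_not_square, of \<mu>\<^sub>4 \<mu>\<^sub>5] that unfolding eps_def by blast
qed

lemma ev2_quartic_b:
  assumes "field_hom \<iota>"
  shows "ev2 \<iota> Z V (quartic_b [:[:a:]:] [:[:b:]:] [:[:c:]:] [:[:0, 1:]:] [:0, 1:]) = quartic_b (\<iota> a) (\<iota> b) (\<iota> c) Z V"
  by (simp only: quartic_b_def ev2_simps(1-6,8-11)[OF assms])

lemma classification_b:
  fixes \<iota> :: "'k::field \<Rightarrow> 'f::field" and \<iota>' :: "'k \<Rightarrow> 'g::field"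
  assumes char: "CHAR('k) = 2" and t: "type_b \<iota> z y a b c" and t': "type_b \<iota>' z' y' a' b' c'"
  shows "K_isomorphic \<iota>' \<iota> \<longleftrightarrow> (\<exists>\<mu>\<^sub>1 \<mu>\<^sub>2 \<mu>\<^sub>4 \<mu>\<^sub>5. constants_b a b c a' b' c' \<mu>\<^sub>1 \<mu>\<^sub>2 \<mu>\<^sub>4 \<mu>\<^sub>5)"
    and "K_isomorphism \<iota>' \<iota> \<sigma> \<Longrightarrow> \<exists>\<mu>\<^sub>1 \<mu>\<^sub>2 \<mu>\<^sub>4 \<mu>\<^sub>5. constants_b a b c a' b' c' \<mu>\<^sub>1 \<mu>\<^sub>2 \<mu>\<^sub>4 \<mu>\<^sub>5
      \<and> (\<sigma> z', \<sigma> y') = images_b \<iota> z y b \<mu>\<^sub>1 \<mu>\<^sub>2 \<mu>\<^sub>4 \<mu>\<^sub>5"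
    and "constants_b a b c a' b' c' \<mu>\<^sub>1 \<mu>\<^sub>2 \<mu>\<^sub>4 \<mu>\<^sub>5 \<Longrightarrow>
      \<exists>!\<sigma>. K_isomorphism \<iota>' \<iota> \<sigma> \<and> (\<sigma> z', \<sigma> y') = images_b \<iota> z y b \<mu>\<^sub>1 \<mu>\<^sub>2 \<mu>\<^sub>4 \<mu>\<^sub>5"
    and "(\<mu>\<^sub>4, \<mu>\<^sub>5) \<noteq> (0, 0) \<Longrightarrow> eps b \<mu>\<^sub>4 \<mu>\<^sub>5 \<noteq> 0"
proof -
  interpret pair_b \<iota> z y a b c by (rule pair_b_if_type_b[OF char t])
  have hom': "field_hom \<iota>'" using t' by (simp add: type_b_def)
  show forward: "\<exists>\<mu>\<^sub>1 \<mu>\<^sub>2 \<mu>\<^sub>4 \<mu>\<^sub>5. constants_b a b c a' b' c' \<mu>\<^sub>1 \<mu>\<^sub>2 \<mu>\<^sub>4 \<mu>\<^sub>5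
      \<and> (\<sigma> z', \<sigma> y') = images_b \<iota> z y b \<mu>\<^sub>1 \<mu>\<^sub>2 \<mu>\<^sub>4 \<mu>\<^sub>5" if "K_isomorphism \<iota>' \<iota> \<sigma>" for \<sigma>
  proof -
    interpret two_pairs_b \<iota> z y a b c "\<sigma> z'" "\<sigma> y'" a' b' c'
      by (intro two_pairs_b.intro pair_b_axioms pair_b_if_type_b[OF char] type_b_transport[OF that t'] field_hom_axioms)
    show ?thesis by (rule normal_form) blast
  qed
  show backward: "\<exists>!\<sigma>. K_isomorphism \<iota>' \<iota> \<sigma> \<and> (\<sigma> z', \<sigma> y') = images_b \<iota> z y b \<mu>\<^sub>1 \<mu>\<^sub>2 \<mu>\<^sub>4 \<mu>\<^sub>5"
    if const: "constants_b a b c a' b' c' \<mu>\<^sub>1 \<mu>\<^sub>2 \<mu>\<^sub>4 \<mu>\<^sub>5"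
    for \<mu>\<^sub>1 \<mu>\<^sub>2 \<mu>\<^sub>4 \<mu>\<^sub>5
  proof -
    obtain Z V where ZV: "images_b \<iota> z y b \<mu>\<^sub>1 \<mu>\<^sub>2 \<mu>\<^sub>4 \<mu>\<^sub>5 = (Z, V)" by fastforce
    note C = converse[OF const ZV[symmetric]]
    show ?thesis unfolding ZV
      by (rule ex1_K_isomorphism[OF field_hom_axioms hom' C(2) _ C(1), where Q = "quartic_b [:[:a':]:] [:[:b':]:]
            [:[:c':]:] [:[:0, 1:]:] [:0, 1:]"])
        (use t' C(3) in \<open>simp_all only: type_b_def ev2_quartic_b[OF field_hom_axioms] ev2_quartic_b[OF hom']\<close>)
  qed
  show "K_isomorphic \<iota>' \<iota> \<longleftrightarrow> (\<exists>\<mu>\<^sub>1 \<mu>\<^sub>2 \<mu>\<^sub>4 \<mu>\<^sub>5. constants_b a b c a' b' c' \<mu>\<^sub>1 \<mu>\<^sub>2 \<mu>\<^sub>4 \<mu>\<^sub>5)"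
  proof
    assume "K_isomorphic \<iota>' \<iota>"
    then obtain \<sigma> where "K_isomorphism \<iota>' \<iota> \<sigma>" unfolding K_isomorphic_def ..
    from forward[OF this] show "\<exists>\<mu>\<^sub>1 \<mu>\<^sub>2 \<mu>\<^sub>4 \<mu>\<^sub>5. constants_b a b c a' b' c' \<mu>\<^sub>1 \<mu>\<^sub>2 \<mu>\<^sub>4 \<mu>\<^sub>5" by blast
  next
    assume "\<exists>\<mu>\<^sub>1 \<mu>\<^sub>2 \<mu>\<^sub>4 \<mu>\<^sub>5. constants_b a b c a' b' c' \<mu>\<^sub>1 \<mu>\<^sub>2 \<mu>\<^sub>4 \<mu>\<^sub>5"
    then obtain \<mu>\<^sub>1 \<mu>\<^sub>2 \<mu>\<^sub>4 \<mu>\<^sub>5 where "constants_b a b c a' b' c' \<mu>\<^sub>1 \<mu>\<^sub>2 \<mu>\<^sub>4 \<mu>\<^sub>5" by blast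
    from ex1_implies_ex[OF backward[OF this]] show "K_isomorphic \<iota>' \<iota>"
      unfolding K_isomorphic_def by blast
  qed
  show "eps b \<mu>\<^sub>4 \<mu>\<^sub>5 \<noteq> 0" if "(\<mu>\<^sub>4, \<mu>\<^sub>5) \<noteq> (0, 0)"
    using not_square_ratio[OF b_not_square, of \<mu>\<^sub>4 \<mu>\<^sub>5] that unfolding eps_def by blast
qed

lemma ev2_quartic_c:
  assumes "field_hom \<iota>"
  shows "ev2 \<iota> Z V (quartic_c [:[:a:]:] [:[:b:]:] [:[:c:]:] [:[:d:]:] [:[:0, 1:]:] [:0, 1:]) = quartic_c (\<iota> a) (\<iota> b) (\<iota> c) (\<iota> d) Z V"
  by (simp only: quartic_c_def ev2_simps(1-6,8-11)[OF assms])

lemma classification_c: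
  fixes \<iota> :: "'k::field \<Rightarrow> 'f::field" and \<iota>' :: "'k \<Rightarrow> 'g::field"
  assumes char: "CHAR('k) = 2" and t: "type_c \<iota> z y a b c d" and t': "type_c \<iota>' z' y' a' b' c' d'"
  shows "K_isomorphic \<iota>' \<iota> \<longleftrightarrow> (\<exists>\<mu>\<^sub>2 \<mu>\<^sub>3 \<mu>\<^sub>4 \<mu>\<^sub>5. constants_c a b c d a' b' c' d' \<mu>\<^sub>2 \<mu>\<^sub>3 \<mu>\<^sub>4 \<mu>\<^sub>5)"
    and "K_isomorphism \<iota>' \<iota> \<sigma> \<Longrightarrow> \<exists>\<mu>\<^sub>2 \<mu>\<^sub>3 \<mu>\<^sub>4 \<mu>\<^sub>5. constants_c a b c d a' b' c' d' \<mu>\<^sub>2 \<mu>\<^sub>3 \<mu>\<^sub>4 \<mu>\<^sub>5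
      \<and> (\<sigma> z', \<sigma> y') = images_c \<iota> z y b \<mu>\<^sub>2 \<mu>\<^sub>3 \<mu>\<^sub>4 \<mu>\<^sub>5"
    and "constants_c a b c d a' b' c' d' \<mu>\<^sub>2 \<mu>\<^sub>3 \<mu>\<^sub>4 \<mu>\<^sub>5 \<Longrightarrow>
      \<exists>!\<sigma>. K_isomorphism \<iota>' \<iota> \<sigma> \<and> (\<sigma> z', \<sigma> y') = images_c \<iota> z y b \<mu>\<^sub>2 \<mu>\<^sub>3 \<mu>\<^sub>4 \<mu>\<^sub>5"
    and "(\<mu>\<^sub>4, \<mu>\<^sub>5) \<noteq> (0, 0) \<Longrightarrow> eps b \<mu>\<^sub>4 \<mu>\<^sub>5 \<noteq> 0"
proof -
  interpret pair_c \<iota> z y a b c d by (rule pair_c_if_type_c[OF char t])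
  have hom': "field_hom \<iota>'" using t' by (simp add: type_c_def)
  have b'_nz: "b' \<noteq> 0" using t' by (auto simp: type_c_def squares_def intro: image_eqI[where x = 0])
  show forward: "\<exists>\<mu>\<^sub>2 \<mu>\<^sub>3 \<mu>\<^sub>4 \<mu>\<^sub>5. constants_c a b c d a' b' c' d' \<mu>\<^sub>2 \<mu>\<^sub>3 \<mu>\<^sub>4 \<mu>\<^sub>5
      \<and> (\<sigma> z', \<sigma> y') = images_c \<iota> z y b \<mu>\<^sub>2 \<mu>\<^sub>3 \<mu>\<^sub>4 \<mu>\<^sub>5" if "K_isomorphism \<iota>' \<iota> \<sigma>" for \<sigma>
  proof -
    interpret two_pairs_c \<iota> z y a b c d "\<sigma> z'" "\<sigma> y'" a' b' c' d'
      by (intro two_pairs_c.intro pair_c_axioms pair_c_if_type_c[OF char] type_c_transport[OF that t'] field_hom_axioms)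
    show ?thesis by (rule normal_form) blast
  qed
  show backward: "\<exists>!\<sigma>. K_isomorphism \<iota>' \<iota> \<sigma> \<and> (\<sigma> z', \<sigma> y') = images_c \<iota> z y b \<mu>\<^sub>2 \<mu>\<^sub>3 \<mu>\<^sub>4 \<mu>\<^sub>5"
    if const: "constants_c a b c d a' b' c' d' \<mu>\<^sub>2 \<mu>\<^sub>3 \<mu>\<^sub>4 \<mu>\<^sub>5"
    for \<mu>\<^sub>2 \<mu>\<^sub>3 \<mu>\<^sub>4 \<mu>\<^sub>5
  proof -
    obtain Z V where ZV: "images_c \<iota> z y b \<mu>\<^sub>2 \<mu>\<^sub>3 \<mu>\<^sub>4 \<mu>\<^sub>5 = (Z, V)" by fastforce
    note C = converse[OF const ZV[symmetric] b'_nz]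
    show ?thesis unfolding ZV
      by (rule ex1_K_isomorphism[OF field_hom_axioms hom' C(2) _ C(1), where Q = "quartic_c [:[:a':]:] [:[:b':]:]
            [:[:c':]:] [:[:d':]:] [:[:0, 1:]:] [:0, 1:]"])
        (use t' C(3) in \<open>simp_all only: type_c_def ev2_quartic_c[OF field_hom_axioms] ev2_quartic_c[OF hom']\<close>)
  qed
  show "K_isomorphic \<iota>' \<iota> \<longleftrightarrow> (\<exists>\<mu>\<^sub>2 \<mu>\<^sub>3 \<mu>\<^sub>4 \<mu>\<^sub>5. constants_c a b c d a' b' c' d' \<mu>\<^sub>2 \<mu>\<^sub>3 \<mu>\<^sub>4 \<mu>\<^sub>5)"
  proof
    assume "K_isomorphic \<iota>' \<iota>"
    then obtain \<sigma> where "K_isomorphism \<iota>' \<iota> \<sigma>" unfolding K_isomorphic_def ..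
    from forward[OF this] show "\<exists>\<mu>\<^sub>2 \<mu>\<^sub>3 \<mu>\<^sub>4 \<mu>\<^sub>5. constants_c a b c d a' b' c' d' \<mu>\<^sub>2 \<mu>\<^sub>3 \<mu>\<^sub>4 \<mu>\<^sub>5" by blast
  next
    assume "\<exists>\<mu>\<^sub>2 \<mu>\<^sub>3 \<mu>\<^sub>4 \<mu>\<^sub>5. constants_c a b c d a' b' c' d' \<mu>\<^sub>2 \<mu>\<^sub>3 \<mu>\<^sub>4 \<mu>\<^sub>5"
    then obtain \<mu>\<^sub>2 \<mu>\<^sub>3 \<mu>\<^sub>4 \<mu>\<^sub>5 where "constants_c a b c d a' b' c' d' \<mu>\<^sub>2 \<mu>\<^sub>3 \<mu>\<^sub>4 \<mu>\<^sub>5" by blast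
    from ex1_implies_ex[OF backward[OF this]] show "K_isomorphic \<iota>' \<iota>"
      unfolding K_isomorphic_def by blast
  qed
  show "eps b \<mu>\<^sub>4 \<mu>\<^sub>5 \<noteq> 0" if "(\<mu>\<^sub>4, \<mu>\<^sub>5) \<noteq> (0, 0)"
    using not_square_ratio[OF b_not_square, of \<mu>\<^sub>4 \<mu>\<^sub>5] that unfolding eps_def by blast
qed

theorem proposition3p10:
  fixes \<iota> :: "'k::field \<Rightarrow> 'f::field" and \<iota>' :: "'k \<Rightarrow> 'g::field"
    and z y :: 'f and z' y' :: 'g
  assumes "CHAR('k) = 2"
  shows "
    (\<forall>a b c d a' b' c' d'.
       type_a \<iota> z y a b c d \<and> type_a \<iota>' z' y' a' b' c' d' \<longrightarrow>
         (K_isomorphic \<iota>' \<iota> \<longleftrightarrow>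
            (\<exists>\<mu>\<^sub>2 \<mu>\<^sub>3 \<mu>\<^sub>4 \<mu>\<^sub>5. constants_a a b c d a' b' c' d' \<mu>\<^sub>2 \<mu>\<^sub>3 \<mu>\<^sub>4 \<mu>\<^sub>5))
         \<and> (\<forall>\<mu>\<^sub>4 \<mu>\<^sub>5. (\<mu>\<^sub>4, \<mu>\<^sub>5) \<noteq> (0, 0) \<longrightarrow> eps a \<mu>\<^sub>4 \<mu>\<^sub>5 \<noteq> 0)
         \<and> (\<forall>\<sigma>. K_isomorphism \<iota>' \<iota> \<sigma> \<longrightarrow>
              (\<exists>\<mu>\<^sub>2 \<mu>\<^sub>3 \<mu>\<^sub>4 \<mu>\<^sub>5. constants_a a b c d a' b' c' d' \<mu>\<^sub>2 \<mu>\<^sub>3 \<mu>\<^sub>4 \<mu>\<^sub>5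
                 \<and> (\<sigma> z', \<sigma> y') = images_a \<iota> z y a \<mu>\<^sub>2 \<mu>\<^sub>3 \<mu>\<^sub>4 \<mu>\<^sub>5))
         \<and> (\<forall>\<mu>\<^sub>2 \<mu>\<^sub>3 \<mu>\<^sub>4 \<mu>\<^sub>5. constants_a a b c d a' b' c' d' \<mu>\<^sub>2 \<mu>\<^sub>3 \<mu>\<^sub>4 \<mu>\<^sub>5 \<longrightarrow>
              (\<exists>!\<sigma>. K_isomorphism \<iota>' \<iota> \<sigma>
                 \<and> (\<sigma> z', \<sigma> y') = images_a \<iota> z y a \<mu>\<^sub>2 \<mu>\<^sub>3 \<mu>\<^sub>4 \<mu>\<^sub>5)))
    \<and> (\<forall>a b c a' b' c'.
       type_b \<iota> z y a b c \<and> type_b \<iota>' z' y' a' b' c' \<longrightarrow>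
         (K_isomorphic \<iota>' \<iota> \<longleftrightarrow>
            (\<exists>\<mu>\<^sub>1 \<mu>\<^sub>2 \<mu>\<^sub>4 \<mu>\<^sub>5. constants_b a b c a' b' c' \<mu>\<^sub>1 \<mu>\<^sub>2 \<mu>\<^sub>4 \<mu>\<^sub>5))
         \<and> (\<forall>\<mu>\<^sub>4 \<mu>\<^sub>5. (\<mu>\<^sub>4, \<mu>\<^sub>5) \<noteq> (0, 0) \<longrightarrow> eps b \<mu>\<^sub>4 \<mu>\<^sub>5 \<noteq> 0)
         \<and> (\<forall>\<sigma>. K_isomorphism \<iota>' \<iota> \<sigma> \<longrightarrow>
              (\<exists>\<mu>\<^sub>1 \<mu>\<^sub>2 \<mu>\<^sub>4 \<mu>\<^sub>5. constants_b a b c a' b' c' \<mu>\<^sub>1 \<mu>\<^sub>2 \<mu>\<^sub>4 \<mu>\<^sub>5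
                 \<and> (\<sigma> z', \<sigma> y') = images_b \<iota> z y b \<mu>\<^sub>1 \<mu>\<^sub>2 \<mu>\<^sub>4 \<mu>\<^sub>5))
         \<and> (\<forall>\<mu>\<^sub>1 \<mu>\<^sub>2 \<mu>\<^sub>4 \<mu>\<^sub>5. constants_b a b c a' b' c' \<mu>\<^sub>1 \<mu>\<^sub>2 \<mu>\<^sub>4 \<mu>\<^sub>5 \<longrightarrow>
              (\<exists>!\<sigma>. K_isomorphism \<iota>' \<iota> \<sigma>
                 \<and> (\<sigma> z', \<sigma> y') = images_b \<iota> z y b \<mu>\<^sub>1 \<mu>\<^sub>2 \<mu>\<^sub>4 \<mu>\<^sub>5)))
    \<and> (\<forall>a b c d a' b' c' d'.
       type_c \<iota> z y a b c d \<and> type_c \<iota>' z' y' a' b' c' d' \<longrightarrow>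
         (K_isomorphic \<iota>' \<iota> \<longleftrightarrow>
            (\<exists>\<mu>\<^sub>2 \<mu>\<^sub>3 \<mu>\<^sub>4 \<mu>\<^sub>5. constants_c a b c d a' b' c' d' \<mu>\<^sub>2 \<mu>\<^sub>3 \<mu>\<^sub>4 \<mu>\<^sub>5))
         \<and> (\<forall>\<mu>\<^sub>4 \<mu>\<^sub>5. (\<mu>\<^sub>4, \<mu>\<^sub>5) \<noteq> (0, 0) \<longrightarrow> eps b \<mu>\<^sub>4 \<mu>\<^sub>5 \<noteq> 0)
         \<and> (\<forall>\<sigma>. K_isomorphism \<iota>' \<iota> \<sigma> \<longrightarrow>
              (\<exists>\<mu>\<^sub>2 \<mu>\<^sub>3 \<mu>\<^sub>4 \<mu>\<^sub>5. constants_c a b c d a' b' c' d' \<mu>\<^sub>2 \<mu>\<^sub>3 \<mu>\<^sub>4 \<mu>\<^sub>5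
                 \<and> (\<sigma> z', \<sigma> y') = images_c \<iota> z y b \<mu>\<^sub>2 \<mu>\<^sub>3 \<mu>\<^sub>4 \<mu>\<^sub>5))
         \<and> (\<forall>\<mu>\<^sub>2 \<mu>\<^sub>3 \<mu>\<^sub>4 \<mu>\<^sub>5. constants_c a b c d a' b' c' d' \<mu>\<^sub>2 \<mu>\<^sub>3 \<mu>\<^sub>4 \<mu>\<^sub>5 \<longrightarrow>
              (\<exists>!\<sigma>. K_isomorphism \<iota>' \<iota> \<sigma>
                 \<and> (\<sigma> z', \<sigma> y') = images_c \<iota> z y b \<mu>\<^sub>2 \<mu>\<^sub>3 \<mu>\<^sub>4 \<mu>\<^sub>5)))
    "
  by (intro conjI allI impI; elim conjE;
      rule classification_a[OF assms] classification_b[OF assms] classification_c[OF assms]; assumption)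

end
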